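(* $$\sum_{\lambda} \frac{c_{\lambda}(t)\, P_{\lambda}(x;t)}{t^{o(\lambda)/2+|\lambda|/2}} = \prod_{i \geq 1} \frac{1+x_i/t}{1+x_i} \prod_{i \leq j} \frac{1-x_ix_j}{1-x_ix_j/t},$$ where the sum is over all partitions $\lambda$ (of all nonnegative integers) in which every even part occurs with even multiplicity.
   Context: For a partition $\lambda$, $|\lambda|$ denotes its size, $m_i(\lambda)$ the number of parts equal to $i$, and $o(\lambda)$ the number of odd parts (counted with multiplicity). The diagram of $\lambda$ is the set of boxes $(i,j)$ with $1\le j\le \lambda_i$ ($i$ is the row index, $j$ the column index). For a box $s$ of the diagram, the arm $a(s)$ is the number of boxes in the same row strictly to the east of $s$, and the leg $l(s)$ is the number of boxes in the same column strictly to the south of $s$. Define $$c_\lambda(t)=\prod_{s\in\lambda:\ a(s)=0,\ l(s)\text{ even}}\bigl(1-t^{l(s)+1}\bigr).$$ $P_\lambda(x;t)=P_\lambda(x_1,x_2,\dots;t)$ is the Hall-Littlewood polynomial (symmetric function) in infinitely many variables: for a partition $\lambda$ with $n$ parts (some possibly $0$), with $v_\lambda(t)=\prod_{i\ge 0}\prod_{j=1}^{m_i(\lambda)}\frac{1-t^j}{1-t}$, $$P_\lambda(x_1,\dots,x_n;t)=\frac1{v_\lambda(t)}\sum_{w\in S_n} w\Bigl(x_1^{\lambda_1}\cdots x_n^{\lambda_n}\prod_{i<j}\frac{x_i-tx_j}{x_i-x_j}\Bigr),$$ and one lets the number of variables go to infinity. The identity is an identity of formal power series in the $x_i$. Indices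 $i,j$ in the products run over positive integers. *)

theory Defs
  imports
    "HOL-Library.Poly_Mapping"
    "HOL-Computational_Algebra.Polynomial_Factorial"
    "HOL-Combinatorics.Permutations"
    "HOL-Analysis.Infinite_Sum"
begin

section \<open>Formal power series in infinitely many variables\<close>

text \<open>
  The variables are indexed by \<^typ>\<open>nat\<close>, starting at 0: the mathematical variable with index
  $i + 1$ is number $i$ here. A monomial is its exponent function, of type
  \<^typ>\<open>nat \<Rightarrow>\<^sub>0 nat\<close>, and \<^typ>\<open>(nat \<Rightarrow>\<^sub>0 nat) \<Rightarrow>\<^sub>0 'a\<close> is the ring of polynomials.
\<close>

typedef 'a mfps = "UNIV :: ((nat \<Rightarrow>\<^sub>0 nat) \<Rightarrow> 'a) set"
  morphisms mfps_coeff Abs_mfps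
  by simp

setup_lifting type_definition_mfps

lemma mfps_eqI: "(\<And>m. mfps_coeff f m = mfps_coeff g m) \<Longrightarrow> f = g"
  by (metis ext mfps_coeff_inject)

definition splits_of :: "(nat \<Rightarrow>\<^sub>0 nat) \<Rightarrow> ((nat \<Rightarrow>\<^sub>0 nat) \<times> (nat \<Rightarrow>\<^sub>0 nat)) set" where
  "splits_of m = {(a, b). a + b = m}"

lemma finite_splits_of [simp]: "finite (splits_of m)"
proof -
  let ?A = "{a. \<exists>b. a + b = m}"
  let ?B = "Max (insert 0 (Poly_Mapping.range m))"
  let ?F = "{f. \<forall>i. (i \<in> Poly_Mapping.keys m \<longrightarrow> f i \<in> {..?B}) \<and>
                 (i \<notin> Poly_Mapping.keys m \<longrightarrow> f i = (0::nat))}"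
  have "finite ?F"
    by (rule finite_set_of_finite_funs) auto
  moreover have "Poly_Mapping.lookup ` ?A \<subseteq> ?F"
  proof clarify
    fix a b i
    assume m: "m = a + b"
    have le: "Poly_Mapping.lookup a i \<le> Poly_Mapping.lookup (a + b) i"
      by (simp add: lookup_add)
    have "Poly_Mapping.lookup (a + b) i \<le> Max (insert 0 (Poly_Mapping.range (a + b)))"
      if "i \<in> Poly_Mapping.keys (a + b)"
      using that by (intro Max_ge) (auto simp: in_keys_lookup_in_range)
    with le order.trans[OF le] show "(i \<in> Poly_Mapping.keys (a + b) \<longrightarrow>
        Poly_Mapping.lookup a i \<in> {..Max (insert 0 (Poly_Mapping.range (a + b)))}) \<and>
        (i \<notin> Poly_Mapping.keys (a + b) \<longrightarrow> Poly_Mapping.lookup a i = 0)"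
      by (auto simp: in_keys_iff simp del: Max_insert)
  qed
  ultimately have "finite (Poly_Mapping.lookup ` ?A)"
    by (rule finite_subset[rotated])
  then have A: "finite ?A"
    by (rule finite_imageD) (auto intro!: inj_onI poly_mapping_eqI)
  have "splits_of m \<subseteq> (\<lambda>a. (a, m - a)) ` ?A"
    by (auto simp: splits_of_def image_iff)
  from finite_subset[OF this finite_imageI[OF A]] show ?thesis .
qed

lemma sum_splits_of_swap:
  "(\<Sum>(a, b) \<in> splits_of m. F a b) = (\<Sum>(a, b) \<in> splits_of m. F b a)"
  by (rule sum.reindex_bij_witness[where i = prod.swap and j = prod.swap])
     (auto simp: splits_of_def add.commute)

lemma sum_splits_of_assoc:
  "(\<Sum>(p, c) \<in> splits_of m. \<Sum>(a, b) \<in> splits_of p. F a b c) =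
   (\<Sum>(a, q) \<in> splits_of m. \<Sum>(b, c) \<in> splits_of q. F a b c)"
proof -
  have "(\<Sum>(p, c) \<in> splits_of m. \<Sum>(a, b) \<in> splits_of p. F a b c) =
        (\<Sum>((p, c), (a, b)) \<in> (SIGMA pc : splits_of m. splits_of (fst pc)). F a b c)"
    by (subst sum.Sigma[symmetric]) (auto simp: case_prod_beta)
  also have "\<dots> = (\<Sum>((a, q), (b, c)) \<in> (SIGMA aq : splits_of m. splits_of (snd aq)). F a b c)"
    by (rule sum.reindex_bij_witness
          [where i = "\<lambda>((a, q), (b, c)). ((a + b, c), (a, b))"
             and j = "\<lambda>((p, c), (a, b)). ((a, b + c), (b, c))"])
       (auto simp: splits_of_def add.assoc)
  also have "\<dots> = (\<Sum>(a, q) \<in> splits_of m. \<Sum>(b, c) \<in> splits_of q. F a b c)"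
    by (subst sum.Sigma[symmetric]) (auto simp: case_prod_beta)
  finally show ?thesis .
qed

instantiation mfps :: (comm_ring_1) comm_ring_1
begin

lift_definition zero_mfps :: "'a mfps" is "\<lambda>_. 0" .
lift_definition one_mfps :: "'a mfps" is "\<lambda>m. if m = 0 then 1 else 0" .
lift_definition plus_mfps :: "'a mfps \<Rightarrow> 'a mfps \<Rightarrow> 'a mfps" is "\<lambda>f g m. f m + g m" .
lift_definition minus_mfps :: "'a mfps \<Rightarrow> 'a mfps \<Rightarrow> 'a mfps" is "\<lambda>f g m. f m - g m" .
lift_definition uminus_mfps :: "'a mfps \<Rightarrow> 'a mfps" is "\<lambda>f m. - f m" .
lift_definition times_mfps :: "'a mfps \<Rightarrow> 'a mfps \<Rightarrow> 'a mfps" is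
  "\<lambda>f g m. \<Sum>(a, b) \<in> splits_of m. f a * g b" .

instance
proof
  fix f g h :: "'a mfps"
  show "f * g * h = f * (g * h)"
  proof (transfer, rule ext)
    fix f g h :: "(nat \<Rightarrow>\<^sub>0 nat) \<Rightarrow> 'a" and m
    show "(\<Sum>(p, c) \<in> splits_of m. (\<Sum>(a, b) \<in> splits_of p. f a * g b) * h c) =
          (\<Sum>(a, q) \<in> splits_of m. f a * (\<Sum>(b, c) \<in> splits_of q. g b * h c))"
      using sum_splits_of_assoc[where F = "\<lambda>a b c. f a * g b * h c" and m = m]
      by (simp add: sum_distrib_left sum_distrib_right case_prod_beta' mult.assoc)
  qed
  show "f * g = g * f"
  proof (transfer, rule ext)
    fix f g :: "(nat \<Rightarrow>\<^sub>0 nat) \<Rightarrow> 'a" and m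
    show "(\<Sum>(a, b) \<in> splits_of m. f a * g b) = (\<Sum>(a, b) \<in> splits_of m. g a * f b)"
      using sum_splits_of_swap[of "\<lambda>a b. f a * g b" m] by (simp only: mult.commute)
  qed
  show "1 * f = f"
  proof (transfer, rule ext)
    fix f :: "(nat \<Rightarrow>\<^sub>0 nat) \<Rightarrow> 'a" and m
    have "(\<Sum>(a, b) \<in> splits_of m. (if a = 0 then 1 else 0) * f b) =
          (\<Sum>(a, b) \<in> {(0 :: nat \<Rightarrow>\<^sub>0 nat, m)}. (if a = 0 then 1 else 0) * f b)"
      by (rule sum.mono_neutral_right, simp) (auto simp: splits_of_def split: if_splits)
    then show "(\<Sum>(a, b) \<in> splits_of m. (if a = 0 then 1 else 0) * f b) = f m"
      by simp
  qed
  show "(f + g) * h = f * h + g * h"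
    by transfer (simp add: distrib_right sum.distrib case_prod_beta')
  show "(0::'a mfps) \<noteq> 1"
    by transfer (auto dest: fun_cong[where x = 0])
qed (transfer; simp add: algebra_simps; fail)+

end

text \<open>
  For a series without multiplicative inverse the value is the junk value 0.
\<close>

instantiation mfps :: (comm_ring_1) inverse
begin

definition inverse_mfps :: "'a mfps \<Rightarrow> 'a mfps" where
  "inverse_mfps f = (if f dvd 1 then THE g. f * g = 1 else 0)"

definition divide_mfps :: "'a mfps \<Rightarrow> 'a mfps \<Rightarrow> 'a mfps" where
  "divide_mfps f g = f * inverse g"

instance ..

end

lemma mfps_inverse_unique:
  assumes "f * g = (1 :: 'a::comm_ring_1 mfps)"
  shows "inverse f = g"
proof -
  have "h = g" if "f * h = 1" for h
    using assms that by (metis mult.assoc mult.commute mult_1)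
  then have "(THE g. f * g = 1) = g"
    using assms by (rule the_equality[rotated])
  moreover have "f dvd 1"
    by (rule dvdI) (rule assms[symmetric])
  ultimately show ?thesis
    by (simp add: inverse_mfps_def)
qed

text \<open>
  The topology of coefficientwise convergence, each coefficient carrying the discrete topology:
  a net converges iff every coefficient is eventually constant.
\<close>

instantiation mfps :: (type) t2_space
begin

definition open_mfps :: "'a mfps set \<Rightarrow> bool" where
  "open_mfps U \<longleftrightarrow> (\<forall>f \<in> U. \<exists>M. finite M \<and>
     (\<forall>g. (\<forall>m \<in> M. mfps_coeff g m = mfps_coeff f m) \<longrightarrow> g \<in> U))"

instance
proof
  show "open (UNIV :: 'a mfps set)"
    unfolding open_mfps_def by (auto intro: exI[of _ "{}"])
next
  fix S T :: "'a mfps set"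
  assume S: "open S" and T: "open T"
  show "open (S \<inter> T)"
    unfolding open_mfps_def
  proof
    fix f assume f: "f \<in> S \<inter> T"
    obtain M where M: "finite M"
      "\<And>g. (\<forall>m \<in> M. mfps_coeff g m = mfps_coeff f m) \<Longrightarrow> g \<in> S"
      using S f unfolding open_mfps_def by blast
    obtain N where N: "finite N"
      "\<And>g. (\<forall>m \<in> N. mfps_coeff g m = mfps_coeff f m) \<Longrightarrow> g \<in> T"
      using T f unfolding open_mfps_def by blast
    show "\<exists>M. finite M \<and>
        (\<forall>g. (\<forall>m \<in> M. mfps_coeff g m = mfps_coeff f m) \<longrightarrow> g \<in> S \<inter> T)"
      using M N by (intro exI[of _ "M \<union> N"]) auto
  qed
next
  fix K :: "'a mfps set set"
  assume "\<forall>S \<in> K. open S"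
  then show "open (\<Union> K)"
    unfolding open_mfps_def by (meson UnionE UnionI)
next
  fix f g :: "'a mfps"
  assume "f \<noteq> g"
  then obtain m where m: "mfps_coeff f m \<noteq> mfps_coeff g m"
    using mfps_eqI by blast
  have "open {h. mfps_coeff h m = c}" for c :: 'a
    unfolding open_mfps_def by (auto intro!: exI[of _ "{m}"])
  with m show "\<exists>U V. open U \<and> open V \<and> f \<in> U \<and> g \<in> V \<and> U \<inter> V = {}"
    by (intro exI[of _ "{h. mfps_coeff h m = mfps_coeff f m}"]
              exI[of _ "{h. mfps_coeff h m = mfps_coeff g m}"]) auto
qed

end

lemma tendsto_mfps_iff:
  "(F \<longlongrightarrow> f) net \<longleftrightarrow> (\<forall>m. \<forall>\<^sub>F x in net. mfps_coeff (F x) m = mfps_coeff f m)"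
proof
  assume F: "(F \<longlongrightarrow> f) net"
  show "\<forall>m. \<forall>\<^sub>F x in net. mfps_coeff (F x) m = mfps_coeff f m"
  proof
    fix m
    have "open {h. mfps_coeff h m = mfps_coeff f m}"
      unfolding open_mfps_def by (auto intro!: exI[of _ "{m}"])
    from topological_tendstoD[OF F this]
    show "\<forall>\<^sub>F x in net. mfps_coeff (F x) m = mfps_coeff f m"
      by simp
  qed
next
  assume ev: "\<forall>m. \<forall>\<^sub>F x in net. mfps_coeff (F x) m = mfps_coeff f m"
  show "(F \<longlongrightarrow> f) net"
  proof (rule topological_tendstoI)
    fix U assume "open U" "f \<in> U"
    then obtain M where M: "finite M"
      "\<And>g. (\<forall>m \<in> M. mfps_coeff g m = mfps_coeff f m) \<Longrightarrow> g \<in> U"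
      unfolding open_mfps_def by blast
    have "\<forall>\<^sub>F x in net. \<forall>m \<in> M. mfps_coeff (F x) m = mfps_coeff f m"
      using M(1) ev by (simp add: eventually_ball_finite)
    then show "\<forall>\<^sub>F x in net. F x \<in> U"
      by (rule eventually_mono) (use M(2) in blast)
  qed
qed

text \<open>
  Unordered infinite product, the multiplicative counterpart of \<^const>\<open>infsum\<close>.
\<close>

definition infprod :: "('i \<Rightarrow> 'b::{comm_monoid_mult, t2_space}) \<Rightarrow> 'i set \<Rightarrow> 'b" where
  "infprod f A = Lim (finite_subsets_at_top A) (prod f)"

definition mfps_of_poly :: "((nat \<Rightarrow>\<^sub>0 nat) \<Rightarrow>\<^sub>0 'a::zero) \<Rightarrow> 'a mfps" where
  "mfps_of_poly p = Abs_mfps (Poly_Mapping.lookup p)"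

definition poly_const :: "'a \<Rightarrow> (nat \<Rightarrow>\<^sub>0 nat) \<Rightarrow>\<^sub>0 'a::zero" where
  "poly_const c = Poly_Mapping.single 0 c"

definition poly_var :: "nat \<Rightarrow> (nat \<Rightarrow>\<^sub>0 nat) \<Rightarrow>\<^sub>0 'a::zero_neq_one" where
  "poly_var i = Poly_Mapping.single (Poly_Mapping.single i 1) 1"

definition mfps_const :: "'a::zero \<Rightarrow> 'a mfps" where
  "mfps_const c = mfps_of_poly (poly_const c)"

definition mfps_var :: "nat \<Rightarrow> 'a::zero_neq_one mfps" where
  "mfps_var i = mfps_of_poly (poly_var i)"


section \<open>Partitions\<close>

text \<open>
  A partition is the weakly decreasing list of its (nonzero) parts. Rows and columns of the
  diagram are numbered from 0.
\<close>

definition is_partition :: "nat list \<Rightarrow> bool" where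
  "is_partition la \<longleftrightarrow> sorted_wrt (\<ge>) la \<and> 0 \<notin> set la"

definition odd_parts :: "nat list \<Rightarrow> nat" where
  "odd_parts la = length (filter odd la)"

definition diagram :: "nat list \<Rightarrow> (nat \<times> nat) set" where
  "diagram la = {(i, j). i < length la \<and> j < la ! i}"

definition arm :: "nat list \<Rightarrow> nat \<times> nat \<Rightarrow> nat" where
  "arm la s = card {(i, j) \<in> diagram la. i = fst s \<and> j > snd s}"

definition leg :: "nat list \<Rightarrow> nat \<times> nat \<Rightarrow> nat" where
  "leg la s = card {(i, j) \<in> diagram la. i > fst s \<and> j = snd s}"

definition c_factor :: "'a::comm_ring_1 \<Rightarrow> nat list \<Rightarrow> 'a" where
  "c_factor t la =
     (\<Prod>s \<in> {s \<in> diagram la. arm la s = 0 \<and> even (leg la s)}. 1 - t ^ (leg la s + 1))"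

text \<open>
  The exponent $o(\lambda)/2 + |\lambda|/2$ is therefore the natural number
  \<^term>\<open>(odd_parts la + sum_list la) div 2\<close>.
\<close>

lemma even_odd_parts_plus_size: "even (odd_parts la + sum_list la)"
  by (induction la) (auto simp: odd_parts_def)


section \<open>Hall-Littlewood functions\<close>

text \<open>
  In the next three definitions \<open>mu\<close> is a partition padded with zeros; the number of variables is
  \<^term>\<open>length mu\<close>.
\<close>

definition hl_v :: "'a::field \<Rightarrow> nat list \<Rightarrow> 'a" where
  "hl_v t mu = (\<Prod>i \<in> set mu. \<Prod>j = 1..count_list mu i. (1 - t ^ j) / (1 - t))"

text \<open>
  The permutation \<open>w\<close> acts on rational functions by replacing variable \<open>i\<close> by variable \<open>w i\<close>.
\<close>

definition hl_rational :: "'a::field \<Rightarrow> nat list \<Rightarrow> ((nat \<Rightarrow>\<^sub>0 nat) \<Rightarrow>\<^sub>0 'a) fract" where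
  "hl_rational t mu =
    (let n = length mu;
         C = (\<lambda>c. to_fract (poly_const c));
         X = (\<lambda>i. to_fract (poly_var i))
     in 1 / C (hl_v t mu) *
        (\<Sum>w | w permutes {..<n}.
           (\<Prod>i<n. X (w i) ^ (mu ! i)) *
           (\<Prod>(i, j) \<in> {(i, j). i < j \<and> j < n}. (X (w i) - C t * X (w j)) / (X (w i) - X (w j)))))"

text \<open>
  The rational function is in fact a polynomial, provided \<^term>\<open>hl_v t mu \<noteq> 0\<close>.
\<close>

definition hl_poly :: "'a::field \<Rightarrow> nat list \<Rightarrow> (nat \<Rightarrow>\<^sub>0 nat) \<Rightarrow>\<^sub>0 'a" where
  "hl_poly t mu = (THE p. to_fract p = hl_rational t mu)"

definition hall_littlewood :: "'a::field \<Rightarrow> nat list \<Rightarrow> 'a mfps" where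
  "hall_littlewood t la = lim (\<lambda>k. mfps_of_poly (hl_poly t (la @ replicate k 0)))"

end

theory Submission
  imports
    Defs
    "HOL-Computational_Algebra.Formal_Laurent_Series"
    "HOL-Combinatorics.Multiset_Permutations"
begin

text \<open>
  Functions of finite sets $S$ of variables form an associative algebra under
  $(f \star g)(S) = \sum_{T \subseteq S} f(T)\, g(S \setminus T)
  \prod_{i \in T,\, j \notin T} \frac{x_i - t x_j}{x_i - x_j}$,
  and $v_\lambda P_\lambda$ is the product of the elements $x^{\lambda_1}, x^{\lambda_2}, \ldots$
  supported on singletons. With $E_u(S) = \prod_{i \in S} u_i$, the weights in $c_\lambda$ are
  the constants $(E_1 \star E_{-1})(S)$ for even parts and $(E_{-t} \star E_1)(S)$ for odd parts.
  The contributions of two consecutive part sizes therefore merge, by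
  $E_{u a x} \star E_u = E_{u (1 + a x)}$, into the factor $V = E_{(1 + x/t)(1 - x)}$, and the left-hand
  side in finitely many variables is the infinite product
  $\cdots \star \tau^2 V \star \tau V \star V$, where $\tau$ multiplies by $\prod_{i \in S} x_i^2/t$.

  The right-hand side $F$ satisfies $F = \tau F \star V$. After division by a multiplicative
  factor this is Littlewood's identity for partitions with even parts, which is proved by
  interpolation in the last variable. Hence both sides agree up to a term divisible by
  $\tau^k$ for every $k$, so they agree in every degree.
\<close>

section \<open>Symmetrisation over a finite alphabet\<close>

text \<open>The parity condition on even parts needs no separate treatment:
  \<open>E_1 \<star> E_{-1}\<close> vanishes on sets of odd size, by Gauss's alternating sum of
  t-binomial coefficients. An even level is cut between its two factors: \<open>E_{-1}\<close> joins
  the odd level on its right and \<open>E_1\<close> the odd level on its left. The partial products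
  and F then have expansions with the same tail, starting from \<open>E_1\<close> and from F. These
  starting functions agree on the empty set, so every term of the difference carries \<tau>^k of a
  non-empty set. The obstacle is that this algebra consists of rational functions, with denominators
  x_i - x_j and 1 - x_i x_j / t, while the theorem is about coefficients. The letters are therefore
  specialised to X_i z in a field of Laurent series: there they are distinct, nonzero and satisfy
  x_i x_j \<noteq> t, and divisibility by \<tau>^k becomes an order of at least 2k in z. Multiplying
  by the denominator of F leaves a comparison of polynomials, and stability of each coefficient in
  the number of variables gives the limit.\<close>

lemma sum_Pow_insert:
  assumes "finite S" "k \<notin> S"
  shows "(\<Sum>T\<in>Pow (insert k S). h T) = (\<Sum>T\<in>Pow S. h T + h (insert k T))"
proof -
  have "inj_on (insert k) (Pow S)"
    using assms(2) by (auto simp: inj_on_def)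
  then have "(\<Sum>T\<in>insert k ` Pow S. h T) = (\<Sum>T\<in>Pow S. h (insert k T))"
    by (simp add: sum.reindex)
  moreover have "Pow S \<inter> insert k ` Pow S = {}"
    using assms(2) by auto
  ultimately show ?thesis
    using assms(1) by (simp add: Pow_insert sum.union_disjoint sum.distrib)
qed

section \<open>Polynomials determined by their zeros\<close>

lemma poly_eq_0_if_roots:
  fixes p :: "'a::idom poly"
  assumes "degree p < card A" "\<And>a. a \<in> A \<Longrightarrow> poly p a = 0"
  shows "p = 0"
proof (rule ccontr)
  assume "p \<noteq> 0"
  then have "card A \<le> card {a. poly p a = 0}"
    using assms(2) by (intro card_mono poly_roots_finite) auto
  also have "\<dots> \<le> degree p"
    using \<open>p \<noteq> 0\<close> by (rule card_poly_roots_bound)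
  finally show False
    using assms(1) by simp
qed

text \<open>The coefficient condition plays the part of one more zero, at infinity.\<close>

lemma poly_eq_0_if_roots':
  fixes p :: "'a::idom poly"
  assumes "degree p \<le> card A" "coeff p (card A) = 0" "\<And>a. a \<in> A \<Longrightarrow> poly p a = 0"
  shows "p = 0"
proof (rule ccontr)
  assume "p \<noteq> 0"
  then have "degree p < card A"
    using assms(1,2) by (metis leading_coeff_0_iff le_neq_implies_less)
  then show False
    using poly_eq_0_if_roots assms(3) \<open>p \<noteq> 0\<close> by blast
qed

lemma prod_linear_poly:
  assumes "finite A"
  shows "degree (\<Prod>i\<in>A. [:a i, b i :: 'a::comm_ring_1:]) \<le> card A"
    and "coeff (\<Prod>i\<in>A. [:a i, b i:]) (card A) = (\<Prod>i\<in>A. b i)"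
  using assms
proof (induction A rule: finite_induct)
  case (insert k A)
  let ?q = "\<Prod>i\<in>A. [:a i, b i:]"
  have "degree ([:a k, b k:] * ?q) \<le> degree [:a k, b k:] + degree ?q"
    by (rule degree_mult_le)
  also have "\<dots> \<le> 1 + card A"
    using insert by (intro add_mono) auto
  finally show "degree (\<Prod>i\<in>insert k A. [:a i, b i:]) \<le> card (insert k A)"
    using insert(1,2) by simp
  have "coeff ?q (Suc (card A)) = 0"
    using insert by (intro coeff_eq_0) auto
  then show "coeff (\<Prod>i\<in>insert k A. [:a i, b i:]) (card (insert k A)) = (\<Prod>i\<in>insert k A. b i)"
    using insert by simp
qed auto

lemma degree_prod_mult_le:
  fixes f g :: "'i \<Rightarrow> 'a::comm_ring_1 poly"
  assumes "\<And>i. i \<in> A \<Longrightarrow> degree (f i) \<le> d"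
  shows "degree (\<Prod>i\<in>A. f i) \<le> card A * d"
  using assms
proof (induction A rule: infinite_finite_induct)
  case (insert k A)
  have "degree (f k * prod f A) \<le> degree (f k) + degree (prod f A)"
    by (rule degree_mult_le)
  also have "\<dots> \<le> d + card A * d"
    using insert by (intro add_mono) auto
  finally show ?case
    using insert by simp
qed auto

lemma dvd_prod_diff:
  fixes f g :: "'i \<Rightarrow> 'a::comm_ring_1"
  assumes "\<And>i. i \<in> A \<Longrightarrow> q dvd f i - g i"
  shows "q dvd prod f A - prod g A"
  using assms
proof (induction A rule: infinite_finite_induct)
  case (insert k A)
  have "f k * prod f A - g k * prod g A = (f k - g k) * prod f A + g k * (prod f A - prod g A)"
    by (simp add: algebra_simps)
  then show ?case
    using insert by auto
qed auto

section \<open>The associative product on functions of finite sets of letters\<close>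

locale alphabet =
  fixes x :: "nat \<Rightarrow> 'a::field" and t :: 'a
  assumes inj_x: "inj x"
begin

lemma x_eq_iff [simp]: "x i = x j \<longleftrightarrow> i = j"
  using inj_x by (auto dest: injD)

definition cross :: "nat set \<Rightarrow> nat set \<Rightarrow> 'a" where
  "cross A B = (\<Prod>i\<in>A. \<Prod>j\<in>B. (x i - t * x j) / (x i - x j))"

lemma cross_empty [simp]: "cross {} B = 1" "cross A {} = 1"
  by (auto simp: cross_def)

lemma cross_Un_left:
  "finite A \<Longrightarrow> finite B \<Longrightarrow> A \<inter> B = {} \<Longrightarrow> cross (A \<union> B) C = cross A C * cross B C"
  unfolding cross_def by (rule prod.union_disjoint)

lemma cross_Un_right:
  "finite A \<Longrightarrow> finite B \<Longrightarrow> A \<inter> B = {} \<Longrightarrow> cross C (A \<union> B) = cross C A * cross C B"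
  unfolding cross_def by (simp add: prod.union_disjoint prod.distrib)

lemma cross_insert_left:
  "finite A \<Longrightarrow> k \<notin> A \<Longrightarrow>
    cross (insert k A) C = (\<Prod>j\<in>C. (x k - t * x j) / (x k - x j)) * cross A C"
  by (simp add: cross_def)

lemma cross_insert_right:
  "finite B \<Longrightarrow> k \<notin> B \<Longrightarrow>
    cross A (insert k B) = (\<Prod>i\<in>A. (x i - t * x k) / (x i - x k)) * cross A B"
  by (simp add: cross_def prod.distrib[symmetric])

definition star :: "(nat set \<Rightarrow> 'a) \<Rightarrow> (nat set \<Rightarrow> 'a) \<Rightarrow> nat set \<Rightarrow> 'a" (infixr "\<star>" 70) where
  "(f \<star> g) S = (\<Sum>T\<in>Pow S. cross T (S - T) * (f T * g (S - T)))"

lemma star_infinite: "infinite S \<Longrightarrow> (f \<star> g) S = 0"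
  by (simp add: star_def)

lemma star_cong:
  assumes "\<And>T. finite T \<Longrightarrow> T \<subseteq> S \<Longrightarrow> f T = f' T" "\<And>T. finite T \<Longrightarrow> T \<subseteq> S \<Longrightarrow> g T = g' T"
  shows "(f \<star> g) S = (f' \<star> g') S"
proof (cases "finite S")
  case True
  then show ?thesis
    unfolding star_def using assms
    by (intro sum.cong refl) (auto dest: finite_subset)
qed (simp add: star_infinite)

text \<open>Both sides are the sum over ordered decompositions of S into T, U, V with weight
  \<open>cross T U * cross T V * cross U V\<close>, because \<open>cross\<close> is multiplicative
  in each argument.\<close>

lemma star_assoc: "(f \<star> g) \<star> h = f \<star> (g \<star> h)"
proof
  fix S
  show "((f \<star> g) \<star> h) S = (f \<star> (g \<star> h)) S"
  proof (cases "finite S")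
    case True
    let ?F = "\<lambda>T U V. cross T U * cross T V * cross U V * (f T * g U * h V)"
    have "((f \<star> g) \<star> h) S =
        (\<Sum>(P, T)\<in>Sigma (Pow S) Pow. ?F T (P - T) (S - P))"
    proof -
      have "((f \<star> g) \<star> h) S = (\<Sum>P\<in>Pow S. \<Sum>T\<in>Pow P. ?F T (P - T) (S - P))"
        unfolding star_def sum_distrib_left sum_distrib_right
      proof (intro sum.cong refl)
        fix P T assume "P \<in> Pow S" "T \<in> Pow P"
        then have fin: "finite T" "finite (P - T)"
          using True by (auto intro: finite_subset)
        have "P = T \<union> (P - T)" using \<open>T \<in> Pow P\<close> by auto
        then have "cross P (S - P) = cross T (S - P) * cross (P - T) (S - P)"
          using cross_Un_left[OF fin, of "S - P"] by (metis Diff_disjoint)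
        then show "cross P (S - P) * (cross T (P - T) * (f T * g (P - T)) * h (S - P)) =
            ?F T (P - T) (S - P)"
          by (simp add: mult_ac)
      qed
      also have "\<dots> = (\<Sum>(P, T)\<in>Sigma (Pow S) Pow. ?F T (P - T) (S - P))"
        using True by (subst sum.Sigma) (auto intro: finite_subset)
      finally show ?thesis .
    qed
    also have "\<dots> = (\<Sum>(T, U)\<in>Sigma (Pow S) (\<lambda>T. Pow (S - T)). ?F T U (S - T - U))"
      by (rule sum.reindex_bij_witness
            [where i = "\<lambda>(T, U). (T \<union> U, T)" and j = "\<lambda>(P, T). (T, P - T)"])
         (auto simp: Un_absorb1 Diff_Diff_Int set_diff_eq intro!: arg_cong2[of _ _ _ _ cross]
           arg_cong[of _ _ h] arg_cong2[of _ _ _ _ times] arg_cong[of _ _ g])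
    also have "\<dots> = (f \<star> (g \<star> h)) S"
    proof -
      have "(f \<star> (g \<star> h)) S = (\<Sum>T\<in>Pow S. \<Sum>U\<in>Pow (S - T). ?F T U (S - T - U))"
        unfolding star_def sum_distrib_left sum_distrib_right
      proof (intro sum.cong refl)
        fix T U assume "T \<in> Pow S" "U \<in> Pow (S - T)"
        then have fin: "finite U" "finite (S - T - U)"
          using True by (auto intro: finite_subset)
        have "S - T = U \<union> (S - T - U)" using \<open>U \<in> Pow (S - T)\<close> by auto
        then have "cross T (S - T) = cross T U * cross T (S - T - U)"
          using cross_Un_right[OF fin, of T] by (metis Diff_disjoint)
        then show "cross T (S - T) * (f T * (cross U (S - T - U) * (g U * h (S - T - U)))) =
            ?F T U (S - T - U)"
          by (simp add: mult_ac)
      qed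
      also have "\<dots> = (\<Sum>(T, U)\<in>Sigma (Pow S) (\<lambda>T. Pow (S - T)). ?F T U (S - T - U))"
        using True by (subst sum.Sigma) (auto intro: finite_subset)
      finally show ?thesis by simp
    qed
    finally show ?thesis .
  qed (simp add: star_infinite)
qed

text \<open>A star product is 0 on an infinite set, since the sum over \<open>Pow S\<close> is then
  infinite. The value 0 here makes identities such as \<open>star_E_affine\<close> equations between
  functions, which can be rewritten inside longer products.\<close>

definition E :: "(nat \<Rightarrow> 'a) \<Rightarrow> nat set \<Rightarrow> 'a" where
  "E u S = (if finite S then \<Prod>i\<in>S. u i else 0)"

definition twist :: "(nat \<Rightarrow> 'a) \<Rightarrow> (nat set \<Rightarrow> 'a) \<Rightarrow> nat set \<Rightarrow> 'a" where
  "twist u f S = E u S * f S"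

lemma E_mult: "E u S * E v S = E (\<lambda>i. u i * v i) S"
  by (simp add: E_def prod.distrib)

lemma twist_E: "twist u (E v) = E (\<lambda>i. u i * v i)"
  by (simp add: fun_eq_iff twist_def E_mult)

lemma twist_twist: "twist u (twist v f) = twist (\<lambda>i. u i * v i) f"
  by (simp add: fun_eq_iff twist_def E_mult[symmetric] mult_ac)

lemma E_split: "finite S \<Longrightarrow> T \<subseteq> S \<Longrightarrow> E u S = E u T * E u (S - T)"
  unfolding E_def by (simp add: finite_subset prod.subset_diff mult.commute)

text \<open>\<open>E u\<close> is multiplicative on disjoint unions, so twisting by it is an
  endomorphism of the algebra.\<close>

lemma twist_star: "twist u (f \<star> g) = twist u f \<star> twist u g"
proof
  fix S
  show "twist u (f \<star> g) S = (twist u f \<star> twist u g) S"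
    by (cases "finite S")
       (auto simp: twist_def star_def sum_distrib_left E_split mult_ac intro!: sum.cong)
qed

definition single_box :: "nat set \<Rightarrow> 'a" where
  "single_box S = (if card S = 1 then 1 else 0)"

text \<open>For m = 0 this is the unit of the algebra; twisted by x^p it is the contribution of m
  parts equal to p (\<open>HL_replicate_append\<close>).\<close>

definition layer :: "nat \<Rightarrow> nat set \<Rightarrow> 'a" where
  "layer m S = (if finite S \<and> card S = m then 1 else 0)"


section \<open>Symmetric sums as polynomials in the value of a new letter\<close>

definition ratio :: "'a \<Rightarrow> 'a \<Rightarrow> nat \<Rightarrow> nat \<Rightarrow> 'a" where
  "ratio \<alpha> \<beta> i j = (1 - \<alpha> * x i * x j) / (1 - \<beta> * x i * x j)"

definition pairs :: "'a \<Rightarrow> 'a \<Rightarrow> nat set \<Rightarrow> 'a" where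
  "pairs \<alpha> \<beta> S = (\<Prod>(i, j)\<in>{(i, j). i \<in> S \<and> j \<in> S \<and> i < j}. ratio \<alpha> \<beta> i j)"

lemma ratio_commute: "ratio \<alpha> \<beta> i j = ratio \<alpha> \<beta> j i"
  by (simp add: ratio_def mult_ac)

lemma pairs_empty [simp]: "pairs \<alpha> \<beta> {} = 1"
  by (simp add: pairs_def)

lemma pairs_zero [simp]: "pairs 0 0 S = 1"
  by (simp add: pairs_def ratio_def case_prod_beta)

lemma pairs_insert:
  assumes "finite S" "k \<notin> S"
  shows "pairs \<alpha> \<beta> (insert k S) = (\<Prod>i\<in>S. ratio \<alpha> \<beta> k i) * pairs \<alpha> \<beta> S"
proof -
  let ?P = "\<lambda>S. {(i, j). i \<in> S \<and> j \<in> S \<and> i < j}"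
  \<comment> \<open>k may lie anywhere among the indices of S, so the new pairs have to be sorted;
    \<open>ratio\<close> is symmetric.\<close>
  let ?g = "\<lambda>i. (min i k, max i k)"
  have fin: "finite (?P S)"
    by (rule finite_subset[of _ "S \<times> S"]) (use assms in auto)
  have "?P (insert k S) = ?g ` S \<union> ?P S"
  proof (intro equalityI subsetI)
    fix z assume "z \<in> ?P (insert k S)"
    then consider "z \<in> ?P S" | "fst z = k" "snd z \<in> S" "k < snd z" | "snd z = k" "fst z \<in> S" "fst z < k"
      by auto
    then show "z \<in> ?g ` S \<union> ?P S"
    proof cases
      case 2
      then have "z = ?g (snd z)" by (simp add: prod_eq_iff)
      then show ?thesis using 2 by blast
    next
      case 3
      then have "z = ?g (fst z)" by (simp add: prod_eq_iff)
      then show ?thesis using 3 by blast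
    qed blast
  next
    fix z assume "z \<in> ?g ` S \<union> ?P S"
    then show "z \<in> ?P (insert k S)"
      using assms(2) by (auto simp: min_def max_def order.strict_iff_order split: if_splits)
  qed
  moreover have "?g ` S \<inter> ?P S = {}"
    using assms(2) by (auto simp: min_def max_def split: if_splits)
  ultimately have "pairs \<alpha> \<beta> (insert k S) = (\<Prod>(i, j)\<in>?g ` S. ratio \<alpha> \<beta> i j) * pairs \<alpha> \<beta> S"
    using assms(1) fin by (simp add: pairs_def prod.union_disjoint)
  also have "(\<Prod>(i, j)\<in>?g ` S. ratio \<alpha> \<beta> i j) = (\<Prod>i\<in>S. ratio \<alpha> \<beta> k i)"
    using assms(2)
    by (subst prod.reindex)
       (auto simp: inj_on_def min_def max_def ratio_commute[of _ _ k] split: if_splits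
             intro!: prod.cong)
  finally show ?thesis .
qed

text \<open>One summand shape for all the interpolation arguments: with \<alpha> = \<beta> = 0 the
  pair factors disappear, which serves \<open>count_sum\<close> and \<open>star_E_affine\<close>;
  \<alpha> = t \<beta> serves \<open>littlewood_sum\<close>.\<close>

definition kappa :: "'a poly \<Rightarrow> 'a poly \<Rightarrow> 'a \<Rightarrow> 'a \<Rightarrow> nat set \<Rightarrow> nat set \<Rightarrow> 'a" where
  "kappa p r \<alpha> \<beta> S T =
    (\<Prod>i\<in>T. poly p (x i)) * (\<Prod>j\<in>S - T. poly r (x j)) * pairs \<alpha> \<beta> T * cross T (S - T)"

definition symm_sum :: "(nat \<Rightarrow> 'a) \<Rightarrow> 'a poly \<Rightarrow> 'a poly \<Rightarrow> 'a \<Rightarrow> 'a \<Rightarrow> nat set \<Rightarrow> 'a" where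
  "symm_sum g p r \<alpha> \<beta> S = (\<Sum>T\<in>Pow S. g (card T) * kappa p r \<alpha> \<beta> S T)"

text \<open>In both this and \<open>lower\<close> the variable is the value y of a new letter, which
  is put into T here and into the complement there. Each is the extra factor acquired by the
  summand, times the common denominator, the product of (y - x_j)(1 - \<beta> x_j y) over S.\<close>

definition upper :: "'a poly \<Rightarrow> 'a \<Rightarrow> 'a \<Rightarrow> nat set \<Rightarrow> nat set \<Rightarrow> 'a poly" where
  "upper p \<alpha> \<beta> S T = p * (\<Prod>i\<in>T. [:1, - \<alpha> * x i:] * [:- x i, 1:]) *
    (\<Prod>j\<in>S - T. [:1, - \<beta> * x j:] * [:- t * x j, 1:])"

definition lower :: "'a poly \<Rightarrow> 'a \<Rightarrow> nat set \<Rightarrow> nat set \<Rightarrow> 'a poly" where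
  "lower r \<beta> S T = r * (\<Prod>i\<in>T. [:1, - \<beta> * x i:] * [:- x i, t:]) *
    (\<Prod>j\<in>S - T. [:1, - \<beta> * x j:] * [:- x j, 1:])"

definition symm_poly :: "(nat \<Rightarrow> 'a) \<Rightarrow> 'a poly \<Rightarrow> 'a poly \<Rightarrow> 'a \<Rightarrow> 'a \<Rightarrow> nat set \<Rightarrow> 'a poly" where
  "symm_poly g p r \<alpha> \<beta> S = (\<Sum>T\<in>Pow S. smult (kappa p r \<alpha> \<beta> S T)
     (smult (g (card T)) (lower r \<beta> S T) + smult (g (Suc (card T))) (upper p \<alpha> \<beta> S T)))"

lemma poly_upper:
  "poly (upper p \<alpha> \<beta> S T) y = poly p y * (\<Prod>i\<in>T. (1 - \<alpha> * x i * y) * (y - x i)) *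
    (\<Prod>j\<in>S - T. (1 - \<beta> * x j * y) * (y - t * x j))"
  unfolding upper_def poly_mult poly_prod by (simp add: mult_ac)

lemma poly_lower:
  "poly (lower r \<beta> S T) y = poly r y * (\<Prod>i\<in>T. (1 - \<beta> * x i * y) * (t * y - x i)) *
    (\<Prod>j\<in>S - T. (1 - \<beta> * x j * y) * (y - x j))"
  unfolding lower_def poly_mult poly_prod by (simp add: mult_ac)

lemma kappa_insert:
  assumes "finite S" "T \<subseteq> S" "s \<notin> S"
  shows "kappa p r \<alpha> \<beta> (insert s S) T =
      poly r (x s) * (\<Prod>i\<in>T. (x i - t * x s) / (x i - x s)) * kappa p r \<alpha> \<beta> S T"
    and "kappa p r \<alpha> \<beta> (insert s S) (insert s T) =
      poly p (x s) * (\<Prod>i\<in>T. ratio \<alpha> \<beta> s i) *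
      (\<Prod>j\<in>S - T. (x s - t * x j) / (x s - x j)) * kappa p r \<alpha> \<beta> S T"
proof -
  have T: "finite T" "s \<notin> T" using assms by (auto intro: finite_subset)
  have 1: "insert s S - T = insert s (S - T)" "insert s S - insert s T = S - T"
    using assms by auto
  show "kappa p r \<alpha> \<beta> (insert s S) T =
      poly r (x s) * (\<Prod>i\<in>T. (x i - t * x s) / (x i - x s)) * kappa p r \<alpha> \<beta> S T"
    using assms T unfolding kappa_def 1 by (simp add: cross_insert_right)
  show "kappa p r \<alpha> \<beta> (insert s S) (insert s T) =
      poly p (x s) * (\<Prod>i\<in>T. ratio \<alpha> \<beta> s i) *
      (\<Prod>j\<in>S - T. (x s - t * x j) / (x s - x j)) * kappa p r \<alpha> \<beta> S T"
    using assms T unfolding kappa_def 1 by (simp add: cross_insert_left pairs_insert)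
qed

lemma symm_sum_insert:
  assumes "finite S" "s \<notin> S" "\<And>j. j \<in> S \<Longrightarrow> \<beta> * x s * x j \<noteq> 1"
  shows "symm_sum g p r \<alpha> \<beta> (insert s S) * (\<Prod>j\<in>S. (x s - x j) * (1 - \<beta> * x s * x j)) =
    poly (symm_poly g p r \<alpha> \<beta> S) (x s)"
proof -
  let ?K = "kappa p r \<alpha> \<beta>"
  let ?q = "\<lambda>j. (x s - x j) * (1 - \<beta> * x s * x j)"
  have "(g (card T) * ?K (insert s S) T +
      g (card (insert s T)) * ?K (insert s S) (insert s T)) * (\<Prod>j\<in>S. ?q j) =
    poly (smult (?K S T)
     (smult (g (card T)) (lower r \<beta> S T) + smult (g (Suc (card T))) (upper p \<alpha> \<beta> S T))) (x s)"
    (is "(?g0 * ?k0 + ?g1 * ?k1) * ?Q = _") if T: "T \<in> Pow S" for T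
  proof -
    have fin: "finite T" "s \<notin> T" using T assms by (auto intro: finite_subset)
    have ne: "x s - x j \<noteq> 0" "x j - x s \<noteq> 0" "1 - \<beta> * x s * x j \<noteq> 0" if "j \<in> S" for j
      using assms(2,3) that by auto
    have Q: "?Q = (\<Prod>j\<in>T. ?q j) * (\<Prod>j\<in>S - T. ?q j)"
      using prod.subset_diff[of T S ?q] T assms(1) by (simp only: Pow_iff mult.commute)
    have "(\<Prod>i\<in>T. (x i - t * x s) / (x i - x s)) * (\<Prod>j\<in>T. ?q j) =
        (\<Prod>i\<in>T. (1 - \<beta> * x i * x s) * (t * x s - x i))"
      unfolding prod.distrib[symmetric] using T ne
      by (intro prod.cong) (auto simp: subset_iff field_simps)
    then have low: "(poly r (x s) * (\<Prod>i\<in>T. (x i - t * x s) / (x i - x s))) * ?Q =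
        poly (lower r \<beta> S T) (x s)"
      unfolding Q poly_lower by (simp add: mult_ac)
    have "(\<Prod>i\<in>T. ratio \<alpha> \<beta> s i) * (\<Prod>j\<in>T. ?q j) =
        (\<Prod>i\<in>T. (1 - \<alpha> * x i * x s) * (x s - x i))"
      unfolding prod.distrib[symmetric] ratio_def using T ne
      by (intro prod.cong) (auto simp: subset_iff field_simps)
    moreover have "(\<Prod>j\<in>S - T. (x s - t * x j) / (x s - x j)) * (\<Prod>j\<in>S - T. ?q j) =
        (\<Prod>j\<in>S - T. (1 - \<beta> * x j * x s) * (x s - t * x j))"
      unfolding prod.distrib[symmetric] using T ne
      by (intro prod.cong) (auto simp: subset_iff field_simps)
    ultimately have upp: "(poly p (x s) * (\<Prod>i\<in>T. ratio \<alpha> \<beta> s i) *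
        (\<Prod>j\<in>S - T. (x s - t * x j) / (x s - x j))) * ?Q = poly (upper p \<alpha> \<beta> S T) (x s)"
      unfolding Q poly_upper by (simp add: mult_ac)
    have "?k0 * ?Q = ?K S T * poly (lower r \<beta> S T) (x s)"
      using T assms by (subst low[symmetric]) (simp add: kappa_insert)
    moreover have "?k1 * ?Q = ?K S T * poly (upper p \<alpha> \<beta> S T) (x s)"
      using T assms by (subst upp[symmetric]) (simp add: kappa_insert)
    ultimately show ?thesis
      using fin by (simp add: distrib_right distrib_left mult.assoc)
  qed
  then show ?thesis
    using assms(1,2) by (simp add: symm_sum_def symm_poly_def sum_Pow_insert sum_distrib_right poly_sum)
qed

text \<open>The pole at y = x_k is only apparent: the new letter and k can be exchanged. The term
  with the new letter inside and k outside cancels the one with k inside and the new letter outside;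
  both have the same number of letters inside, so the weight g is arbitrary.\<close>

lemma symm_poly_root:
  assumes "finite S" "k \<in> S" "\<And>j. j \<in> S \<Longrightarrow> j \<noteq> k \<Longrightarrow> \<beta> * x k * x j \<noteq> 1"
  shows "poly (symm_poly g p r \<alpha> \<beta> S) (x k) = 0"
proof -
  let ?K = "kappa p r \<alpha> \<beta>"
  define R where "R = S - {k}"
  have S: "S = insert k R" "finite R" "k \<notin> R"
    using assms by (auto simp: R_def)
  define H where "H T = poly (smult (?K S T)
     (smult (g (card T)) (lower r \<beta> S T) + smult (g (Suc (card T))) (upper p \<alpha> \<beta> S T))) (x k)" for T
  have "H T + H (insert k T) = 0" if T: "T \<in> Pow R" for T
  proof -
    have fin: "finite T" "k \<notin> T" using T S by (auto intro: finite_subset)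
    have d: "S - T = insert k (R - T)" "S - insert k T = R - T"
      using T S by auto
    have ne: "x k - x j \<noteq> 0" "x j - x k \<noteq> 0" "1 - \<beta> * x k * x j \<noteq> 0" if "j \<in> R" for j
      using assms(3)[of j] that S by auto
    \<comment> \<open>A factor y - x_k kills the terms in which the new letter and k lie on the same
      side.\<close>
    have low0: "poly (lower r \<beta> S T) (x k) = 0"
      unfolding poly_lower d using fin S by simp
    have upp1: "poly (upper p \<alpha> \<beta> S (insert k T)) (x k) = 0"
      unfolding poly_upper d using fin S by simp
    have "poly (lower r \<beta> S (insert k T)) (x k) =
        poly r (x k) * ((1 - \<beta> * x k * x k) * (t * x k - x k)) *
        (\<Prod>i\<in>T. (1 - \<beta> * x i * x k) * (t * x k - x i)) *
        (\<Prod>j\<in>R - T. (1 - \<beta> * x j * x k) * (x k - x j))"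
      unfolding poly_lower d using fin S by (simp add: mult_ac)
    moreover have "poly (upper p \<alpha> \<beta> S T) (x k) =
        poly p (x k) * ((1 - \<beta> * x k * x k) * (x k - t * x k)) *
        (\<Prod>i\<in>T. (1 - \<alpha> * x i * x k) * (x k - x i)) *
        (\<Prod>j\<in>R - T. (1 - \<beta> * x j * x k) * (x k - t * x j))"
      unfolding poly_upper d using fin S by (simp add: mult_ac)
    moreover have "(\<Prod>i\<in>T. (x i - t * x k) / (x i - x k)) *
          (\<Prod>i\<in>T. (1 - \<alpha> * x i * x k) * (x k - x i)) =
        (\<Prod>i\<in>T. ratio \<alpha> \<beta> k i) * (\<Prod>i\<in>T. (1 - \<beta> * x i * x k) * (t * x k - x i))"
      unfolding prod.distrib[symmetric] ratio_def using T ne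
      by (intro prod.cong) (auto simp: subset_iff field_simps)
    moreover have "(\<Prod>j\<in>R - T. (1 - \<beta> * x j * x k) * (x k - t * x j)) =
        (\<Prod>j\<in>R - T. (x k - t * x j) / (x k - x j)) *
        (\<Prod>j\<in>R - T. (1 - \<beta> * x j * x k) * (x k - x j))"
      unfolding prod.distrib[symmetric] using T ne
      by (intro prod.cong) (auto simp: subset_iff field_simps)
    moreover have "?K S T =
        poly r (x k) * (\<Prod>i\<in>T. (x i - t * x k) / (x i - x k)) * ?K R T"
      unfolding S(1) using S T by (intro kappa_insert) auto
    moreover have "?K S (insert k T) =
        poly p (x k) * (\<Prod>i\<in>T. ratio \<alpha> \<beta> k i) *
        (\<Prod>j\<in>R - T. (x k - t * x j) / (x k - x j)) * ?K R T"
      unfolding S(1) using S T by (intro kappa_insert) auto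
    ultimately have "?K S T * poly (upper p \<alpha> \<beta> S T) (x k) +
        ?K S (insert k T) * poly (lower r \<beta> S (insert k T)) (x k) = 0"
      by (simp only:) algebra
    then have "g (Suc (card T)) * (?K S T * poly (upper p \<alpha> \<beta> S T) (x k) +
        ?K S (insert k T) * poly (lower r \<beta> S (insert k T)) (x k)) = 0"
      by simp
    then show ?thesis
      using fin unfolding H_def by (simp add: low0 upp1 algebra_simps)
  qed
  then have "(\<Sum>T\<in>Pow S. H T) = 0"
    using sum_Pow_insert[OF S(2,3), of H] S(1) by simp
  then show ?thesis
    by (simp add: symm_poly_def H_def poly_sum)
qed


section \<open>Sums without pair factors: t-binomial recursions and the merging rule\<close>

lemma upper_0: "upper p 0 0 S T = p * ((\<Prod>i\<in>T. [:- x i, 1:]) * (\<Prod>j\<in>S - T. [:- t * x j, 1:]))"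
  by (simp add: upper_def mult.assoc)

lemma lower_0: "lower r 0 S T = r * ((\<Prod>i\<in>T. [:- x i, t:]) * (\<Prod>j\<in>S - T. [:- x j, 1:]))"
  by (simp add: lower_def mult.assoc)

lemma prod_linear_Pow:
  assumes "finite S" "T \<in> Pow S"
  shows "degree ((\<Prod>i\<in>T. [:a i, b i :: 'a:]) * (\<Prod>j\<in>S - T. [:c j, d j:])) \<le> card S" (is "degree (?f * ?g) \<le> _")
    and "coeff ((\<Prod>i\<in>T. [:a i, b i :: 'a:]) * (\<Prod>j\<in>S - T. [:c j, d j:])) (card S) =
      (\<Prod>i\<in>T. b i) * (\<Prod>j\<in>S - T. d j)"
proof -
  have "?f * ?g = (\<Prod>i\<in>S. [:if i \<in> T then a i else c i, if i \<in> T then b i else d i:])"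
    using assms by (subst prod.subset_diff[of T S]) (auto simp: mult.commute intro!: arg_cong2[of _ _ _ _ times] prod.cong)
  moreover have "(\<Prod>i\<in>T. b i) * (\<Prod>j\<in>S - T. d j) = (\<Prod>i\<in>S. if i \<in> T then b i else d i)"
    using assms by (subst prod.subset_diff[of T S]) (auto simp: mult.commute intro!: arg_cong2[of _ _ _ _ times] prod.cong)
  ultimately show "degree (?f * ?g) \<le> card S" "coeff (?f * ?g) (card S) = (\<Prod>i\<in>T. b i) * (\<Prod>j\<in>S - T. d j)"
    using prod_linear_poly[OF assms(1)] by simp_all
qed

lemma prod_split: "finite S \<Longrightarrow> T \<in> Pow S \<Longrightarrow> (\<Prod>i\<in>S. f i) = (\<Prod>i\<in>T. f i) * (\<Prod>i\<in>S - T. f i :: 'a)"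
  using prod.subset_diff[of T S f] by (simp add: mult.commute)

text \<open>The sum of \<open>cross T (S - T)\<close> over the k-element T is the t-binomial
  coefficient, so this is a sum of g k against t-binomials. Only the two Pascal rules below are
  needed.\<close>

abbreviation count_sum :: "(nat \<Rightarrow> 'a) \<Rightarrow> nat set \<Rightarrow> 'a" where
  "count_sum g S \<equiv> symm_sum g 1 1 0 0 S"

lemma kappa_1: "kappa 1 1 0 0 S T = cross T (S - T)"
  by (simp add: kappa_def)

text \<open>The degree is at most the number of letters and all letters are zeros, so only a
  constant is free; it is read off from the leading coefficient.\<close>

lemma symm_poly_count:
  assumes "finite S"
  shows "symm_poly g 1 1 0 0 S =
    smult (count_sum (\<lambda>k. g (Suc k) + t ^ k * g k) S) (\<Prod>i\<in>S. [:- x i, 1:])" (is "?P = smult ?c ?W")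
proof -
  have deg: "degree (smult u (smult v (lower 1 0 S T) + smult w (upper 1 0 0 S T))) \<le> card S"
    if "T \<in> Pow S" for T u v w
    unfolding upper_0 lower_0 mult_1 using assms that
    by (intro order.trans[OF degree_smult_le] degree_add_le prod_linear_Pow)
  have "?P - smult ?c ?W = 0"
  proof (rule poly_eq_0_if_roots'[of _ "x ` S"])
    have card: "card (x ` S) = card S"
      using inj_x by (simp add: card_image inj_on_def)
    show "degree (?P - smult ?c ?W) \<le> card (x ` S)"
      unfolding card symm_poly_def using assms deg
      by (intro degree_diff_le degree_sum_le order.trans[OF degree_smult_le prod_linear_poly(1)]) auto
    have "coeff ?P (card S) = ?c"
      unfolding symm_poly_def coeff_sum symm_sum_def
    proof (rule sum.cong[OF refl])
      fix T assume T: "T \<in> Pow S"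
      show "coeff (smult (kappa 1 1 0 0 S T) (smult (g (card T)) (lower 1 0 S T) +
          smult (g (Suc (card T))) (upper 1 0 0 S T))) (card S) =
        (g (Suc (card T)) + t ^ card T * g (card T)) * kappa 1 1 0 0 S T"
        using prod_linear_Pow(2)[OF assms T] unfolding upper_0 lower_0 mult_1
        by (simp add: algebra_simps)
    qed
    then show "coeff (?P - smult ?c ?W) (card (x ` S)) = 0"
      using prod_linear_poly(2)[OF assms, where a = "\<lambda>i. - x i" and b = "\<lambda>_. 1"] by (simp add: card)
    show "poly (?P - smult ?c ?W) a = 0" if "a \<in> x ` S" for a
      using that symm_poly_root[OF assms, of _ 0 g 1 1 0] assms
      by (auto simp: poly_prod)
  qed
  then show ?thesis by simp
qed

lemma count_sum_insert:
  assumes "finite S" "s \<notin> S"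
  shows "count_sum g (insert s S) = count_sum (\<lambda>k. g (Suc k) + t ^ k * g k) S"
proof -
  have "(\<Prod>j\<in>S. x s - x j) \<noteq> 0"
    using assms by auto
  then show ?thesis
    using symm_sum_insert[OF assms, of 0 g 1 1 0] by (simp add: symm_poly_count[OF assms(1)] poly_prod)
qed

text \<open>The second Pascal rule: the constant that \<open>count_sum_insert\<close> reads off at y
  = \<infinity> is read off at y = 0 instead, where nonzero letters are needed for the
  division.\<close>

lemma count_sum_insert':
  assumes "finite S" "s \<notin> S" "\<And>i. x i \<noteq> 0"
  shows "count_sum g (insert s S) = count_sum (\<lambda>k. g (Suc k) * t ^ (card S - k) + g k) S"
proof -
  have "poly (symm_poly g 1 1 0 0 S) 0 =
      count_sum (\<lambda>k. g (Suc k) * t ^ (card S - k) + g k) S * (\<Prod>i\<in>S. - x i)"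
    unfolding symm_poly_def poly_sum symm_sum_def sum_distrib_right
  proof (rule sum.cong[OF refl])
    fix T assume T: "T \<in> Pow S"
    then have "card S - card T = card (S - T)"
      using assms(1) by (simp add: card_Diff_subset finite_subset)
    moreover have "(\<Prod>j\<in>S - T. - (t * x j)) = t ^ card (S - T) * (\<Prod>j\<in>S - T. - x j)"
      by (simp add: prod.distrib[symmetric] flip: prod_constant)
    ultimately show "poly (smult (kappa 1 1 0 0 S T) (smult (g (card T)) (lower 1 0 S T) +
        smult (g (Suc (card T))) (upper 1 0 0 S T))) 0 =
      (g (Suc (card T)) * t ^ (card S - card T) + g (card T)) * kappa 1 1 0 0 S T * (\<Prod>i\<in>S. - x i)"
      using prod_split[OF assms(1) T, of "\<lambda>i. - x i"]
      by (simp add: poly_upper poly_lower algebra_simps)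
  qed
  moreover have "poly (symm_poly g 1 1 0 0 S) 0 = count_sum g (insert s S) * (\<Prod>i\<in>S. - x i)"
    unfolding symm_poly_count[OF assms(1)] count_sum_insert[OF assms(1,2)]
    by (simp add: poly_prod)
  moreover have "(\<Prod>i\<in>S. - x i) \<noteq> 0"
    using assms by simp
  ultimately show ?thesis
    by simp
qed

text \<open>Induction on the alphabet. With n letters present, the polynomial in the next letter has
  degree at most n + 1; it is fixed by its zeros x_k, its value at 0 and its leading coefficient.
  The letters must be nonzero so that 0 is a further point.\<close>

lemma star_E_affine:
  assumes "\<And>i. x i \<noteq> 0"
  shows "E (\<lambda>i. a * x i) \<star> E (\<lambda>_. 1) = E (\<lambda>i. 1 + a * x i)"
proof
  fix S
  show "(E (\<lambda>i. a * x i) \<star> E (\<lambda>_. 1)) S = E (\<lambda>i. 1 + a * x i) S"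
  proof (cases "finite S")
    case True
    define p :: "'a poly" where "p = [:0, a:]"
    have p: "degree p \<le> 1" "poly p y = a * y" "coeff (p * q) (Suc n) = a * coeff q n" for y q n
      by (auto simp: p_def)
    have symm: "symm_sum (\<lambda>_. 1) p 1 0 0 S = (E (\<lambda>i. a * x i) \<star> E (\<lambda>_. 1)) S" if "finite S" for S
      using that unfolding symm_sum_def star_def
      by (intro sum.cong) (auto simp: kappa_def E_def p finite_subset)
    have "symm_sum (\<lambda>_. 1) p 1 0 0 S = (\<Prod>i\<in>S. 1 + a * x i)"
      using True
    proof (induction S rule: finite_induct)
      case empty
      then show ?case by (simp add: symm_sum_def kappa_def)
    next
      case (insert s S)
      let ?P = "symm_poly (\<lambda>_. 1) p 1 0 0 S" and ?c = "symm_sum (\<lambda>_. 1) p 1 0 0 S"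
      let ?W = "[:1, a:] * (\<Prod>i\<in>S. [:- x i, 1:])"
      have deg: "degree (upper p 0 0 S T) \<le> Suc (card S)" "degree (lower 1 0 S T) \<le> Suc (card S)"
        if "T \<in> Pow S" for T
      proof -
        have "degree (upper p 0 0 S T) \<le> 1 + card S"
          unfolding upper_0 using insert(1) that p(1)
          by (intro order.trans[OF degree_mult_le] add_mono prod_linear_Pow)
        then show "degree (upper p 0 0 S T) \<le> Suc (card S)" by simp
        have "degree (lower 1 0 S T) \<le> card S"
          unfolding lower_0 mult_1 using insert(1) that by (intro prod_linear_Pow)
        then show "degree (lower 1 0 S T) \<le> Suc (card S)" by simp
      qed
      have "?P - smult ?c ?W = 0"
      proof (rule poly_eq_0_if_roots'[of _ "insert 0 (x ` S)"])
        have "card (x ` S) = card S"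
          using inj_x by (simp add: card_image inj_on_def)
        moreover have "0 \<notin> x ` S"
          using assms by (metis imageE)
        ultimately have card: "card (insert 0 (x ` S)) = Suc (card S)"
          using insert(1) by simp
        have W: "degree ?W \<le> 1 + card S"
          using insert(1) by (intro order.trans[OF degree_mult_le] add_mono prod_linear_poly(1)) auto
        then show "degree (?P - smult ?c ?W) \<le> card (insert 0 (x ` S))"
          unfolding card symm_poly_def using insert(1) deg
          by (intro degree_diff_le degree_sum_le order.trans[OF degree_smult_le] degree_add_le) auto
        have "coeff (lower 1 0 S T) (Suc (card S)) = 0" if "T \<in> Pow S" for T
          unfolding lower_0 mult_1 using prod_linear_Pow(1)[OF insert(1) that] by (intro coeff_eq_0) (simp add: less_Suc_eq_le)
        moreover have "coeff (upper p 0 0 S T) (Suc (card S)) = a" if "T \<in> Pow S" for T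
          unfolding upper_0 p using prod_linear_Pow(2)[OF insert(1) that] by simp
        ultimately have "coeff ?P (Suc (card S)) = a * ?c"
          unfolding symm_poly_def coeff_sum symm_sum_def sum_distrib_left
          by (intro sum.cong) (auto simp: mult.commute)
        moreover have "coeff ?W (Suc (card S)) = a"
          using prod_linear_poly[OF insert(1), where a = "\<lambda>i. - x i" and b = "\<lambda>_. 1"]
          by (simp add: coeff_eq_0 less_Suc_eq_le)
        ultimately show "coeff (?P - smult ?c ?W) (card (insert 0 (x ` S))) = 0"
          by (simp only: card coeff_diff coeff_smult) simp
        have "poly ?P (x k) = 0" "poly ?W (x k) = 0" if "k \<in> S" for k
        proof -
          show "poly ?P (x k) = 0"
            using symm_poly_root[OF insert(1) that, of 0] by simp
          have "(\<Prod>i\<in>S. x k - x i) = 0"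
            using insert(1) that by (intro prod_zero) auto
          then show "poly ?W (x k) = 0"
            unfolding poly_mult poly_prod by simp
        qed
        moreover have "poly ?P 0 = ?c * (\<Prod>i\<in>S. - x i)"
          unfolding symm_poly_def poly_sum symm_sum_def sum_distrib_right
        proof (rule sum.cong[OF refl])
          fix T assume T: "T \<in> Pow S"
          show "poly (smult (kappa p 1 0 0 S T) (smult 1 (lower 1 0 S T) + smult 1 (upper p 0 0 S T))) 0 =
              1 * kappa p 1 0 0 S T * (\<Prod>i\<in>S. - x i)"
            using prod_split[OF insert(1) T, of "\<lambda>i. - x i"] by (simp add: poly_upper poly_lower p)
        qed
        moreover have "poly ?W 0 = (\<Prod>i\<in>S. - x i)"
          by (simp add: poly_prod)
        ultimately show "poly (?P - smult ?c ?W) y = 0" if "y \<in> insert 0 (x ` S)" for y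
          using that by (auto simp del: mult_pCons_left)
      qed
      then have P: "?P = smult ?c ?W" by simp
      have "symm_sum (\<lambda>_. 1) p 1 0 0 (insert s S) * (\<Prod>j\<in>S. x s - x j) =
          (?c * (1 + a * x s)) * (\<Prod>j\<in>S. x s - x j)"
        using symm_sum_insert[OF insert(1,2), of 0 "\<lambda>_. 1" p 1 0] unfolding P
        by (simp add: poly_prod algebra_simps)
      moreover have "(\<Prod>j\<in>S. x s - x j) \<noteq> 0"
        using insert(1,2) by auto
      ultimately show ?case
        using insert by (simp add: mult.commute)
    qed
    then show ?thesis
      using True symm[of S] by (simp add: E_def)
  qed (simp add: star_infinite E_def)
qed

lemma star_E_mult:
  assumes "\<And>i. x i \<noteq> 0"
  shows "E (\<lambda>i. u i * (a * x i)) \<star> E u = E (\<lambda>i. u i * (1 + a * x i))"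
  using twist_star[of u "E (\<lambda>i. a * x i)" "E (\<lambda>_. 1)"]
  by (simp add: star_E_affine[OF assms] twist_E)


text \<open>
  The case $\alpha = t\beta$: the difference of both sides, as a polynomial in the last variable
  $y$, has degree at most $2n + 2$, is divisible by $1 - \beta y^2$ and vanishes at the $2n + 1$
  points $0$, $x_k$, $1/(\beta x_k)$.
\<close>

lemma littlewood_sum:
  assumes nz: "\<And>i. x i \<noteq> 0" and gen: "\<And>i j. \<beta> * x i * x j \<noteq> 1" and \<beta>: "\<beta> \<noteq> 0"
    and "finite S"
  shows "symm_sum (\<lambda>_. 1) [:0, 0, \<beta>:] [:1, 0, - \<beta>:] (t * \<beta>) \<beta> S = pairs (t * \<beta>) \<beta> S"
  using \<open>finite S\<close>
\<comment> \<open>Induction on the cardinality, because at y = 1/(\<beta> x_k) the identity is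
  needed for the alphabet without k as well.\<close>
proof (induction "card S" arbitrary: S rule: less_induct)
  case (less S')
  define p where "p = [:0, 0, \<beta>:]"
  define q where "q = [:1, 0, - \<beta>:]"
  define \<alpha> where "\<alpha> = t * \<beta>"
  let ?K = "kappa p q \<alpha> \<beta>"
  have poly_p: "poly p y = \<beta> * y ^ 2" and poly_q: "poly q y = 1 - \<beta> * y ^ 2" for y
    by (simp_all add: p_def q_def power2_eq_square algebra_simps)
  have deg_p: "degree p = 2" and deg_q: "degree q = 2"
    using \<beta> by (simp_all add: p_def q_def)
  have IH: "symm_sum (\<lambda>_. 1) p q \<alpha> \<beta> S = pairs \<alpha> \<beta> S" if "card S < card S'" "finite S" for S
    using less that by (simp add: p_def q_def \<alpha>_def)
  show ?case
  proof (cases "S' = {}")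
    case True
    then show ?thesis by (simp add: symm_sum_def kappa_def)
  next
    case False
    then obtain s where s: "s \<in> S'" by auto
    define S where "S = S' - {s}"
    have S: "S' = insert s S" "s \<notin> S" "finite S" "card S < card S'"
      using s less.prems card_Diff1_less[OF less.prems s] by (auto simp: S_def)
    let ?Y = "symm_poly (\<lambda>_. 1) p q \<alpha> \<beta> S"
    \<comment> \<open>The right-hand side after clearing denominators: the numerators of the new
      pair ratios, and the factors y - x_i that remain.\<close>
    define W where "W = (\<Prod>i\<in>S. [:1, - \<alpha> * x i:] * [:- x i, 1:])"
    define D where "D = ?Y - smult (pairs \<alpha> \<beta> S) W"
    have W: "poly W y = (\<Prod>i\<in>S. (1 - \<alpha> * x i * y) * (y - x i))" for y
      unfolding W_def poly_prod poly_mult by (simp add: mult_ac)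
    have deg_fac: "degree ([:a, b:] * [:c, d:]) \<le> 2" for a b c d :: 'a
      by (rule order.trans[OF degree_mult_le]) (simp add: numeral_2_eq_2)
    have deg_two: "degree (prod f T * prod g (S - T)) \<le> card S * 2"
      if "T \<in> Pow S" "\<And>i. degree (f i) \<le> 2" "\<And>i. degree (g i) \<le> 2"
      for f g :: "nat \<Rightarrow> 'a poly" and T
    proof -
      have "degree (prod f T * prod g (S - T)) \<le> card T * 2 + card (S - T) * 2"
        using that by (intro order.trans[OF degree_mult_le] add_mono degree_prod_mult_le)
      also have "card T * 2 + card (S - T) * 2 = card S * 2"
        using that(1) S(3) by (simp add: card_Diff_subset finite_subset card_mono flip: distrib_right)
      finally show ?thesis .
    qed
    have deg_terms: "degree (upper p \<alpha> \<beta> S T) \<le> 2 + card S * 2"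
        "degree (lower q \<beta> S T) \<le> 2 + card S * 2" if "T \<in> Pow S" for T
      unfolding upper_def lower_def mult.assoc using that deg_p deg_q
      by (intro order.trans[OF degree_mult_le] add_mono deg_two deg_fac; simp)+
    have deg_D: "degree D \<le> 2 + card S * 2"
      unfolding D_def symm_poly_def
    proof (intro degree_diff_le degree_sum_le)
      have "degree W \<le> card S * 2"
        unfolding W_def by (intro degree_prod_mult_le deg_fac)
      then show "degree (smult (pairs \<alpha> \<beta> S) W) \<le> 2 + card S * 2"
        by (intro order.trans[OF degree_smult_le]) simp
    qed (use S(3) deg_terms in \<open>auto intro!: order.trans[OF degree_smult_le] degree_add_le\<close>)
    have IH_S: "(\<Sum>T\<in>Pow S. ?K S T) = pairs \<alpha> \<beta> S"
      using IH[of S] S by (simp add: symm_sum_def)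
    \<comment> \<open>Modulo q, that is for \<beta> y^2 = 1, \<open>lower\<close> vanishes, p
      becomes 1, and \<alpha> = t \<beta> makes (1 - \<beta> x_j y)(y - t x_j) equal to (1 -
      \<alpha> x_j y)(y - x_j). Hence every \<open>upper\<close> becomes W, and the induction
      hypothesis sums the coefficients.\<close>
    have "q dvd D"
    proof -
      have "D = (\<Sum>T\<in>Pow S. smult (?K S T) (lower q \<beta> S T + (upper p \<alpha> \<beta> S T - W)))"
        unfolding D_def symm_poly_def IH_S[symmetric]
        by (simp add: smult_sum sum_subtractf[symmetric] smult_diff_right smult_add_right algebra_simps)
      moreover have "q dvd upper p \<alpha> \<beta> S T - W" if T: "T \<in> Pow S" for T
      proof -
        let ?f = "\<lambda>i. [:1, - \<alpha> * x i:] * [:- x i, 1:]"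
        let ?g = "\<lambda>j. [:1, - \<beta> * x j:] * [:- t * x j, 1:]"
        have split: "W = prod ?f T * prod ?f (S - T)"
          unfolding W_def using prod.subset_diff[of T S ?f] T S(3) by (simp only: Pow_iff mult.commute)
        have "?g j - ?f j = [:(1 - t) * x j:] * q" for j
          by (simp add: q_def \<alpha>_def algebra_simps)
        then have "q dvd ?g j - ?f j" for j
          by (simp only: dvd_triv_right)
        then have "q dvd prod ?g (S - T) - prod ?f (S - T)"
          by (intro dvd_prod_diff)
        moreover have "p - 1 = - q"
          by (simp add: p_def q_def one_pCons)
        then have "q dvd p - 1" by simp
        moreover have "upper p \<alpha> \<beta> S T - W = (p - 1) * (prod ?f T * prod ?g (S - T)) +
            prod ?f T * (prod ?g (S - T) - prod ?f (S - T))"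
          unfolding upper_def split by (simp only: algebra_simps mult_1)
        ultimately show ?thesis by simp
      qed
      moreover have "q dvd lower q \<beta> S T" for T
        unfolding lower_def by (simp add: mult.assoc)
      ultimately show ?thesis
        by (auto intro!: dvd_sum dvd_smult dvd_add)
    qed
    then obtain D' where D': "D = q * D'" by (elim dvdE)
    let ?A = "insert 0 (x ` S \<union> (\<lambda>k. 1 / (\<beta> * x k)) ` S)"
    have inv_ne: "1 / (\<beta> * x k) \<noteq> x j" "1 / (\<beta> * x k) \<noteq> 0" for j k
      using nz[of k] \<beta> gen[of k j] by (auto simp: field_simps)
    have card_A: "card ?A = Suc (2 * card S)"
    proof -
      have "card (x ` S) = card S" "card ((\<lambda>k. 1 / (\<beta> * x k)) ` S) = card S"
        using nz \<beta> by (auto simp: card_image inj_on_def)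
      moreover have "x ` S \<inter> (\<lambda>k. 1 / (\<beta> * x k)) ` S = {}"
        using inv_ne by (simp add: disjoint_iff image_iff) metis
      moreover have "0 \<notin> x ` S \<union> (\<lambda>k. 1 / (\<beta> * x k)) ` S"
        using inv_ne(2) nz by (metis (no_types, lifting) UnE imageE)
      ultimately show ?thesis
        using S(3) by (simp add: card_Un_disjoint)
    qed
    have D_root: "poly D y = 0" if y_in: "y \<in> ?A" for y
    proof -
      consider "y = 0" | k where "k \<in> S" "y = x k" | k where "k \<in> S" "y = 1 / (\<beta> * x k)"
        using y_in by blast
      then show ?thesis
      proof cases
        case 1
        have "poly ?Y 0 = (\<Sum>T\<in>Pow S. ?K S T * (\<Prod>i\<in>S. - x i))"
          unfolding symm_poly_def poly_sum
        proof (rule sum.cong[OF refl])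
          fix T assume T: "T \<in> Pow S"
          show "poly (smult (?K S T) (smult 1 (lower q \<beta> S T) + smult 1 (upper p \<alpha> \<beta> S T))) 0 =
              ?K S T * (\<Prod>i\<in>S. - x i)"
            using prod_split[OF S(3) T, of "\<lambda>i. - x i"] by (simp add: poly_upper poly_lower poly_p poly_q)
        qed
        then show ?thesis
          by (simp add: 1 D_def W sum_distrib_right[symmetric] IH_S)
      next
        case 2
        then have "poly W y = 0"
          unfolding W using S(3) by (intro prod_zero) auto
        then show ?thesis
          using symm_poly_root[OF S(3) 2(1)] gen 2(2) by (simp add: D_def)
      next
        case 3
        \<comment> \<open>Here 1 - \<beta> x_k y = 0. This kills \<open>lower\<close>, and it kills
          \<open>upper\<close> unless k lies in T, so the surviving sets are
          \<open>insert k T\<close> with T inside R.\<close>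
        define R where "R = S - {k}"
        have R: "S = insert k R" "k \<notin> R" "finite R" "card R < card S'"
          using 3(1) S(3,4) card_Diff1_less[OF S(3) 3(1)] unfolding R_def by auto
        \<comment> \<open>The factor that a letter i of R contributes, the same whether i lies in T
          or not. The sum therefore collapses to the induction hypothesis for R.\<close>
        define G where "G i = (1 - \<alpha> * x k * x i) * (1 - \<alpha> * x i * y) / (\<beta> * x k)" for i
        let ?u = "(1 - \<alpha> * x k * y) * (y - x k)"
        define H where "H T = ?K S T * (poly (lower q \<beta> S T) y + poly (upper p \<alpha> \<beta> S T) y)" for T
        have y: "\<beta> * x k * y = 1"
          using 3 nz \<beta> by simp
        have low: "poly (lower q \<beta> S T) y = 0" if "T \<in> Pow S" for T
        proof -
          have "k \<in> T \<or> k \<in> S - T" "finite T" "finite (S - T)"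
            using 3(1) that S(3) by (auto intro: finite_subset)
          then have "(\<Prod>i\<in>T. (1 - \<beta> * x i * y) * (t * y - x i)) = 0 \<or>
              (\<Prod>j\<in>S - T. (1 - \<beta> * x j * y) * (y - x j)) = 0"
            using y by (auto simp del: prod_zero_iff intro!: prod_zero)
          then show ?thesis
            by (auto simp only: poly_lower mult_zero_left mult_zero_right)
        qed
        have H: "H T + H (insert k T) = ?K R T * (?u * (\<Prod>i\<in>R. G i))" if T: "T \<in> Pow R" for T
        proof -
          have fin: "finite T" "k \<notin> T" using T R by (auto intro: finite_subset)
          have d: "S - insert k T = R - T" using T R by auto
          have "(\<Prod>j\<in>S - T. (1 - \<beta> * x j * y) * (y - t * x j)) = 0"
            using y fin 3(1) S(3) by (intro prod_zero) auto
          then have "poly (upper p \<alpha> \<beta> S T) y = 0"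
            by (simp only: poly_upper mult_zero_right)
          then have "H T = 0"
            using low[of T] T R by (auto simp: H_def)
          moreover have "H (insert k T) = ?K R T * (?u * (\<Prod>i\<in>R. G i))"
          proof -
            have "H (insert k T) = ?K S (insert k T) * poly (upper p \<alpha> \<beta> S (insert k T)) y"
              using low[of "insert k T"] T R by (auto simp: H_def)
            also have "?K S (insert k T) =
                \<beta> * x k ^ 2 * (\<Prod>i\<in>T. ratio \<alpha> \<beta> k i) *
                (\<Prod>j\<in>R - T. (x k - t * x j) / (x k - x j)) * ?K R T"
              unfolding R(1) poly_p[symmetric] using R T by (intro kappa_insert) auto
            also have "poly (upper p \<alpha> \<beta> S (insert k T)) y = \<beta> * y ^ 2 *
                (?u * (\<Prod>i\<in>T. (1 - \<alpha> * x i * y) * (y - x i))) *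
                (\<Prod>j\<in>R - T. (1 - \<beta> * x j * y) * (y - t * x j))"
              unfolding poly_upper poly_p d using fin by simp
            also have "\<beta> * x k ^ 2 * (\<Prod>i\<in>T. ratio \<alpha> \<beta> k i) *
                (\<Prod>j\<in>R - T. (x k - t * x j) / (x k - x j)) * ?K R T *
                (\<beta> * y ^ 2 * (?u * (\<Prod>i\<in>T. (1 - \<alpha> * x i * y) * (y - x i))) *
                (\<Prod>j\<in>R - T. (1 - \<beta> * x j * y) * (y - t * x j))) =
              (\<beta> * x k * y) ^ 2 * (?K R T * (?u *
                (((\<Prod>i\<in>T. ratio \<alpha> \<beta> k i) * (\<Prod>i\<in>T. (1 - \<alpha> * x i * y) * (y - x i))) *
                 ((\<Prod>j\<in>R - T. (x k - t * x j) / (x k - x j)) *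
                  (\<Prod>j\<in>R - T. (1 - \<beta> * x j * y) * (y - t * x j))))))"
              by (simp only: power2_eq_square mult_ac)
            also have "(\<Prod>i\<in>T. ratio \<alpha> \<beta> k i) * (\<Prod>i\<in>T. (1 - \<alpha> * x i * y) * (y - x i)) = (\<Prod>i\<in>T. G i)"
              unfolding prod.distrib[symmetric]
            proof (rule prod.cong[OF refl])
              fix i assume "i \<in> T"
              have "1 - \<beta> * x k * x i \<noteq> 0"
                using gen[of k i] by simp
              moreover have "y - x i = (1 - \<beta> * x k * x i) / (\<beta> * x k)"
                using 3(2) nz[of k] \<beta> by (simp add: field_simps)
              ultimately show "ratio \<alpha> \<beta> k i * ((1 - \<alpha> * x i * y) * (y - x i)) = G i"
                unfolding ratio_def G_def by simp
            qed
            also have "(\<Prod>j\<in>R - T. (x k - t * x j) / (x k - x j)) *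
                  (\<Prod>j\<in>R - T. (1 - \<beta> * x j * y) * (y - t * x j)) = (\<Prod>j\<in>R - T. G j)"
              unfolding prod.distrib[symmetric]
            proof (rule prod.cong[OF refl])
              fix j assume "j \<in> R - T"
              then have "x k - x j \<noteq> 0"
                using R by auto
              moreover have "1 - \<beta> * x j * y = (x k - x j) / x k"
                using 3(2) nz[of k] \<beta> by (simp add: field_simps)
              moreover have "y - t * x j = (1 - \<alpha> * x k * x j) / (\<beta> * x k)"
                using 3(2) nz[of k] \<beta> by (simp add: field_simps \<alpha>_def)
              moreover have "1 - \<alpha> * x j * y = (x k - t * x j) / x k"
                using 3(2) nz[of k] \<beta> by (simp add: field_simps \<alpha>_def)
              ultimately show "(x k - t * x j) / (x k - x j) * ((1 - \<beta> * x j * y) * (y - t * x j)) = G j"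
                unfolding G_def by simp
            qed
            also have "(\<Prod>i\<in>T. G i) * (\<Prod>j\<in>R - T. G j) = (\<Prod>i\<in>R. G i)"
              using prod_split[OF R(3) T, of G] by simp
            finally show ?thesis
              by (simp add: y)
          qed
          ultimately show ?thesis by simp
        qed
        have "poly ?Y y = (\<Sum>T\<in>Pow S. H T)"
          unfolding symm_poly_def poly_sum H_def by simp
        also have "\<dots> = (\<Sum>T\<in>Pow R. ?K R T * (?u * (\<Prod>i\<in>R. G i)))"
          using H sum_Pow_insert[OF R(3,2), of H] R(1) by simp
        also have "\<dots> = pairs \<alpha> \<beta> R * (?u * (\<Prod>i\<in>R. G i))"
          using IH[OF R(4,3)] by (simp add: symm_sum_def flip: sum_distrib_right)
        also have "(\<Prod>i\<in>R. G i) = (\<Prod>i\<in>R. ratio \<alpha> \<beta> k i) * (\<Prod>i\<in>R. (1 - \<alpha> * x i * y) * (y - x i))"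
          unfolding prod.distrib[symmetric]
        proof (rule prod.cong[OF refl])
          fix i assume "i \<in> R"
          have "1 - \<beta> * x k * x i \<noteq> 0"
            using gen[of k i] by simp
          moreover have "y - x i = (1 - \<beta> * x k * x i) / (\<beta> * x k)"
            using 3(2) nz[of k] \<beta> by (simp add: field_simps)
          ultimately show "G i = ratio \<alpha> \<beta> k i * ((1 - \<alpha> * x i * y) * (y - x i))"
            unfolding ratio_def G_def by simp
        qed
        also have "pairs \<alpha> \<beta> R * (?u * ((\<Prod>i\<in>R. ratio \<alpha> \<beta> k i) *
            (\<Prod>i\<in>R. (1 - \<alpha> * x i * y) * (y - x i)))) = pairs \<alpha> \<beta> S * poly W y"
          unfolding W R(1) using R by (simp add: pairs_insert mult_ac)
        finally show ?thesis
          by (simp add: D_def)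
      qed
    qed
    have "D = 0"
    proof (rule ccontr)
      assume "D \<noteq> 0"
      then have "D' \<noteq> 0" "q \<noteq> 0" using D' by auto
      then have "degree D = 2 + degree D'"
        unfolding D' using deg_q by (simp add: degree_mult_eq)
      then have "degree D' < card ?A"
        using deg_D card_A by simp
      moreover have "poly D' y = 0" if y_in: "y \<in> ?A" for y
      proof -
        consider "y = 0" | k where "y = x k" | k where "y = 1 / (\<beta> * x k)"
          using y_in by blast
        \<comment> \<open>q does not vanish at any of the 2n + 1 points, so these are zeros of the
          cofactor D', whose degree is at most 2n.\<close>
        then have "\<beta> * y ^ 2 \<noteq> 1"
        proof cases
          case (2 k)
          then show ?thesis
            using gen[of k k] by (simp add: power2_eq_square mult.assoc)
        next
          case (3 k)
          then have "\<beta> * y ^ 2 = 1 / (\<beta> * x k * x k)"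
            using \<beta> by (simp add: power2_eq_square)
          then show ?thesis
            using gen[of k k] nz[of k] \<beta> by simp
        qed simp
        then show ?thesis
          using D_root[OF y_in] D' by (simp add: poly_q)
      qed
      ultimately have "D' = 0"
        by (rule poly_eq_0_if_roots)
      then show False using \<open>D' \<noteq> 0\<close> by simp
    qed
    then have Y: "?Y = smult (pairs \<alpha> \<beta> S) W"
      by (simp add: D_def)
    let ?Q = "\<Prod>j\<in>S. (x s - x j) * (1 - \<beta> * x s * x j)"
    have "symm_sum (\<lambda>_. 1) p q \<alpha> \<beta> S' * ?Q = pairs \<alpha> \<beta> S * poly W (x s)"
      using symm_sum_insert[OF S(3,2), of \<beta> "\<lambda>_. 1" p q \<alpha>] gen unfolding Y S(1) by simp
    also have "poly W (x s) = (\<Prod>j\<in>S. ratio \<alpha> \<beta> s j) * ?Q"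
      unfolding W prod.distrib[symmetric] ratio_def
    proof (rule prod.cong[OF refl])
      fix j
      have "1 - \<beta> * x s * x j \<noteq> 0"
        using gen[of s j] by simp
      then show "(1 - \<alpha> * x j * x s) * (x s - x j) =
          (1 - \<alpha> * x s * x j) / (1 - \<beta> * x s * x j) * ((x s - x j) * (1 - \<beta> * x s * x j))"
        by (simp add: mult_ac)
    qed
    also have "pairs \<alpha> \<beta> S * ((\<Prod>j\<in>S. ratio \<alpha> \<beta> s j) * ?Q) = pairs \<alpha> \<beta> S' * ?Q"
      unfolding S(1) using S by (simp add: pairs_insert)
    finally have "symm_sum (\<lambda>_. 1) p q \<alpha> \<beta> S' * ?Q = pairs \<alpha> \<beta> S' * ?Q" .
    moreover have "?Q \<noteq> 0"
      using S gen by auto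
    ultimately show ?thesis
      by (simp add: p_def q_def \<alpha>_def)
  qed
qed

end

text \<open>The contribution of m equal rows to c_\<lambda>: their last boxes have legs 0, ..., m -
  1.\<close>

definition odd_poch :: "'a::comm_ring_1 \<Rightarrow> nat \<Rightarrow> 'a" where
  "odd_poch t m = (\<Prod>l\<in>{l. l < m \<and> even l}. 1 - t ^ (l + 1))"

lemma odd_poch_0 [simp]: "odd_poch t 0 = 1"
  by (simp add: odd_poch_def)

lemma odd_poch_Suc:
  "odd_poch t (Suc m) = (if even m then 1 - t ^ (m + 1) else 1) * odd_poch t m"
proof -
  have "{l. l < Suc m \<and> even l} = (if even m then insert m {l. l < m \<and> even l} else {l. l < m \<and> even l})"
    by (auto simp: less_Suc_eq)
  then show ?thesis
    by (simp add: odd_poch_def)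
qed

section \<open>The weights of the part sizes and their regrouping into blocks\<close>

context alphabet
begin

lemma count_sum_eq: "count_sum g S = (\<Sum>T\<in>Pow S. g (card T) * cross T (S - T))"
  by (simp add: symm_sum_def kappa_1)

lemma count_sum_cong:
  assumes "finite S" "\<And>k. k \<le> card S \<Longrightarrow> g k = g' k"
  shows "count_sum g S = count_sum g' S"
  unfolding count_sum_eq using assms by (intro sum.cong) (auto simp: card_mono)

lemma count_sum_add: "count_sum (\<lambda>k. g k + g' k) S = count_sum g S + count_sum g' S"
  by (simp add: count_sum_eq distrib_right sum.distrib)

lemma count_sum_scale: "count_sum (\<lambda>k. c * g k) S = c * count_sum g S"
  by (simp add: count_sum_eq mult.assoc sum_distrib_left)

text \<open>Gauss's alternating sums A_n and B_n of t-binomials, proved together. The first Pascal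
  rule gives A_{n+1} = B_n - A_n. In the second rule the power of t multiplying (-1)^k no longer
  depends on k, which gives B_{n+1} = B_n - t^{n+1} A_n.\<close>

lemma count_sum_alternating:
  assumes "finite S" "\<And>i. x i \<noteq> 0"
  shows "count_sum (\<lambda>k. (- 1) ^ k) S = (if even (card S) then odd_poch t (card S) else 0)"
    and "count_sum (\<lambda>k. (- t) ^ k) S = odd_poch t (card S)"
  using assms(1)
proof (induction S rule: finite_induct)
  case empty
  show "count_sum (\<lambda>k. (- 1) ^ k) {} = (if even (card {}) then odd_poch t (card {}) else 0)"
    and "count_sum (\<lambda>k. (- t) ^ k) {} = odd_poch t (card {})"
    by (simp_all add: count_sum_eq)
next
  case (insert s S)
  let ?n = "card S"
  have "count_sum (\<lambda>k. (- 1) ^ k) (insert s S) = count_sum (\<lambda>k. (- 1) * (- 1) ^ k + (- t) ^ k) S"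
    by (subst count_sum_insert[OF insert(1,2)]) (simp add: power_mult_distrib[symmetric])
  also have "\<dots> = (- 1) * count_sum (\<lambda>k. (- 1) ^ k) S + count_sum (\<lambda>k. (- t) ^ k) S"
    by (simp only: count_sum_add count_sum_scale)
  finally have a: "count_sum (\<lambda>k. (- 1) ^ k) (insert s S) = \<dots>" .
  have "count_sum (\<lambda>k. (- t) ^ k) (insert s S) =
      count_sum (\<lambda>k. (- t) ^ Suc k * t ^ (?n - k) + (- t) ^ k) S"
    by (subst count_sum_insert'[OF insert(1,2) assms(2)]) simp
  also have "\<dots> = count_sum (\<lambda>k. (- (t ^ Suc ?n)) * (- 1) ^ k + (- t) ^ k) S"
  proof (rule count_sum_cong[OF insert(1)])
    fix k assume "k \<le> ?n"
    then have "t ^ Suc k * t ^ (?n - k) = t ^ Suc ?n"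
      by (simp flip: power_add)
    then show "(- t) ^ Suc k * t ^ (?n - k) + (- t) ^ k =
        (- (t ^ Suc ?n)) * (- 1) ^ k + (- t) ^ k"
      by (simp add: power_minus[of t] mult_ac)
  qed
  also have "\<dots> = (- (t ^ Suc ?n)) * count_sum (\<lambda>k. (- 1) ^ k) S + count_sum (\<lambda>k. (- t) ^ k) S"
    by (simp only: count_sum_add count_sum_scale)
  finally have b: "count_sum (\<lambda>k. (- t) ^ k) (insert s S) = \<dots>" .
  show "count_sum (\<lambda>k. (- 1) ^ k) (insert s S) =
      (if even (card (insert s S)) then odd_poch t (card (insert s S)) else 0)"
    unfolding a insert.IH using insert(1,2) by (simp add: odd_poch_Suc)
  show "count_sum (\<lambda>k. (- t) ^ k) (insert s S) = odd_poch t (card (insert s S))"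
    unfolding b insert.IH using insert(1,2) by (simp add: odd_poch_Suc algebra_simps)
qed

lemma E_infinite: "infinite S \<Longrightarrow> E u S = 0"
  by (simp add: E_def)

definition mult_weight :: "nat \<Rightarrow> nat \<Rightarrow> 'a" where
  "mult_weight p m = (if odd p \<or> even m then odd_poch t m else 0)"

text \<open>All rows of length p together. The exponent \<open>(p + 1) div 2\<close> is the share of
  one such row in (o(\<lambda>) + |\<lambda>|)/2.\<close>

definition level :: "nat \<Rightarrow> nat set \<Rightarrow> 'a" where
  "level p = twist (\<lambda>i. x i ^ p / t ^ ((p + 1) div 2))
    (\<lambda>S. if finite S then mult_weight p (card S) else 0)"

abbreviation tau :: "nat \<Rightarrow> nat \<Rightarrow> 'a" where
  "tau k \<equiv> \<lambda>i. (x i ^ 2 / t) ^ k"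

text \<open>Up to the sign (-1)^|S| the product is the alternating sum of t-binomials, which is zero
  for odd |S|: this is the multiplicity condition on even parts.\<close>

lemma level_even:
  assumes "\<And>i. x i \<noteq> 0"
  shows "level (2 * k) = twist (tau k) (E (\<lambda>_. 1) \<star> E (\<lambda>_. - 1))"
proof
  fix S
  have "(E (\<lambda>_. 1) \<star> E (\<lambda>_. - 1)) S = mult_weight (2 * k) (card S)" if "finite S"
  proof -
    have "(E (\<lambda>_. 1) \<star> E (\<lambda>_. - 1)) S = (\<Sum>T\<in>Pow S. (- 1) ^ card S * ((- 1) ^ card T * cross T (S - T)))"
      unfolding star_def
    proof (rule sum.cong[OF refl])
      fix T assume T: "T \<in> Pow S"
      then have fin: "finite T" "finite (S - T)"
        using that by (auto intro: finite_subset)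
      have "card S = card (S - T) + card T"
        using T that fin by (simp add: card_Diff_subset card_mono)
      then have "(- 1 :: 'a) ^ card (S - T) = (- 1) ^ card S * (- 1) ^ card T"
        by (simp add: power_add mult.assoc flip: power_mult_distrib)
      then show "cross T (S - T) * (E (\<lambda>_. 1) T * E (\<lambda>_. - 1) (S - T)) =
          (- 1) ^ card S * ((- 1) ^ card T * cross T (S - T))"
        using fin by (simp add: E_def)
    qed
    also have "\<dots> = mult_weight (2 * k) (card S)"
      unfolding sum_distrib_left[symmetric] count_sum_eq[symmetric]
      by (simp add: count_sum_alternating that assms mult_weight_def)
    finally show ?thesis .
  qed
  then show "level (2 * k) S = twist (tau k) (E (\<lambda>_. 1) \<star> E (\<lambda>_. - 1)) S"
    by (simp add: level_def twist_def E_def power_mult power_divide)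
qed

text \<open>x^{2k+1} / t^{k+1} exceeds \<tau>^k by a factor x/t, which is absorbed by
  \<open>E_{-t}\<close> and \<open>E_1\<close>.\<close>

lemma level_odd:
  assumes "\<And>i. x i \<noteq> 0" "t \<noteq> 0"
  shows "level (2 * k + 1) = twist (tau k) (E (\<lambda>i. - x i) \<star> E (\<lambda>i. x i / t))"
proof
  fix S
  have "(E (\<lambda>_. - t) \<star> E (\<lambda>_. 1)) S = mult_weight (2 * k + 1) (card S)" if "finite S"
  proof -
    have "(E (\<lambda>_. - t) \<star> E (\<lambda>_. 1)) S = (\<Sum>T\<in>Pow S. (- t) ^ card T * cross T (S - T))"
      unfolding star_def using that
      by (intro sum.cong) (auto simp: E_def finite_subset)
    also have "\<dots> = mult_weight (2 * k + 1) (card S)"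
      unfolding count_sum_eq[symmetric]
      by (simp add: count_sum_alternating that assms mult_weight_def)
    finally show ?thesis .
  qed
  moreover have "twist (tau k) (E (\<lambda>i. - x i) \<star> E (\<lambda>i. x i / t)) =
      twist (\<lambda>i. x i ^ (2 * k + 1) / t ^ ((2 * k + 1 + 1) div 2)) (E (\<lambda>_. - t) \<star> E (\<lambda>_. 1))"
  proof -
    have "E (\<lambda>i. - x i) \<star> E (\<lambda>i. x i / t) = twist (\<lambda>i. x i / t) (E (\<lambda>_. - t) \<star> E (\<lambda>_. 1))"
      using assms(2) by (simp add: twist_star twist_E)
    then show ?thesis
      by (simp add: twist_twist power_divide mult_ac flip: power_mult)
  qed
  ultimately show "level (2 * k + 1) S = twist (tau k) (E (\<lambda>i. - x i) \<star> E (\<lambda>i. x i / t)) S"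
    by (simp add: level_def twist_def E_def)
qed

text \<open>Larger parts stand further left. The initial \<open>E_1\<close> takes the letters that
  are left over for the parts 0, whose multiplicity is free.\<close>

primrec levels :: "nat \<Rightarrow> nat set \<Rightarrow> 'a" where
  "levels 0 = E (\<lambda>_. 1)"
| "levels (Suc M) = level (Suc M) \<star> levels M"

definition two_levels :: "nat set \<Rightarrow> 'a" where
  "two_levels = E (\<lambda>i. (1 + x i / t) * (1 - x i))"

text \<open>With V for \<open>two_levels\<close>, \<open>tail k\<close> is \<tau>^{k-1} V \<star>
  ... \<star> \<tau> V \<star> V.\<close>

primrec tail :: "nat \<Rightarrow> nat set \<Rightarrow> 'a" where
  "tail 0 = layer 0"
| "tail (Suc k) = twist (tau k) two_levels \<star> tail k"

lemma star_layer_0: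
  assumes "\<And>S. infinite S \<Longrightarrow> f S = 0"
  shows "f \<star> layer 0 = f"
proof
  fix S
  show "(f \<star> layer 0) S = f S"
  proof (cases "finite S")
    case True
    then have "(f \<star> layer 0) S = (\<Sum>T\<in>{S}. cross T (S - T) * (f T * layer 0 (S - T)))"
      unfolding star_def by (intro sum.mono_neutral_right) (auto simp: layer_def)
    then show ?thesis by (simp add: layer_def)
  qed (simp add: star_infinite assms)
qed

lemma twist_one_star_layer_0:
  assumes "\<And>S. infinite S \<Longrightarrow> f S = 0"
  shows "twist (tau 0) f \<star> layer 0 = f"
proof -
  have "twist (tau 0) f = f"
    using assms by (fastforce simp: twist_def E_def)
  then show ?thesis
    using star_layer_0[OF assms] by simp
qed

lemma layer_0_star: "finite S \<Longrightarrow> (layer 0 \<star> f) S = f S"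
proof -
  assume "finite S"
  then have "(layer 0 \<star> f) S = (\<Sum>T\<in>{{}}. cross T (S - T) * (layer 0 T * f (S - T)))"
    unfolding star_def by (intro sum.mono_neutral_right) (auto simp: layer_def dest: finite_subset)
  then show ?thesis by (simp add: layer_def)
qed

text \<open>The four factors are \<open>E_{-1}\<close> of level 2, both factors of level 1 and
  \<open>E_1\<close> of level 0. The outer pairs merge with a = 1/t, giving -x (1 + x/t) and 1 +
  x/t; these results merge with a = -1.\<close>

lemma two_levels_eq:
  assumes "\<And>i. x i \<noteq> 0"
  shows "two_levels = E (\<lambda>i. - (x i ^ 2 / t)) \<star> E (\<lambda>i. - x i) \<star> E (\<lambda>i. x i / t) \<star> E (\<lambda>_. 1)"
proof -
  have "E (\<lambda>i. x i / t) \<star> E (\<lambda>_. 1) = E (\<lambda>i. 1 + x i / t)"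
    using star_E_affine[OF assms, of "1 / t"] by simp
  moreover have "E (\<lambda>i. - (x i ^ 2 / t)) \<star> E (\<lambda>i. - x i) = E (\<lambda>i. (1 + x i / t) * (- 1 * x i))"
    using star_E_mult[OF assms, of "\<lambda>i. - x i" "1 / t"] by (simp add: power2_eq_square algebra_simps)
  moreover have "E (\<lambda>i. (1 + x i / t) * (- 1 * x i)) \<star> E (\<lambda>i. 1 + x i / t) = two_levels"
    using star_E_mult[OF assms, of "\<lambda>i. 1 + x i / t" "- 1"] by (simp add: two_levels_def)
  ultimately show ?thesis
    by (simp flip: star_assoc)
qed

text \<open>The right half of level 2k + 2, level 2k + 1 and the left half of level 2k form the
  block \<tau>^k V. Only the left half of the topmost level stays outside the blocks.\<close>

lemma levels_even:
  assumes "\<And>i. x i \<noteq> 0" "t \<noteq> 0"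
  shows "levels (2 * k) = twist (tau k) (E (\<lambda>_. 1)) \<star> tail k"
proof (induction k)
  case 0
  then show ?case
    using twist_one_star_layer_0[of "E (\<lambda>_. 1)"] by (simp add: E_infinite)
next
  case (Suc k)
  have "levels (2 * Suc k) = level (2 * Suc k) \<star> level (2 * k + 1) \<star> levels (2 * k)"
    by simp
  also have "\<dots> = twist (tau (Suc k)) (E (\<lambda>_. 1)) \<star> (twist (tau (Suc k)) (E (\<lambda>_. - 1)) \<star>
      twist (tau k) (E (\<lambda>i. - x i)) \<star> twist (tau k) (E (\<lambda>i. x i / t)) \<star> twist (tau k) (E (\<lambda>_. 1))) \<star> tail k"
    unfolding level_even[OF assms(1)] level_odd[OF assms] Suc.IH twist_star star_assoc ..
  \<comment> \<open>The surplus \<tau> of the higher level becomes the factor x^2/t that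
    \<open>two_levels_eq\<close> asks for.\<close>
  also have "twist (tau (Suc k)) (E (\<lambda>_. - 1)) = twist (tau k) (E (\<lambda>i. - (x i ^ 2 / t)))"
    by (simp add: twist_E mult.commute)
  also have "twist (tau k) (E (\<lambda>i. - (x i ^ 2 / t))) \<star> twist (tau k) (E (\<lambda>i. - x i)) \<star>
      twist (tau k) (E (\<lambda>i. x i / t)) \<star> twist (tau k) (E (\<lambda>_. 1)) = twist (tau k) two_levels"
    by (simp add: two_levels_eq[OF assms(1)] twist_star)
  finally show ?case
    by simp
qed

text \<open>The right-hand side of the theorem in the letters of S. The diagonal factors i = j have
  been combined with the linear ones: 1 - x^2 divided by 1 + x leaves 1 - x.\<close>

definition closed_form :: "nat set \<Rightarrow> 'a" where
  "closed_form = twist (\<lambda>i. (1 + x i / t) * (1 - x i) / (1 - x i ^ 2 / t)) (pairs 1 (1 / t))"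

lemma closed_form_infinite: "infinite S \<Longrightarrow> closed_form S = 0"
  by (simp add: closed_form_def twist_def E_infinite)

text \<open>This is \<open>littlewood_sum\<close> at \<beta> = 1/t, where \<alpha> = 1, twisted by
  \<phi>; the twist turns 1 - x^2/t into (1 + x/t)(1 - x).\<close>

lemma closed_form_unfold:
  assumes nz: "\<And>i. x i \<noteq> 0" and "t \<noteq> 0" and gen: "\<And>i j. x i * x j \<noteq> t"
  shows "closed_form = twist (tau 1) closed_form \<star> two_levels"
proof
  fix S
  let ?\<phi> = "\<lambda>i. (1 + x i / t) * (1 - x i) / (1 - x i ^ 2 / t)"
  show "closed_form S = (twist (tau 1) closed_form \<star> two_levels) S"
  proof (cases "finite S")
    case True
    have ne: "1 / t * x i * x j \<noteq> 1" for i j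
      using gen[of i j] \<open>t \<noteq> 0\<close> by (simp add: field_simps)
    have "closed_form S = E ?\<phi> S * (twist (tau 1) (pairs 1 (1 / t)) \<star> E (\<lambda>i. 1 - x i ^ 2 / t)) S"
    proof -
      have "pairs 1 (1 / t) S = (\<Sum>T\<in>Pow S. kappa [:0, 0, 1 / t:] [:1, 0, - (1 / t):] 1 (1 / t) S T)"
        using littlewood_sum[OF nz ne _ True] \<open>t \<noteq> 0\<close> by (simp add: symm_sum_def)
      also have "\<dots> = (twist (tau 1) (pairs 1 (1 / t)) \<star> E (\<lambda>i. 1 - x i ^ 2 / t)) S"
        unfolding star_def
      proof (rule sum.cong[OF refl])
        fix T assume "T \<in> Pow S"
        then have "finite T" "finite (S - T)" using True by (auto intro: finite_subset)
        then show "kappa [:0, 0, 1 / t:] [:1, 0, - (1 / t):] 1 (1 / t) S T =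
            cross T (S - T) * (twist (tau 1) (pairs 1 (1 / t)) T * E (\<lambda>i. 1 - x i ^ 2 / t) (S - T))"
          by (simp add: kappa_def twist_def E_def power2_eq_square)
      qed
      finally show ?thesis by (simp add: closed_form_def twist_def)
    qed
    also have "\<dots> = (twist ?\<phi> (twist (tau 1) (pairs 1 (1 / t)) \<star> E (\<lambda>i. 1 - x i ^ 2 / t))) S"
      by (simp add: twist_def)
    also have "\<dots> = (twist (tau 1) closed_form \<star> E (\<lambda>i. ?\<phi> i * (1 - x i ^ 2 / t))) S"
      by (simp add: twist_star twist_E twist_twist closed_form_def mult.commute)
    also have "(\<lambda>i. ?\<phi> i * (1 - x i ^ 2 / t)) = (\<lambda>i. (1 + x i / t) * (1 - x i))"
    proof
      fix i
      have "1 - x i ^ 2 / t \<noteq> 0"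
        using gen[of i i] \<open>t \<noteq> 0\<close> by (simp add: power2_eq_square)
      then show "?\<phi> i * (1 - x i ^ 2 / t) = (1 + x i / t) * (1 - x i)"
        by simp
    qed
    finally show ?thesis
      by (simp add: two_levels_def)
  qed (simp add: star_infinite closed_form_def twist_def E_def)
qed

lemma closed_form_eq:
  assumes "\<And>i. x i \<noteq> 0" "t \<noteq> 0" "\<And>i j. x i * x j \<noteq> t"
  shows "closed_form = twist (tau k) closed_form \<star> tail k"
proof (induction k)
  case 0
  then show ?case
    using twist_one_star_layer_0[of closed_form] by (simp add: closed_form_infinite)
next
  case (Suc k)
  have "twist (tau k) closed_form = twist (tau (Suc k)) closed_form \<star> twist (tau k) two_levels"
    by (subst closed_form_unfold[OF assms]) (simp add: twist_star twist_twist mult.commute)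
  then show ?case
    by (subst Suc.IH) (simp add: star_assoc)
qed

text \<open>Both functions have the form \<open>twist (tau k) f \<star> tail k\<close>, with f =
  \<open>E_1\<close> and f = \<open>closed_form\<close>. As \<open>closed_form {}\<close> is 1, the
  term T = {} drops out and each remaining term has the factor \<tau>^k of at least one
  letter.\<close>

lemma levels_diff:
  assumes "\<And>i. x i \<noteq> 0" "t \<noteq> 0" "\<And>i j. x i * x j \<noteq> t"
  shows "levels (2 * k) S - closed_form S =
    (\<Sum>T\<in>Pow S - {{}}. cross T (S - T) * (E (tau k) T * (1 - closed_form T) * tail k (S - T)))"
proof (cases "finite S")
  case True
  have "levels (2 * k) S - closed_form S =
      (\<Sum>T\<in>Pow S. cross T (S - T) * (E (tau k) T * (1 - closed_form T) * tail k (S - T)))"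
    unfolding levels_even[OF assms(1,2)]
    by (subst closed_form_eq[OF assms, of k])
       (use True in \<open>auto simp: star_def sum_subtractf[symmetric] twist_def E_def algebra_simps
          dest: finite_subset intro!: sum.cong\<close>)
  also have "\<dots> = (\<Sum>T\<in>Pow S - {{}}. cross T (S - T) * (E (tau k) T * (1 - closed_form T) * tail k (S - T)))"
    using True by (intro sum.mono_neutral_right) (auto simp: closed_form_def twist_def E_def)
  finally show ?thesis .
next
  case False
  then have "levels (2 * k) S = 0" "closed_form S = 0"
    unfolding levels_even[OF assms(1,2)] by (simp_all add: star_infinite closed_form_def twist_def E_def)
  moreover have "infinite (Pow S - {{}})"
    using False by simp
  ultimately show ?thesis
    by simp
qed

end

section \<open>Partitions\<close>

lemma is_partition_Cons:
  "is_partition (p # la) \<longleftrightarrow> p \<noteq> 0 \<and> (\<forall>r\<in>set la. r \<le> p) \<and> is_partition la"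
  by (auto simp: is_partition_def)

text \<open>The boxes with arm 0 are the last boxes of the rows.\<close>

lemma c_factor_rows:
  assumes "is_partition la"
  shows "c_factor t la = (\<Prod>i<length la. let l = card {r. i < r \<and> r < length la \<and> la ! i \<le> la ! r}
    in if even l then 1 - t ^ (l + 1) else 1)"
proof -
  let ?l = "\<lambda>i. card {r. i < r \<and> r < length la \<and> la ! i \<le> la ! r}"
  have pos: "0 < la ! i" if "i < length la" for i
    using assms nth_mem[OF that] by (metis gr0I is_partition_def)
  have arm: "arm la (i, j) = la ! i - Suc j" if "i < length la" for i j
  proof -
    have "{(a, b) \<in> diagram la. a = i \<and> b > j} = Pair i ` {Suc j..<la ! i}"
      using that by (auto simp: diagram_def)
    then show ?thesis
      by (simp add: arm_def card_image inj_on_def)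
  qed
  have leg: "leg la (i, la ! i - 1) = ?l i" if "i < length la" for i
  proof -
    have "{(a, b) \<in> diagram la. a > i \<and> b = la ! i - 1} =
        (\<lambda>r. (r, la ! i - 1)) ` {r. i < r \<and> r < length la \<and> la ! i \<le> la ! r}"
      using pos[OF that] by (auto simp: diagram_def image_iff)
    then show ?thesis
      by (simp add: leg_def card_image inj_on_def)
  qed
  have boxes: "{s \<in> diagram la. arm la s = 0 \<and> even (leg la s)} =
      (\<lambda>i. (i, la ! i - 1)) ` {i \<in> {..<length la}. even (?l i)}" (is "?A = ?B")
  proof (intro equalityI subsetI)
    fix s assume "s \<in> ?A"
    then obtain i j where s: "s = (i, j)" "i < length la" "j < la ! i" "la ! i \<le> Suc j" "even (leg la s)"
      by (cases s) (auto simp: diagram_def arm)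
    then have "j = la ! i - 1" by simp
    then show "s \<in> ?B"
      using s leg[OF s(2)] by auto
  next
    fix s assume "s \<in> ?B"
    then obtain i where s: "s = (i, la ! i - 1)" "i < length la" "even (?l i)"
      by auto
    then show "s \<in> ?A"
      using pos[OF s(2)] arm[OF s(2)] leg[OF s(2)] by (auto simp: diagram_def)
  qed
  have "c_factor t la = (\<Prod>i\<in>{i \<in> {..<length la}. even (?l i)}. 1 - t ^ (leg la (i, la ! i - 1) + 1))"
    unfolding c_factor_def boxes by (subst prod.reindex) (auto simp: inj_on_def)
  also have "\<dots> = (\<Prod>i\<in>{i \<in> {..<length la}. even (?l i)}. 1 - t ^ (?l i + 1))"
    by (intro prod.cong refl) (auto simp: leg[unfolded One_nat_def])
  also have "\<dots> = (\<Prod>i<length la. if even (?l i) then 1 - t ^ (?l i + 1) else 1)"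
    by (rule prod.inter_filter) simp
  finally show ?thesis
    by (simp add: Let_def)
qed

text \<open>A row added on top leaves all other legs unchanged, and below its own last box are
  exactly the rows of the same length.\<close>

lemma c_factor_Cons:
  assumes "is_partition (p # la)"
  shows "c_factor t (p # la) =
    (if even (count_list la p) then 1 - t ^ (count_list la p + 1) else 1) * c_factor t la"
proof -
  have la: "is_partition la" "\<forall>r\<in>set la. r \<le> p"
    using assms by (auto simp: is_partition_Cons)
  let ?l = "\<lambda>la i. card {r. i < r \<and> r < length la \<and> la ! i \<le> la ! r}"
  have "{r. 0 < r \<and> r < length (p # la) \<and> (p # la) ! 0 \<le> (p # la) ! r} =
      Suc ` {r. r < length la \<and> p = la ! r}"
  proof (intro equalityI subsetI)
    fix r assume "r \<in> {r. 0 < r \<and> r < length (p # la) \<and> (p # la) ! 0 \<le> (p # la) ! r}"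
    then obtain r' where "r = Suc r'" "r' < length la" "p \<le> la ! r'"
      by (cases r) auto
    moreover from this have "p = la ! r'"
      using la(2) nth_mem[of r' la] by (auto intro: antisym)
    ultimately show "r \<in> Suc ` {r. r < length la \<and> p = la ! r}"
      by blast
  qed auto
  then have "?l (p # la) 0 = count_list la p"
    by (simp add: card_image count_list_eq_length_filter length_filter_conv_card)
  moreover have "?l (p # la) (Suc i) = ?l la i" for i
  proof -
    have "{r. Suc i < r \<and> r < length (p # la) \<and> (p # la) ! Suc i \<le> (p # la) ! r} =
        Suc ` {r. i < r \<and> r < length la \<and> la ! i \<le> la ! r}" (is "?A = ?B")
    proof (intro equalityI subsetI)
      fix r assume "r \<in> ?A"
      then show "r \<in> ?B" by (cases r) auto
    qed auto
    then show ?thesis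
      by (simp add: card_image)
  qed
  ultimately show ?thesis
    unfolding c_factor_rows[OF assms] c_factor_rows[OF la(1)] list.size(4) add_0_right add_Suc_right
      One_nat_def prod.lessThan_Suc_shift
    by (simp add: Let_def)
qed

lemma is_partition_replicate_append:
  assumes "is_partition la" "\<forall>r\<in>set la. r \<le> M"
  shows "is_partition (replicate m (Suc M) @ la)"
  using assms by (induction m) (auto simp: is_partition_Cons in_set_replicate)

lemma count_list_replicate: "count_list (replicate m p) r = (if r = p then m else 0)"
  by (induction m) auto

lemma c_factor_replicate_append:
  assumes "is_partition la" "\<forall>r\<in>set la. r \<le> M"
  shows "c_factor t (replicate m (Suc M) @ la) = odd_poch t m * c_factor t la"
proof (induction m)
  case (Suc m)
  have "count_list la (Suc M) = 0"
    using assms(2) by (fastforce simp: count_list_0_iff)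
  then show ?case
    using c_factor_Cons[of "Suc M" "replicate m (Suc M) @ la" t]
      is_partition_replicate_append[OF assms, of "Suc m"] Suc
    by (simp add: count_list_replicate odd_poch_Suc mult.assoc)
qed simp

definition admissible :: "nat list \<Rightarrow> bool" where
  "admissible la \<longleftrightarrow> (\<forall>p\<in>set la. even p \<longrightarrow> even (count_list la p))"

text \<open>The value 0 outside the admissible partitions allows sums over all partitions.\<close>

definition coefficient :: "'a::field \<Rightarrow> nat list \<Rightarrow> 'a" where
  "coefficient t la =
    (if admissible la then c_factor t la / t ^ ((odd_parts la + sum_list la) div 2) else 0)"

lemma admissible_replicate_append:
  assumes "\<forall>r\<in>set la. r \<le> M"
  shows "admissible (replicate m (Suc M) @ la) \<longleftrightarrow> (odd (Suc M) \<or> even m) \<and> admissible la"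
proof -
  have c0: "count_list la (Suc M) = 0"
    using assms by (fastforce simp: count_list_0_iff)
  have "count_list (replicate m (Suc M) @ la) p = count_list la p" if "p \<in> set la" for p
    using assms that by (fastforce simp: count_list_replicate)
  moreover have "count_list (replicate m (Suc M) @ la) (Suc M) = m"
    using c0 by (simp add: count_list_replicate)
  ultimately show ?thesis
    unfolding admissible_def set_append set_replicate_conv_if
    by (cases "m = 0") (auto simp del: count_list_append)
qed

lemma weight_exponent:
  "(odd_parts (replicate m p @ la) + sum_list (replicate m p @ la)) div 2 =
    ((p + 1) div 2) * m + (odd_parts la + sum_list la) div 2"
proof (induction m)
  case (Suc m)
  have "odd_parts (p # la') + sum_list (p # la') = 2 * ((p + 1) div 2) + (odd_parts la' + sum_list la')" for la'
    by (auto simp: odd_parts_def elim: oddE evenE)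
  from this[of "replicate m p @ la"] Suc show ?case by simp
qed simp

text \<open>N bounds each multiplicity rather than the length, so that every step is a full product
  set. Partitions with more rows than letters do no harm: their Hall-Littlewood values vanish
  (\<open>rows_eq_0\<close>).\<close>

primrec partitions_in :: "nat \<Rightarrow> nat \<Rightarrow> nat list set" where
  "partitions_in N 0 = {[]}"
| "partitions_in N (Suc M) =
    (\<lambda>(m, la). replicate m (Suc M) @ la) ` ({..N} \<times> partitions_in N M)"

lemma partitions_in_props:
  "la \<in> partitions_in N M \<Longrightarrow> is_partition la \<and> (\<forall>r\<in>set la. r \<le> M)"
proof (induction M arbitrary: la)
  case (Suc M)
  then obtain m mu where la: "la = replicate m (Suc M) @ mu" "mu \<in> partitions_in N M"
    by auto
  then show ?case
    using Suc.IH[OF la(2)] is_partition_replicate_append[of mu M m] by (auto simp: le_SucI)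
qed (simp add: is_partition_def)

lemma finite_partitions_in [simp]: "finite (partitions_in N M)"
  by (induction M) auto

lemma in_partitions_in:
  assumes "is_partition la" "\<forall>r\<in>set la. r \<le> M" "length la \<le> N"
  shows "la \<in> partitions_in N M"
  using assms
proof (induction M arbitrary: la)
  case 0
  then show ?case by (cases la) (auto simp: is_partition_Cons)
next
  case (Suc M)
  have "\<exists>m mu. la = replicate m (Suc M) @ mu \<and> (\<forall>r\<in>set mu. r \<le> M) \<and> is_partition mu \<and>
      m + length mu = length la"
    using Suc.prems(1,2)
  proof (induction la)
    case (Cons p la)
    show ?case
    proof (cases "p = Suc M")
      case True
      obtain m mu where "la = replicate m (Suc M) @ mu" "\<forall>r\<in>set mu. r \<le> M" "is_partition mu"
        "m + length mu = length la"
        using Cons by (auto simp: is_partition_Cons)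
      then show ?thesis
        using True by (intro exI[of _ "Suc m"] exI[of _ mu]) auto
    next
      case False
      then have "\<forall>r\<in>set (p # la). r \<le> M"
        using Cons.prems by (auto simp: is_partition_Cons intro: order.trans)
      then show ?thesis
        using Cons.prems by (intro exI[of _ 0] exI[of _ "p # la"]) auto
    qed
  qed auto
  then obtain m mu where "la = replicate m (Suc M) @ mu" "\<forall>r\<in>set mu. r \<le> M" "is_partition mu"
      "m + length mu = length la"
    by auto
  then show ?case
    using Suc.IH[of mu] Suc.prems(3) by auto
qed

lemma inj_on_partitions_in:
  "inj_on (\<lambda>(m, la). replicate m (Suc M) @ la) ({..N} \<times> partitions_in N M)"
proof (rule inj_onI, clarify)
  fix m la m' la'
  assume eq: "replicate m (Suc M) @ la = replicate m' (Suc M) @ la'"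
    and "la \<in> partitions_in N M" "la' \<in> partitions_in N M"
  then have "count_list la (Suc M) = 0" "count_list la' (Suc M) = 0"
    using partitions_in_props by (fastforce simp: count_list_0_iff)+
  with arg_cong[OF eq, of "\<lambda>l. count_list l (Suc M)"] have "m = m'"
    by (simp add: count_list_replicate)
  with eq show "m = m' \<and> la = la'" by simp
qed

section \<open>Hall-Littlewood functions as star products of rows\<close>

definition q_fact :: "'a::field \<Rightarrow> nat \<Rightarrow> 'a" where
  "q_fact t m = (\<Prod>j = 1..m. (1 - t ^ j) / (1 - t))"

lemma q_fact_0 [simp]: "q_fact t 0 = 1"
  by (simp add: q_fact_def)

lemma q_fact_Suc: "q_fact t (Suc m) = (1 - t ^ Suc m) / (1 - t) * q_fact t m"
  by (simp add: q_fact_def mult.commute)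

lemma hl_v_eq: "hl_v t mu = (\<Prod>i\<in>set mu. q_fact t (count_list mu i))"
  by (simp add: hl_v_def q_fact_def)

lemma hl_v_split:
  assumes "p \<notin> set la"
  shows "hl_v t (replicate m p @ la) = q_fact t m * hl_v t la"
    and "hl_v t (la @ replicate m p) = q_fact t m * hl_v t la"
proof -
  have c: "count_list la p = 0" using assms by (simp add: count_list_0_iff)
  have "(\<Prod>i\<in>set la. q_fact t (count_list (replicate m p @ la) i)) = hl_v t la"
      "(\<Prod>i\<in>set la. q_fact t (count_list (la @ replicate m p) i)) = hl_v t la"
    unfolding hl_v_eq using assms by (auto simp: count_list_replicate intro!: prod.cong)
  then show "hl_v t (replicate m p @ la) = q_fact t m * hl_v t la"
      "hl_v t (la @ replicate m p) = q_fact t m * hl_v t la"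
    unfolding hl_v_eq[of t "replicate m p @ la"] hl_v_eq[of t "la @ replicate m p"]
    using assms c by (cases "m = 0"; simp add: count_list_replicate set_replicate_conv_if)+
qed

lemma hl_v_nonzero:
  assumes "\<And>j. j \<ge> 1 \<Longrightarrow> t ^ j \<noteq> 1"
  shows "hl_v t mu \<noteq> 0"
proof -
  have "t ^ j \<noteq> 1" if "Suc 0 \<le> j" for j using assms that by simp
  moreover have "t \<noteq> 1" using assms[of 1] by simp
  ultimately show ?thesis
    by (auto simp: hl_v_def)
qed

context alphabet
begin

definition row :: "nat \<Rightarrow> nat set \<Rightarrow> 'a" where
  "row p = twist (\<lambda>i. x i ^ p) single_box"

primrec rows :: "nat list \<Rightarrow> nat set \<Rightarrow> 'a" where
  "rows [] = E (\<lambda>_. 1)"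
| "rows (p # la) = row p \<star> rows la"

text \<open>Only the nonzero parts are normalised. The factor of v belonging to the parts 0 cancels
  in the symmetrisation over the leftover letters (\<open>word_sum_padded\<close>), so the formula
  is independent of the number of letters.\<close>

definition HL :: "nat list \<Rightarrow> nat set \<Rightarrow> 'a" where
  "HL la S = rows la S / hl_v t la"

lemma star_scale_left: "((\<lambda>S. c * f S) \<star> g) S = c * (f \<star> g) S"
  by (simp add: star_def sum_distrib_left mult_ac)

lemma star_scale_right: "(f \<star> (\<lambda>S. c * g S)) S = c * (f \<star> g) S"
  by (simp add: star_def sum_distrib_left mult_ac)

lemma count_sum_single:
  assumes "finite S"
  shows "count_sum (\<lambda>k. if k = 0 then 1 else 0) S = 1"
    and "count_sum (\<lambda>k. if k = 1 then 1 else 0) S = (\<Sum>i<card S. t ^ i)"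
proof -
  have one: "count_sum (\<lambda>k. if k = 0 then 1 else 0) S = 1" if "finite S" for S
  proof -
    have "count_sum (\<lambda>k. if k = 0 then 1 else 0) S =
        (\<Sum>T\<in>{{}}. (if card T = 0 then 1 else 0) * cross T (S - T))"
      unfolding count_sum_eq using that
      by (intro sum.mono_neutral_right) (auto dest: finite_subset)
    then show ?thesis by simp
  qed
  show "count_sum (\<lambda>k. if k = 0 then 1 else 0) S = 1"
    using assms by (rule one)
  show "count_sum (\<lambda>k. if k = 1 then 1 else 0) S = (\<Sum>i<card S. t ^ i)"
    using assms
  proof (induction S rule: finite_induct)
    case (insert s S)
    have "count_sum (\<lambda>k. if k = 1 then 1 else 0) (insert s S) =
        count_sum (\<lambda>k. (if k = 0 then 1 else 0) + t * (if k = 1 then 1 else 0)) S"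
      by (subst count_sum_insert[OF insert(1,2)])
         (auto intro!: count_sum_cong[OF insert(1)])
    also have "\<dots> = 1 + t * (\<Sum>i<card S. t ^ i)"
      by (simp only: count_sum_add count_sum_scale one[OF insert(1)] insert.IH)
    finally show ?case
      using insert(1,2) by (simp add: sum.lessThan_Suc_shift sum_distrib_left del: sum.lessThan_Suc)
  qed (simp add: count_sum_eq)
qed

text \<open>Only sets of size m + 1 contribute, and on them the choice of the single letter sums to
  the t-integer 1 + t + ... + t^m.\<close>

lemma single_box_star_layer:
  assumes "t \<noteq> 1"
  shows "single_box \<star> layer m = (\<lambda>S. (1 - t ^ Suc m) / (1 - t) * layer (Suc m) S)"
proof
  fix S
  show "(single_box \<star> layer m) S = (1 - t ^ Suc m) / (1 - t) * layer (Suc m) S"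
  proof (cases "finite S")
    case True
    have "(single_box \<star> layer m) S =
        (\<Sum>T\<in>Pow S. (if card S = Suc m then 1 else 0) * ((if card T = 1 then 1 else 0) * cross T (S - T)))"
      unfolding star_def
    proof (rule sum.cong[OF refl])
      fix T assume T: "T \<in> Pow S"
      then have fin: "finite T" "finite (S - T)"
        using True by (auto intro: finite_subset)
      then have "card (S - T) = card S - card T" "card T \<le> card S"
        using T True by (auto simp: card_Diff_subset card_mono)
      with fin show "cross T (S - T) * (single_box T * layer m (S - T)) =
          (if card S = Suc m then 1 else 0) * ((if card T = 1 then 1 else 0) * cross T (S - T))"
        by (auto simp: single_box_def layer_def)
    qed
    also have "\<dots> = (if card S = Suc m then 1 else 0) * (\<Sum>i<card S. t ^ i)"
      unfolding sum_distrib_left[symmetric] count_sum_single(2)[OF True, unfolded count_sum_eq] ..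
    finally show ?thesis
      using True assms by (simp add: layer_def sum_gp_strict)
  qed (simp add: star_infinite layer_def)
qed

lemma rows_replicate_append:
  assumes "t \<noteq> 1" "finite S"
  shows "rows (replicate m p @ la) S =
    q_fact t m * (twist (\<lambda>i. x i ^ p) (layer m) \<star> rows la) S"
  using assms(2)
proof (induction m arbitrary: S)
  case 0
  have "twist (\<lambda>i. x i ^ p) (layer 0) = layer 0"
    by (auto simp: twist_def layer_def E_def)
  then show ?case using 0 by (simp add: layer_0_star)
next
  case (Suc m)
  have "rows (replicate (Suc m) p @ la) S =
      (row p \<star> (\<lambda>S. q_fact t m * (twist (\<lambda>i. x i ^ p) (layer m) \<star> rows la) S)) S"
    unfolding replicate_Suc append_Cons rows.simps using Suc.IH by (intro star_cong) auto
  also have "\<dots> = q_fact t m * ((row p \<star> twist (\<lambda>i. x i ^ p) (layer m)) \<star> rows la) S"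
    by (simp only: star_scale_right star_assoc)
  also have "row p \<star> twist (\<lambda>i. x i ^ p) (layer m) =
      (\<lambda>S. (1 - t ^ Suc m) / (1 - t) * twist (\<lambda>i. x i ^ p) (layer (Suc m)) S)"
    unfolding row_def twist_star[symmetric] single_box_star_layer[OF assms(1)]
    by (simp add: fun_eq_iff twist_def mult_ac)
  finally show ?case
    unfolding star_scale_left by (simp only: q_fact_Suc mult_ac)
qed

text \<open>m equal rows produce the t-factorial of m, which is exactly the factor of v for the part
  p. After the division the product has no constant, and p contributes only through its
  multiplicity.\<close>

lemma HL_replicate_append:
  assumes "\<And>j. j \<ge> 1 \<Longrightarrow> t ^ j \<noteq> 1" "finite S" "p \<notin> set la"
  shows "HL (replicate m p @ la) S = (twist (\<lambda>i. x i ^ p) (layer m) \<star> HL la) S"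
proof -
  have "t \<noteq> 1" using assms(1)[of 1] by simp
  have "q_fact t m \<noteq> 0"
    using hl_v_nonzero[OF assms(1), of "replicate m p"] hl_v_split(1)[of p "[]" t m] by auto
  moreover have "HL la = (\<lambda>S. 1 / hl_v t la * rows la S)"
    by (auto simp: HL_def)
  then have "(f \<star> HL la) S = 1 / hl_v t la * (f \<star> rows la) S" for f
    by (simp only: star_scale_right)
  ultimately show ?thesis
    unfolding HL_def[of "replicate m p @ la"] rows_replicate_append[OF \<open>t \<noteq> 1\<close> assms(2)]
      hl_v_split(1)[OF assms(3)]
    by simp
qed

lemma sum_HL_eq_levels:
  assumes "\<And>j. j \<ge> 1 \<Longrightarrow> t ^ j \<noteq> 1" "finite S" "card S \<le> N"
  shows "(\<Sum>la\<in>partitions_in N M. coefficient t la * HL la S) = levels M S"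
  using assms(2,3)
proof (induction M arbitrary: S)
  case 0
  then show ?case
    by (simp add: coefficient_def admissible_def HL_def hl_v_def c_factor_def diagram_def odd_parts_def)
next
  case (Suc M)
  let ?c = "\<lambda>m. mult_weight (Suc M) m / t ^ (((Suc M + 1) div 2) * m)"
  let ?X = "\<lambda>m. twist (\<lambda>i. x i ^ Suc M) (layer m)"
  have "(\<Sum>la\<in>partitions_in N (Suc M). coefficient t la * HL la S) =
      (\<Sum>(m, la)\<in>{..N} \<times> partitions_in N M.
        coefficient t (replicate m (Suc M) @ la) * HL (replicate m (Suc M) @ la) S)"
    unfolding partitions_in.simps
    by (subst sum.reindex[OF inj_on_partitions_in]) (simp add: case_prod_beta)
  also have "\<dots> = (\<Sum>(m, la)\<in>{..N} \<times> partitions_in N M.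
        ?c m * (coefficient t la * (?X m \<star> HL la) S))"
  proof (intro sum.cong refl, clarify)
    fix m la assume "la \<in> partitions_in N M"
    then have la: "is_partition la" "\<forall>r\<in>set la. r \<le> M" "Suc M \<notin> set la"
      using partitions_in_props by force+
    have "coefficient t (replicate m (Suc M) @ la) = ?c m * coefficient t la"
      using la unfolding coefficient_def admissible_replicate_append[OF la(2)] weight_exponent
      by (auto simp: c_factor_replicate_append power_add mult_weight_def)
    then show "coefficient t (replicate m (Suc M) @ la) * HL (replicate m (Suc M) @ la) S =
        ?c m * (coefficient t la * (?X m \<star> HL la) S)"
      using HL_replicate_append[OF assms(1) Suc.prems(1) la(3), of m] by simp
  qed
  also have "\<dots> = (\<Sum>m\<le>N. \<Sum>la\<in>partitions_in N M. \<Sum>T\<in>Pow S.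
      cross T (S - T) * (?c m * ?X m T * (coefficient t la * HL la (S - T))))"
    unfolding sum.cartesian_product[symmetric] star_def sum_distrib_left
    by (intro sum.cong refl) (simp only: mult_ac)
  also have "\<dots> = (\<Sum>m\<le>N. \<Sum>T\<in>Pow S. \<Sum>la\<in>partitions_in N M.
      cross T (S - T) * (?c m * ?X m T * (coefficient t la * HL la (S - T))))"
    by (intro sum.cong[OF refl] sum.swap)
  also have "\<dots> = (\<Sum>T\<in>Pow S. \<Sum>m\<le>N. \<Sum>la\<in>partitions_in N M.
      cross T (S - T) * (?c m * ?X m T * (coefficient t la * HL la (S - T))))"
    by (rule sum.swap)
  also have "\<dots> = (\<Sum>T\<in>Pow S. cross T (S - T) * ((\<Sum>m\<le>N. ?c m * ?X m T) *
      (\<Sum>la\<in>partitions_in N M. coefficient t la * HL la (S - T))))"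
    by (simp only: sum_product) (simp only: sum_distrib_left)
  also have "\<dots> = (level (Suc M) \<star> levels M) S"
    unfolding star_def
  proof (rule sum.cong[OF refl])
    fix T assume T: "T \<in> Pow S"
    then have fin: "finite T" "finite (S - T)" "card T \<le> N" "card (S - T) \<le> N"
      using Suc.prems by (auto intro: finite_subset order.trans[OF card_mono])
    \<comment> \<open>The set T of letters used by the largest part determines its multiplicity; N
      is large enough because T lies in S.\<close>
    have "(\<Sum>m\<le>N. ?c m * ?X m T) = (\<Sum>m\<in>{card T}. ?c m * ?X m T)"
      using fin by (intro sum.mono_neutral_right) (auto simp: twist_def layer_def)
    also have "\<dots> = level (Suc M) T"
    proof -
      have "(\<Prod>i\<in>T. x i ^ Suc M / t ^ a) = (\<Prod>i\<in>T. x i ^ Suc M) / t ^ (a * card T)" for a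
        by (simp only: prod_dividef prod_constant power_mult)
      then show ?thesis
        using fin by (simp only: level_def twist_def layer_def E_def) simp
    qed
    finally show "cross T (S - T) * ((\<Sum>m\<le>N. ?c m * ?X m T) *
        (\<Sum>la\<in>partitions_in N M. coefficient t la * HL la (S - T))) =
      cross T (S - T) * (level (Suc M) T * levels M (S - T))"
      using Suc.IH[OF fin(2,4)] by simp
  qed
  finally show ?case by simp
qed

end

section \<open>From the symmetrisation formula to star products, by way of words\<close>

lemma bij_betw_permutes_lists:
  "bij_betw (\<lambda>w. map w [0..<n]) {w. w permutes {..<n}} (permutations_of_set {..<n})"
proof -
  have inj: "inj_on (\<lambda>w. map w [0..<n]) {w. w permutes {..<n}}"
  proof (rule inj_onI, clarify)
    fix v w assume vw: "v permutes {..<n}" "w permutes {..<n}" "map v [0..<n] = map w [0..<n]"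
    show "v = w"
    proof
      fix i show "v i = w i"
        using vw by (cases "i < n") (auto simp: permutes_def)
    qed
  qed
  have "(\<lambda>w. map w [0..<n]) ` {w. w permutes {..<n}} \<subseteq> permutations_of_set {..<n}"
  proof (intro subsetI, elim imageE CollectE)
    fix ws w assume w: "ws = map w [0..<n]" "w permutes {..<n}"
    then show "ws \<in> permutations_of_set {..<n}"
      using permutes_image[OF w(2)] permutes_inj_on[OF w(2)]
      by (auto simp: permutations_of_set_def distinct_map lessThan_atLeast0)
  qed
  moreover have "card ((\<lambda>w. map w [0..<n]) ` {w. w permutes {..<n}}) = card (permutations_of_set {..<n})"
    by (simp add: card_image[OF inj] card_permutations[OF card_lessThan] card_permutations_of_set)
  ultimately show ?thesis
    using inj unfolding bij_betw_def by (metis card_subset_eq finite_lessThan finite_permutations_of_set)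
qed

context alphabet
begin

abbreviation factor :: "nat \<Rightarrow> nat \<Rightarrow> 'a" where
  "factor i j \<equiv> (x i - t * x j) / (x i - x j)"

text \<open>The summand of the symmetrisation formula for the word w(0) w(1) ..., with its first
  letter peeled off, as in a star product whose left factor is a row.\<close>

primrec word_weight :: "nat list \<Rightarrow> nat list \<Rightarrow> 'a" where
  "word_weight mu [] = 1"
| "word_weight mu (a # ws) =
    x a ^ hd mu * (\<Prod>b\<in>set ws. factor a b) * word_weight (tl mu) ws"

lemma pairs_less_Suc:
  "(\<Prod>(i, j)\<in>{(i, j). i < j \<and> j < Suc n}. f i j) =
    (\<Prod>j<n. f 0 (Suc j)) * (\<Prod>(i, j)\<in>{(i, j). i < j \<and> j < n}. f (Suc i) (Suc j) :: 'a)"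
proof -
  let ?P = "\<lambda>n. {(i, j). i < j \<and> j < (n::nat)}"
  have fin: "finite (?P n)" for n
    by (rule finite_subset[of _ "{..<n} \<times> {..<n}"]) auto
  have "?P (Suc n) = (\<lambda>j. (0, Suc j)) ` {..<n} \<union> map_prod Suc Suc ` ?P n"
  proof (intro equalityI subsetI)
    fix z assume "z \<in> ?P (Suc n)"
    then obtain i j where z: "z = (i, Suc j)" "i < Suc j" "j < n"
      by (cases z) (auto elim: less_natE)
    then show "z \<in> (\<lambda>j. (0, Suc j)) ` {..<n} \<union> map_prod Suc Suc ` ?P n"
      by (cases i) (auto simp: image_iff)
  qed auto
  moreover have "(\<lambda>j. (0, Suc j)) ` {..<n} \<inter> map_prod Suc Suc ` ?P n = {}"
    by auto
  moreover have "inj_on (map_prod Suc Suc) (?P n)" "inj_on (\<lambda>j. (0::nat, Suc j)) {..<n}"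
    by (auto simp: inj_on_def)
  ultimately show ?thesis
    using fin[of n] by (simp add: prod.union_disjoint prod.reindex case_prod_beta)
qed

lemma word_weight_eq:
  assumes "distinct ws" "length ws = n" "length mu = n"
  shows "word_weight mu ws = (\<Prod>i<n. x (ws ! i) ^ (mu ! i)) *
    (\<Prod>(i, j)\<in>{(i, j). i < j \<and> j < n}. factor (ws ! i) (ws ! j))"
  using assms
proof (induction ws arbitrary: mu n)
  case (Cons a ws)
  then obtain p mu' where mu: "mu = p # mu'" by (cases mu) auto
  have n: "n = Suc (length ws)" using Cons.prems by simp
  have "(\<Prod>b\<in>set ws. factor a b) = (\<Prod>j<length ws. factor a (ws ! j))"
    using Cons.prems(1) by (intro prod.reindex_bij_betw[symmetric] bij_betw_nth) auto
  moreover have "word_weight mu' ws = (\<Prod>i<length ws. x (ws ! i) ^ (mu' ! i)) *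
      (\<Prod>(i, j)\<in>{(i, j). i < j \<and> j < length ws}. factor (ws ! i) (ws ! j))"
    using Cons.prems by (intro Cons.IH) (auto simp: mu)
  ultimately show ?case
    unfolding n pairs_less_Suc prod.lessThan_Suc_shift by (simp add: mu mult_ac)
qed simp

text \<open>In contrast to \<open>rows\<close> this ends with the unit: all letters have to be used
  up, the parts 0 being listed explicitly.\<close>

primrec word_sum :: "nat list \<Rightarrow> nat set \<Rightarrow> 'a" where
  "word_sum [] = layer 0"
| "word_sum (p # mu) = row p \<star> word_sum mu"

lemma row_star:
  assumes "finite S"
  shows "(row p \<star> f) S = (\<Sum>a\<in>S. x a ^ p * (\<Prod>b\<in>S - {a}. factor a b) * f (S - {a}))"
proof -
  have "(row p \<star> f) S = (\<Sum>T\<in>(\<lambda>a. {a}) ` S. cross T (S - T) * (row p T * f (S - T)))"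
    unfolding star_def
  proof (rule sum.mono_neutral_right)
    show "\<forall>T\<in>Pow S - (\<lambda>a. {a}) ` S. cross T (S - T) * (row p T * f (S - T)) = 0"
      by (auto simp: row_def twist_def single_box_def card_1_singleton_iff)
  qed (use assms in auto)
  also have "\<dots> = (\<Sum>a\<in>S. x a ^ p * (\<Prod>b\<in>S - {a}. factor a b) * f (S - {a}))"
    by (subst sum.reindex)
       (auto simp: inj_on_def row_def twist_def single_box_def E_def cross_def intro!: sum.cong)
  finally show ?thesis .
qed

lemma word_sum_eq:
  assumes "finite S" "card S = length mu"
  shows "word_sum mu S = (\<Sum>ws\<in>permutations_of_set S. word_weight mu ws)"
  using assms
proof (induction mu arbitrary: S)
  case Nil
  then show ?case by (simp add: layer_def)
next
  case (Cons p mu)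
  have "S \<noteq> {}" using Cons.prems(2) by auto
  have "(\<Sum>ws\<in>permutations_of_set S. word_weight (p # mu) ws) =
      (\<Sum>a\<in>S. \<Sum>ws\<in>permutations_of_set (S - {a}). word_weight (p # mu) (a # ws))"
    unfolding permutations_of_set_nonempty[OF \<open>S \<noteq> {}\<close>] using Cons.prems(1)
    by (subst sum.UNION_disjoint) (auto simp: sum.reindex inj_on_def)
  also have "\<dots> = (\<Sum>a\<in>S. x a ^ p * (\<Prod>b\<in>S - {a}. factor a b) * word_sum mu (S - {a}))"
    using Cons
    by (intro sum.cong refl)
       (auto simp: sum_distrib_left permutations_of_set_def intro!: sum.cong)
  also have "\<dots> = word_sum (p # mu) S"
    using row_star[OF Cons.prems(1)] by simp
  finally show ?case ..
qed

text \<open>The k parts 0 must take exactly the letters left over, and the symmetrisation over these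
  gives the t-factorial of k, whatever the letters are.\<close>

lemma word_sum_padded:
  assumes "t \<noteq> 1" "finite S"
  shows "word_sum (la @ replicate k 0) S =
    (if card S = length la + k then q_fact t k * rows la S else 0)"
  using assms(2)
proof (induction la arbitrary: S)
  case Nil
  have "word_sum (replicate k 0) S = q_fact t k * layer k S" if "finite S" for S
    using that
  proof (induction k arbitrary: S)
    case (Suc k)
    have "word_sum (replicate (Suc k) 0) S = (single_box \<star> (\<lambda>S. q_fact t k * layer k S)) S"
      unfolding replicate_Suc word_sum.simps using Suc.IH
      by (intro star_cong) (auto simp: row_def twist_def E_def)
    then show ?case
      unfolding star_scale_right single_box_star_layer[OF assms(1)] by (simp add: q_fact_Suc)
  qed simp
  then show ?case
    using Nil by (simp add: layer_def E_def)
next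
  case (Cons p la)
  show ?case
  proof (cases "card S = Suc (length la + k)")
    case True
    then have "word_sum (la @ replicate k 0) (S - {a}) = q_fact t k * rows la (S - {a})" if "a \<in> S" for a
      using that Cons by (subst Cons.IH) auto
    then show ?thesis
      using Cons.prems True by (simp add: row_star sum_distrib_left mult_ac)
  next
    case False
    then have "word_sum (la @ replicate k 0) (S - {a}) = 0" if "a \<in> S" for a
    proof -
      have "card S = Suc (card (S - {a}))"
        using that Cons.prems by (metis card_Suc_Diff1)
      then show ?thesis
        using that Cons.prems False by (subst Cons.IH) auto
    qed
    then show ?thesis
      using Cons.prems False by (simp add: row_star)
  qed
qed

definition hl_value :: "nat list \<Rightarrow> 'a" where
  "hl_value mu = 1 / hl_v t mu *
    (\<Sum>w | w permutes {..<length mu}. (\<Prod>i<length mu. x (w i) ^ (mu ! i)) *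
      (\<Prod>(i, j)\<in>{(i, j). i < j \<and> j < length mu}. factor (w i) (w j)))"

lemma hl_value_eq_HL:
  assumes "\<And>j. j \<ge> 1 \<Longrightarrow> t ^ j \<noteq> 1" "0 \<notin> set la"
  shows "hl_value (la @ replicate k 0) = HL la {..<length la + k}"
proof -
  let ?mu = "la @ replicate k 0" and ?n = "length la + k"
  have "t \<noteq> 1" using assms(1)[of 1] by simp
  have "(\<Sum>w | w permutes {..<?n}. (\<Prod>i<?n. x (w i) ^ (?mu ! i)) *
      (\<Prod>(i, j)\<in>{(i, j). i < j \<and> j < ?n}. factor (w i) (w j))) =
    (\<Sum>w | w permutes {..<?n}. word_weight ?mu (map w [0..<?n]))"
  proof (intro sum.cong refl)
    fix w assume "w \<in> {w. w permutes {..<?n}}"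
    then have "distinct (map w [0..<?n])"
      by (auto simp: distinct_map intro: permutes_inj_on)
    then have "word_weight ?mu (map w [0..<?n]) = (\<Prod>i<?n. x (map w [0..<?n] ! i) ^ (?mu ! i)) *
        (\<Prod>(i, j)\<in>{(i, j). i < j \<and> j < ?n}. factor (map w [0..<?n] ! i) (map w [0..<?n] ! j))"
      by (intro word_weight_eq) auto
    also have "(\<Prod>i<?n. x (map w [0..<?n] ! i) ^ (?mu ! i)) = (\<Prod>i<?n. x (w i) ^ (?mu ! i))"
      by (intro prod.cong) auto
    also have "(\<Prod>(i, j)\<in>{(i, j). i < j \<and> j < ?n}. factor (map w [0..<?n] ! i) (map w [0..<?n] ! j)) =
        (\<Prod>(i, j)\<in>{(i, j). i < j \<and> j < ?n}. factor (w i) (w j))"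
      by (intro prod.cong) auto
    finally show "(\<Prod>i<?n. x (w i) ^ (?mu ! i)) *
      (\<Prod>(i, j)\<in>{(i, j). i < j \<and> j < ?n}. factor (w i) (w j)) = word_weight ?mu (map w [0..<?n])" ..
  qed
  also have "\<dots> = (\<Sum>ws\<in>permutations_of_set {..<?n}. word_weight ?mu ws)"
    by (rule sum.reindex_bij_betw[OF bij_betw_permutes_lists])
  also have "\<dots> = q_fact t k * rows la {..<?n}"
    by (subst word_sum_eq[symmetric]) (simp_all add: word_sum_padded[OF \<open>t \<noteq> 1\<close>])
  finally have "hl_value ?mu = q_fact t k * rows la {..<?n} / (q_fact t k * hl_v t la)"
    by (simp add: hl_value_def hl_v_split(2)[OF assms(2)])
  moreover have "q_fact t k \<noteq> 0"
    using hl_v_nonzero[OF assms(1), of "replicate k 0"] hl_v_split(1)[of 0 "[]" t k] by auto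
  ultimately show ?thesis
    by (simp add: HL_def)
qed

text \<open>The letter 0 cannot be chosen for a positive part, and next to any other letter a its
  factor is x_a / x_a = 1. This is why an alphabet may contain 0.\<close>

lemma rows_zero_variable:
  assumes "x s = 0" "s \<notin> S" "finite S" "0 \<notin> set la"
  shows "rows la (insert s S) = rows la S"
  using assms(2-)
proof (induction la arbitrary: S)
  case Nil
  then show ?case by (simp add: E_def)
next
  case (Cons p la)
  have "x a ^ p * (\<Prod>b\<in>insert s S - {a}. factor a b) * rows la (insert s S - {a}) =
      x a ^ p * (\<Prod>b\<in>S - {a}. factor a b) * rows la (S - {a})" if a: "a \<in> S" for a
  proof -
    have "a \<noteq> s" "x a \<noteq> 0"
      using a Cons.prems(1) assms(1) x_eq_iff[of a s] by auto
    moreover from this have "insert s S - {a} = insert s (S - {a})" by auto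
    ultimately show ?thesis
      using Cons.IH[of "S - {a}"] Cons.prems assms(1) by simp
  qed
  then have "(\<Sum>a\<in>S. x a ^ p * (\<Prod>b\<in>insert s S - {a}. factor a b) * rows la (insert s S - {a})) =
      (\<Sum>a\<in>S. x a ^ p * (\<Prod>b\<in>S - {a}. factor a b) * rows la (S - {a}))"
    by (intro sum.cong) auto
  moreover have "p \<noteq> 0"
    using Cons.prems by auto
  ultimately show ?case
    using Cons.prems(1,2) by (simp add: row_star assms(1) power_0_left)
qed

end

section \<open>Hall-Littlewood polynomials\<close>

abbreviation (input) "keys \<equiv> Poly_Mapping.keys"
abbreviation (input) "lookup \<equiv> Poly_Mapping.lookup"
abbreviation (input) "single \<equiv> Poly_Mapping.single"

section \<open>Evaluation of polynomials in infinitely many variables\<close>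

lemma poly_mapping_eq_sum:
  fixes p :: "'k \<Rightarrow>\<^sub>0 'a::comm_monoid_add"
  shows "p = (\<Sum>m\<in>keys p. single m (lookup p m))"
proof (rule poly_mapping_eqI)
  fix k
  show "lookup p k =
      lookup (\<Sum>m\<in>keys p. single m (lookup p m)) k"
    by (cases "k \<in> keys p")
       (auto simp: lookup_sum lookup_single when_def sum.delta' in_keys_iff)
qed

lemma mult_poly_mapping_eq_sum:
  fixes p q :: "'k::monoid_add \<Rightarrow>\<^sub>0 'a::comm_semiring_1"
  shows "p * q = (\<Sum>a\<in>keys p. \<Sum>b\<in>keys q.
    single (a + b) (lookup p a * lookup q b))"
  by (subst (1) poly_mapping_eq_sum[of p], subst (1) poly_mapping_eq_sum[of q])
     (simp add: sum_product mult_single)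

type_synonym 'a mpoly = "(nat \<Rightarrow>\<^sub>0 nat) \<Rightarrow>\<^sub>0 'a"

definition monom_value :: "(nat \<Rightarrow> 'b::comm_monoid_mult) \<Rightarrow> (nat \<Rightarrow>\<^sub>0 nat) \<Rightarrow> 'b" where
  "monom_value x m = (\<Prod>i\<in>keys m. x i ^ lookup m i)"

lemma monom_value_superset:
  "finite A \<Longrightarrow> keys m \<subseteq> A \<Longrightarrow> monom_value x m = (\<Prod>i\<in>A. x i ^ lookup m i)"
  unfolding monom_value_def by (rule prod.mono_neutral_left) (auto simp: in_keys_iff)

lemma monom_value_0 [simp]: "monom_value x 0 = 1"
  by (simp add: monom_value_def)

lemma monom_value_single [simp]: "monom_value x (single i k) = x i ^ k"
  by (simp add: monom_value_def)

lemma monom_value_add: "monom_value x (a + b) = monom_value x a * monom_value x b"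
proof -
  let ?A = "keys a \<union> keys b"
  have "keys (a + b) \<subseteq> ?A" by (rule keys_add)
  then show ?thesis
    by (simp add: monom_value_superset[of ?A] lookup_add power_add prod.distrib)
qed

text \<open>One notion of evaluation for three targets: polynomials (substitution of variables),
  their field of fractions, and Laurent series over that field.\<close>

locale coeff_hom =
  fixes h :: "'c::comm_ring_1 \<Rightarrow> 'b::comm_ring_1"
  assumes h_add: "h (a + b) = h a + h b"
    and h_mult: "h (a * b) = h a * h b"
    and h_1 [simp]: "h 1 = 1"
begin

lemma h_0 [simp]: "h 0 = 0"
  using h_add[of 0 0] by simp

lemma h_uminus: "h (- a) = - h a"
  using h_add[of a "- a"] by (simp add: add_eq_0_iff)

lemma h_diff: "h (a - b) = h a - h b"
  using h_add[of a "- b"] by (simp add: h_uminus)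

lemma h_power: "h (a ^ n) = h a ^ n"
  by (induction n) (simp_all add: h_mult)

lemma h_prod: "h (prod f A) = (\<Prod>i\<in>A. h (f i))"
  by (induction A rule: infinite_finite_induct) (simp_all add: h_mult)

definition meval :: "(nat \<Rightarrow> 'b) \<Rightarrow> 'c mpoly \<Rightarrow> 'b" where
  "meval x p = (\<Sum>m\<in>keys p. h (lookup p m) * monom_value x m)"

lemma meval_superset:
  "finite A \<Longrightarrow> keys p \<subseteq> A \<Longrightarrow>
    meval x p = (\<Sum>m\<in>A. h (lookup p m) * monom_value x m)"
  unfolding meval_def by (rule sum.mono_neutral_left) (auto simp: in_keys_iff)

lemma meval_add: "meval x (p + q) = meval x p + meval x q"
proof -
  let ?A = "keys p \<union> keys q"
  have "keys (p + q) \<subseteq> ?A" by (rule keys_add)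
  then show ?thesis
    by (simp add: meval_superset[of ?A] lookup_add h_add distrib_right sum.distrib)
qed

lemma meval_0 [simp]: "meval x 0 = 0"
  by (simp add: meval_def)

lemma meval_single: "meval x (single m c) = h c * monom_value x m"
  by (simp add: meval_def)

lemma meval_1 [simp]: "meval x 1 = 1"
  using meval_single[of x 0 1] by simp

lemma meval_sum: "meval x (sum f A) = (\<Sum>i\<in>A. meval x (f i))"
  by (induction A rule: infinite_finite_induct) (simp_all add: meval_add)

lemma meval_mult: "meval x (p * q) = meval x p * meval x q"
proof -
  have "meval x (p * q) = (\<Sum>a\<in>keys p. \<Sum>b\<in>keys q.
      h (lookup p a * lookup q b) * monom_value x (a + b))"
    by (simp only: mult_poly_mapping_eq_sum[of p q] meval_sum meval_single)
  also have "\<dots> = meval x p * meval x q"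
    by (simp add: meval_def sum_product h_mult monom_value_add mult_ac)
  finally show ?thesis .
qed

lemma meval_prod: "meval x (prod f A) = (\<Prod>i\<in>A. meval x (f i))"
  by (induction A rule: infinite_finite_induct) (simp_all add: meval_mult)

lemma meval_power: "meval x (p ^ n) = meval x p ^ n"
  by (induction n) (simp_all add: meval_mult)

lemma meval_uminus: "meval x (- p) = - meval x p"
  using meval_add[of x p "- p"] by (simp add: add_eq_0_iff)

lemma meval_diff: "meval x (p - q) = meval x p - meval x q"
  using meval_add[of x p "- q"] by (simp add: meval_uminus)

lemma meval_const [simp]: "meval x (poly_const c) = h c"
  by (simp add: poly_const_def meval_single)

lemma meval_var [simp]: "meval x (poly_var i) = x i"
  by (simp add: poly_var_def meval_single)

lemma dvd_meval_diff:
  assumes "\<And>i. q dvd x i - y i"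
  shows "q dvd meval x p - meval y p"
proof -
  have "q dvd x i ^ n - y i ^ n" for i n
    using dvd_prod_diff[of "{..<n}" q "\<lambda>_. x i" "\<lambda>_. y i"] assms by simp
  then have "q dvd monom_value x m - monom_value y m" for m
    unfolding monom_value_def by (intro dvd_prod_diff)
  then show ?thesis
    unfolding meval_def sum_subtractf[symmetric] right_diff_distrib[symmetric]
    by (intro dvd_sum dvd_mult)
qed

end

lemma poly_const_0 [simp]: "poly_const 0 = 0"
  and poly_const_1 [simp]: "poly_const 1 = 1"
  by (simp_all add: poly_const_def)

lemma poly_const_add: "poly_const (a + b) = poly_const a + poly_const (b::'a::comm_ring_1)"
  and poly_const_mult: "poly_const (a * b) = poly_const a * poly_const (b::'a::comm_ring_1)"
  by (simp_all add: poly_const_def single_add mult_single)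

interpretation poly_const: coeff_hom "poly_const :: 'a::comm_ring_1 \<Rightarrow> _"
  by unfold_locales (simp_all add: poly_const_add poly_const_mult)

abbreviation subst_vars ::
  "(nat \<Rightarrow> 'a mpoly) \<Rightarrow> 'a::comm_ring_1 mpoly \<Rightarrow> 'a mpoly" where
  "subst_vars \<equiv> poly_const.meval"

lemma poly_var_power: "(poly_var i :: 'a::comm_ring_1 mpoly) ^ n = single (single i n) 1"
  by (induction n) (simp_all add: poly_var_def mult_single single_add[symmetric])

lemma monom_value_poly_var:
  "monom_value poly_var m = (single m 1 :: 'a::comm_ring_1 mpoly)"
proof -
  have "(\<Prod>i\<in>A. single (f i) (1::'a)) = single (\<Sum>i\<in>A. f i) 1"
    if "finite A" for A and f :: "nat \<Rightarrow> nat \<Rightarrow>\<^sub>0 nat"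
    using that by (induction A rule: finite_induct) (simp_all add: mult_single)
  then have "monom_value poly_var m =
      single (\<Sum>i\<in>keys m. single i (lookup m i)) (1::'a)"
    by (simp add: monom_value_def poly_var_power)
  then show ?thesis
    by (simp flip: poly_mapping_eq_sum)
qed

lemma subst_vars_id: "subst_vars poly_var p = p"
proof -
  have "subst_vars poly_var p =
      (\<Sum>m\<in>keys p. single m (lookup p m))"
    by (simp add: poly_const.meval_def monom_value_poly_var poly_const_def mult_single)
  then show ?thesis
    by (simp flip: poly_mapping_eq_sum)
qed

lemma poly_var_eq_iff [simp]: "poly_var i = (poly_var j :: 'a::comm_ring_1 mpoly) \<longleftrightarrow> i = j"
proof
  assume "poly_var i = (poly_var j :: 'a mpoly)"
  then have "keys (poly_var i :: 'a mpoly) = keys (poly_var j :: 'a mpoly)"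
    by simp
  then have "single i (1::nat) = single j 1"
    by (simp add: poly_var_def)
  then have "keys (single i (1::nat)) = keys (single j (1::nat))"
    by simp
  then show "i = j" by simp
qed simp

section \<open>Divisibility of the symmetrised numerator by the Vandermonde product\<close>

definition identify :: "nat \<Rightarrow> nat \<Rightarrow> 'a::comm_ring_1 mpoly \<Rightarrow> 'a mpoly" where
  "identify a b = subst_vars (poly_var(a := poly_var b))"

text \<open>The factor theorem in several variables: replacing X_a by X_b changes p by a multiple of
  X_a - X_b only.\<close>

lemma dvd_if_identify_eq_0:
  assumes "identify a b p = 0"
  shows "poly_var a - poly_var b dvd p"
proof -
  have "poly_var a - poly_var b dvd subst_vars poly_var p - subst_vars (poly_var(a := poly_var b)) p"
    by (rule poly_const.dvd_meval_diff) auto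
  then show ?thesis
    using assms by (simp add: subst_vars_id identify_def)
qed

lemma identify_diff_nonzero:
  assumes "c < d" "a < b" "(c, d) \<noteq> (a, b)"
  shows "identify a b (poly_var c - poly_var d :: 'a::comm_ring_1 mpoly) \<noteq> 0"
proof -
  have "(poly_var(a := poly_var b)) c \<noteq> (poly_var(a := poly_var b) :: _ \<Rightarrow> 'a mpoly) d"
    using assms by auto
  then show ?thesis
    by (simp add: identify_def poly_const.meval_diff)
qed

text \<open>Unique factorisation is avoided: the substitution X_a := X_b keeps every other linear
  factor nonzero, so these can be cancelled in the integral domain before the factor theorem is
  applied to the cofactor.\<close>

lemma vandermonde_dvd:
  fixes p :: "'a::idom mpoly"
  assumes "finite Q" "\<And>a b. (a, b) \<in> Q \<Longrightarrow> a < b \<and> identify a b p = 0"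
  shows "(\<Prod>(a, b)\<in>Q. poly_var a - poly_var b) dvd p"
  using assms
proof (induction Q rule: finite_induct)
  case (insert z Q)
  obtain a b where z: "z = (a, b)" by (cases z)
  have "(\<Prod>(a, b)\<in>Q. poly_var a - poly_var b) dvd p"
    using insert by blast
  then obtain q where q: "p = (\<Prod>(a, b)\<in>Q. poly_var a - poly_var b) * q"
    unfolding dvd_def by blast
  have "identify a b (poly_var c - poly_var d :: 'a mpoly) \<noteq> 0" if "(c, d) \<in> Q" for c d
    using insert that z by (intro identify_diff_nonzero) auto
  then have "identify a b (\<Prod>(c, d)\<in>Q. poly_var c - poly_var d :: 'a mpoly) \<noteq> 0"
    using insert(1) by (auto simp: identify_def poly_const.meval_prod case_prod_beta)
  moreover have "identify a b p = 0"
    using insert.prems z by auto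
  ultimately have "identify a b q = 0"
    unfolding q identify_def poly_const.meval_mult by simp
  then obtain r where "q = (poly_var a - poly_var b) * r"
    using dvd_if_identify_eq_0[of a b q] unfolding dvd_def by blast
  then have "p = (\<Prod>(a, b)\<in>insert z Q. poly_var a - poly_var b) * r"
    using insert(1,2) q z by (simp add: mult_ac)
  then show ?case by simp
qed simp

definition index_pairs :: "nat \<Rightarrow> (nat \<times> nat) set" where
  "index_pairs n = {(i, j). i < j \<and> j < n}"

lemma finite_index_pairs [simp]: "finite (index_pairs n)"
  by (rule finite_subset[of _ "{..<n} \<times> {..<n}"]) (auto simp: index_pairs_def)

definition vandermonde :: "nat \<Rightarrow> (nat \<Rightarrow> nat) \<Rightarrow> 'a::comm_ring_1 mpoly" where
  "vandermonde n w = (\<Prod>(i, j)\<in>index_pairs n. poly_var (w i) - poly_var (w j))"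

text \<open>For a permutation this is its sign, as a product over inversions. In this form it
  compares factor by factor with the Vandermonde product and makes sense in every ring that
  occurs.\<close>

definition sgn_of :: "nat \<Rightarrow> (nat \<Rightarrow> nat) \<Rightarrow> 'b::comm_ring_1" where
  "sgn_of n w = (\<Prod>(i, j)\<in>index_pairs n. if w i < w j then 1 else - 1)"

lemma sgn_of_square: "sgn_of n w * sgn_of n w = 1"
  unfolding sgn_of_def prod.distrib[symmetric] by (rule prod.neutral) auto

lemma vandermonde_permute:
  assumes "w permutes {..<n}"
  shows "vandermonde n w = sgn_of n w * (vandermonde n id :: 'a::comm_ring_1 mpoly)"
proof -
  \<comment> \<open>Sorting each image pair permutes the index pairs; every pair that has to be
    swapped costs a sign.\<close>
  let ?\<phi> = "\<lambda>(i, j). (min (w i) (w j), max (w i) (w j))"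
  have inj_w: "w i = w j \<longleftrightarrow> i = j" for i j
    using permutes_inj[OF assms] by (auto dest: injD)
  have "?\<phi> ` index_pairs n \<subseteq> index_pairs n"
  proof clarify
    fix i j assume "(i, j) \<in> index_pairs n"
    then have "i < n" "j < n" "i \<noteq> j" by (auto simp: index_pairs_def)
    then have "w i < n" "w j < n" "w i \<noteq> w j"
      using permutes_in_image[OF assms] inj_w by auto
    then show "(min (w i) (w j), max (w i) (w j)) \<in> index_pairs n"
      by (auto simp: index_pairs_def min_def max_def)
  qed
  moreover have "inj_on ?\<phi> (index_pairs n)"
  proof (rule inj_onI, clarify)
    fix i j k l assume ij: "(i, j) \<in> index_pairs n" "(k, l) \<in> index_pairs n"
      and eq: "min (w i) (w j) = min (w k) (w l)" "max (w i) (w j) = max (w k) (w l)"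
    then have "(w i = w k \<and> w j = w l) \<or> (w i = w l \<and> w j = w k)"
      by (auto simp: min_def max_def split: if_splits)
    then show "i = k \<and> j = l"
      using ij by (auto simp: inj_w index_pairs_def)
  qed
  ultimately have bij: "bij_betw ?\<phi> (index_pairs n) (index_pairs n)"
    by (simp add: bij_betw_def endo_inj_surj)
  have "vandermonde n w = sgn_of n w *
      (\<Prod>z\<in>index_pairs n. (\<lambda>(i, j). poly_var i - poly_var j :: 'a mpoly) (?\<phi> z))"
    unfolding vandermonde_def sgn_of_def prod.distrib[symmetric]
    by (intro prod.cong) (auto simp: min_def max_def)
  also have "(\<Prod>z\<in>index_pairs n. (\<lambda>(i, j). poly_var i - poly_var j :: 'a mpoly) (?\<phi> z)) = vandermonde n id"
    unfolding vandermonde_def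
    using prod.reindex_bij_betw[OF bij, of "\<lambda>(i, j). poly_var i - poly_var j"] by simp
  finally show ?thesis .
qed

lemma vandermonde_nonzero: "(vandermonde n id :: 'a::idom mpoly) \<noteq> 0"
  unfolding vandermonde_def by (subst prod_zero_iff[OF finite_index_pairs]) (auto simp: index_pairs_def)

lemma subst_vars_sgn_of: "subst_vars f (sgn_of n w) = sgn_of n w"
  by (auto simp: sgn_of_def poly_const.meval_prod poly_const.meval_uminus intro!: prod.cong)

lemma subst_vars_vandermonde:
  "subst_vars (poly_var \<circ> v) (vandermonde n w) = vandermonde n (v \<circ> w)"
  by (simp add: vandermonde_def poly_const.meval_prod case_prod_beta poly_const.meval_diff)

text \<open>After cancelling X_a - X_b from the two Vandermonde products, the remaining factors
  become equal and nonzero for X_a = X_b, so the sign that relates them is forced to be -1.\<close>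

lemma sgn_of_transpose:
  assumes "a < b" "b < n"
  shows "sgn_of n (transpose a b) = (- 1 :: 'a::idom mpoly)"
proof -
  let ?\<tau> = "transpose a b" and ?Q = "index_pairs n - {(a, b)}"
  define N where "N w = (\<Prod>(i, j)\<in>?Q. poly_var (w i) - poly_var (w j) :: 'a mpoly)" for w
  have ab: "(a, b) \<in> index_pairs n" using assms by (simp add: index_pairs_def)
  have split: "vandermonde n w = (poly_var (w a) - poly_var (w b)) * N w" for w
    unfolding vandermonde_def N_def
    using prod.remove[OF finite_index_pairs ab, of "\<lambda>(i, j). poly_var (w i) - poly_var (w j)"] by simp
  have "?\<tau> permutes {..<n}"
    using assms by (intro permutes_swap_id) auto
  then have "vandermonde n ?\<tau> = sgn_of n ?\<tau> * (vandermonde n id :: 'a mpoly)"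
    by (rule vandermonde_permute)
  then have "(poly_var b - poly_var a) * N ?\<tau> = sgn_of n ?\<tau> * ((poly_var a - poly_var b) * N id)"
    by (simp add: split)
  then have "(poly_var a - poly_var b) * (- N ?\<tau>) = (poly_var a - poly_var b) * (sgn_of n ?\<tau> * N id)"
    by (simp add: algebra_simps)
  then have "- N ?\<tau> = sgn_of n ?\<tau> * N id"
    using assms by (subst (asm) mult_left_cancel) auto
  then have "identify a b (- N ?\<tau>) = identify a b (sgn_of n ?\<tau> * N id)"
    by simp
  moreover have "identify a b (N ?\<tau>) = identify a b (N id)"
  proof -
    have "(poly_var(a := poly_var b)) (?\<tau> i) = (poly_var(a := poly_var b) :: _ \<Rightarrow> 'a mpoly) i" for i
      by (auto simp: transpose_def)
    then show ?thesis
      by (simp add: N_def identify_def poly_const.meval_prod poly_const.meval_diff case_prod_beta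
            del: fun_upd_apply)
  qed
  ultimately have "- identify a b (N id) = sgn_of n ?\<tau> * identify a b (N id)"
    by (simp add: identify_def poly_const.meval_mult poly_const.meval_uminus subst_vars_sgn_of)
  moreover have "identify a b (N id) \<noteq> 0"
    using identify_diff_nonzero[OF _ assms(1), where 'a = 'a]
    unfolding N_def identify_def poly_const.meval_prod
    by (subst prod_zero_iff) (simp, auto simp: index_pairs_def)
  ultimately show ?thesis
    by (metis mult_minus1 mult_right_cancel)
qed

text \<open>Permuting the variables of the Vandermonde product in two stages shows that the sign is
  multiplicative here.\<close>

lemma sgn_of_transpose_comp:
  assumes "a < b" "b < n" "w permutes {..<n}"
  shows "sgn_of n (transpose a b \<circ> w) = (- sgn_of n w :: 'a::idom mpoly)"
proof -
  let ?\<tau> = "transpose a b"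
  have \<tau>: "?\<tau> permutes {..<n}"
    using assms by (intro permutes_swap_id) auto
  have "sgn_of n (?\<tau> \<circ> w) * vandermonde n id = (vandermonde n (?\<tau> \<circ> w) :: 'a mpoly)"
    by (simp only: vandermonde_permute[OF permutes_compose[OF assms(3) \<tau>]])
  also have "\<dots> = subst_vars (poly_var \<circ> ?\<tau>) (vandermonde n w)"
    by (simp add: subst_vars_vandermonde)
  also have "\<dots> = sgn_of n w * vandermonde n ?\<tau>"
    unfolding vandermonde_permute[OF assms(3)] poly_const.meval_mult subst_vars_sgn_of
      subst_vars_vandermonde by simp
  also have "\<dots> = - sgn_of n w * vandermonde n id"
    by (simp add: vandermonde_permute[OF \<tau>] sgn_of_transpose[OF assms(1,2)])
  finally show ?thesis
    using vandermonde_nonzero[of n] by (metis mult_right_cancel)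
qed

definition hl_term :: "'a::comm_ring_1 \<Rightarrow> nat list \<Rightarrow> (nat \<Rightarrow> nat) \<Rightarrow> 'a mpoly" where
  "hl_term t mu w = (\<Prod>i<length mu. poly_var (w i) ^ (mu ! i)) *
    (\<Prod>(i, j)\<in>index_pairs (length mu). poly_var (w i) - poly_const t * poly_var (w j))"

definition hl_numerator :: "'a::comm_ring_1 \<Rightarrow> nat list \<Rightarrow> 'a mpoly" where
  "hl_numerator t mu = (\<Sum>w | w permutes {..<length mu}. sgn_of (length mu) w * hl_term t mu w)"

text \<open>For X_a = X_b, composing w with the transposition of a and b preserves
  \<open>hl_term\<close> but reverses the sign. The sum is therefore its own negative, and 2
  \<noteq> 0 makes it vanish.\<close>

lemma vandermonde_dvd_hl_numerator:
  assumes "(2::'a::idom) \<noteq> 0"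
  shows "vandermonde (length mu) id dvd hl_numerator (t::'a) mu"
  unfolding vandermonde_def id_apply
proof (rule vandermonde_dvd)
  fix a b assume ab: "(a, b) \<in> index_pairs (length mu)"
  let ?n = "length mu" and ?\<tau> = "transpose a b"
  have ab': "a < b" "b < ?n" using ab by (auto simp: index_pairs_def)
  let ?f = "\<lambda>w. identify a b (sgn_of ?n w * hl_term t mu w)"
  have \<tau>: "?\<tau> permutes {..<?n}"
    using ab' by (intro permutes_swap_id) auto
  have neg: "?f (?\<tau> \<circ> w) = - ?f w" if "w permutes {..<?n}" for w
  proof -
    have "(poly_var(a := poly_var b)) (?\<tau> i) = (poly_var(a := poly_var b) :: _ \<Rightarrow> 'a mpoly) i" for i
      by (auto simp: transpose_def)
    then have "identify a b (hl_term t mu (?\<tau> \<circ> w)) = identify a b (hl_term t mu w)"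
      by (simp add: hl_term_def identify_def poly_const.meval_mult poly_const.meval_prod
            poly_const.meval_diff poly_const.meval_power case_prod_beta del: fun_upd_apply)
    then show ?thesis
      using sgn_of_transpose_comp[OF ab' that, where 'a = 'a]
      by (simp add: identify_def poly_const.meval_mult poly_const.meval_uminus)
  qed
  have "bij_betw (\<lambda>w. ?\<tau> \<circ> w) {w. w permutes {..<?n}} {w. w permutes {..<?n}}"
    by (rule bij_betw_byWitness[where f' = "\<lambda>w. ?\<tau> \<circ> w"])
       (auto simp: comp_assoc[symmetric] intro: permutes_compose[OF _ \<tau>])
  from sum.reindex_bij_betw[OF this, of ?f]
  have "(\<Sum>w | w permutes {..<?n}. ?f w) = (\<Sum>w | w permutes {..<?n}. - ?f w)"
    using neg by simp
  then have "(\<Sum>w | w permutes {..<?n}. ?f w) + (\<Sum>w | w permutes {..<?n}. ?f w) = 0"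
    by (simp add: sum_negf add_eq_0_iff)
  then have "poly_const 2 * (\<Sum>w | w permutes {..<?n}. ?f w) = 0"
    using poly_const_add[of "1::'a" 1] by (simp add: distrib_right)
  moreover have "poly_const (2::'a) \<noteq> 0"
    using assms by (metis poly_const_def single_zero lookup_single_eq lookup_zero)
  ultimately have "identify a b (hl_numerator t mu) = 0"
    by (simp add: hl_numerator_def identify_def poly_const.meval_sum)
  with ab' show "a < b \<and> identify a b (hl_numerator t mu) = 0" by simp
qed simp

lemma hl_rational_eq:
  "hl_rational t mu = 1 / to_fract (poly_const (hl_v t mu)) *
    (to_fract (hl_numerator t mu) / to_fract (vandermonde (length mu) id))"
proof -
  let ?n = "length mu" and ?X = "\<lambda>i. to_fract (poly_var i)"
  have hom: "to_fract (prod f A) = (\<Prod>i\<in>A. to_fract (f i))" "to_fract (sum g B) = (\<Sum>i\<in>B. to_fract (g i))"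
    for f :: "'i \<Rightarrow> 'a mpoly" and A and g :: "'j \<Rightarrow> 'a mpoly" and B
  proof -
    show "to_fract (prod f A) = (\<Prod>i\<in>A. to_fract (f i))"
      by (induction A rule: infinite_finite_induct) simp_all
    show "to_fract (sum g B) = (\<Sum>i\<in>B. to_fract (g i))"
      by (induction B rule: infinite_finite_induct) simp_all
  qed
  have hom_pow: "to_fract (p ^ k) = to_fract p ^ k" for p :: "'a mpoly" and k
    by (induction k) simp_all
  have "(\<Sum>w | w permutes {..<?n}. (\<Prod>i<?n. ?X (w i) ^ (mu ! i)) *
      (\<Prod>(i, j)\<in>{(i, j). i < j \<and> j < ?n}.
        (?X (w i) - to_fract (poly_const t) * ?X (w j)) / (?X (w i) - ?X (w j)))) =
    (\<Sum>w | w permutes {..<?n}. to_fract (sgn_of ?n w * hl_term t mu w) / to_fract (vandermonde ?n id))"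
  proof (intro sum.cong refl)
    fix w assume "w \<in> {w. w permutes {..<?n}}"
    then have w: "w permutes {..<?n}" by simp
    have "vandermonde ?n w * sgn_of ?n w = (vandermonde ?n id :: 'a mpoly)"
      using sgn_of_square[of ?n w, where 'a = "'a mpoly"]
      by (simp add: vandermonde_permute[OF w] mult_ac)
    then have V: "to_fract (vandermonde ?n id :: 'a mpoly) =
        to_fract (vandermonde ?n w) * to_fract (sgn_of ?n w)"
      by (metis to_fract_mult)
    have "to_fract (sgn_of ?n w :: 'a mpoly) \<noteq> 0"
      using sgn_of_square[of ?n w, where 'a = "'a mpoly"] by auto
    then have "to_fract (sgn_of ?n w * hl_term t mu w) / to_fract (vandermonde ?n id) =
        to_fract (hl_term t mu w) / to_fract (vandermonde ?n w)"
      unfolding V by simp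
    also have "\<dots> = (\<Prod>i<?n. ?X (w i) ^ (mu ! i)) *
      (\<Prod>(i, j)\<in>{(i, j). i < j \<and> j < ?n}.
        (?X (w i) - to_fract (poly_const t) * ?X (w j)) / (?X (w i) - ?X (w j)))"
      by (simp add: hl_term_def vandermonde_def hom hom_pow case_prod_beta index_pairs_def prod_dividef)
    finally show "(\<Prod>i<?n. ?X (w i) ^ (mu ! i)) *
      (\<Prod>(i, j)\<in>{(i, j). i < j \<and> j < ?n}.
        (?X (w i) - to_fract (poly_const t) * ?X (w j)) / (?X (w i) - ?X (w j))) =
      to_fract (sgn_of ?n w * hl_term t mu w) / to_fract (vandermonde ?n id)" ..
  qed
  also have "\<dots> = to_fract (hl_numerator t mu) / to_fract (vandermonde ?n id)"
    by (simp only: hl_numerator_def hom sum_divide_distrib)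
  finally show ?thesis
    by (simp only: hl_rational_def Let_def)
qed

text \<open>Free of fractions, so that evaluations, which are ring homomorphisms on polynomials
  only, can be applied to it.\<close>

lemma hl_poly_eq:
  assumes "(2::'a::field) \<noteq> 0" "hl_v t mu \<noteq> 0"
  shows "poly_const (hl_v t mu) * hl_poly t mu * vandermonde (length mu) id = hl_numerator (t::'a) mu"
proof -
  obtain q where q: "hl_numerator t mu = vandermonde (length mu) id * q"
    using vandermonde_dvd_hl_numerator[OF assms(1)] unfolding dvd_def by blast
  let ?p = "poly_const (1 / hl_v t mu) * q"
  have vp: "poly_const (hl_v t mu) * ?p = q"
    using assms(2) by (simp add: mult.assoc[symmetric] poly_const_mult[symmetric])
  have ne: "poly_const (hl_v t mu) \<noteq> 0"
    using assms(2) by (metis poly_const_def single_zero lookup_single_eq lookup_zero)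
  have "hl_rational t mu = 1 / to_fract (poly_const (hl_v t mu)) * to_fract q"
    unfolding hl_rational_eq q using vandermonde_nonzero[of "length mu", where 'a = 'a] by simp
  also have "to_fract q = to_fract (poly_const (hl_v t mu)) * to_fract ?p"
    by (subst vp[symmetric]) (simp only: to_fract_mult)
  finally have "to_fract ?p = hl_rational t mu"
    using ne by simp
  then have "hl_poly t mu = ?p"
    unfolding hl_poly_def by (intro the_equality) (metis to_fract_eq_iff)+
  then have "poly_const (hl_v t mu) * hl_poly t mu = q"
    using vp by (simp only:)
  then show ?thesis
    by (simp add: q)
qed

lemma (in coeff_hom) meval_sgn_of: "meval x (sgn_of n w) = sgn_of n w"
  by (auto simp: sgn_of_def meval_prod meval_uminus intro!: prod.cong)

section \<open>Values of Hall-Littlewood polynomials and their stability\<close>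

locale field_hom = coeff_hom h for h :: "'c::field \<Rightarrow> 'b::field"
begin

lemma h_eq_0_iff [simp]: "h a = 0 \<longleftrightarrow> a = 0"
proof
  assume "h a = 0"
  show "a = 0"
  proof (rule ccontr)
    assume "a \<noteq> 0"
    then have "h (a * inverse a) = 1" by simp
    then show False using \<open>h a = 0\<close> by (simp only: h_mult mult_zero_left zero_neq_one)
  qed
qed simp

lemma h_eq_1_iff [simp]: "h a = 1 \<longleftrightarrow> a = 1"
  using h_eq_0_iff[of "a - 1"] by (simp add: h_diff del: h_eq_0_iff)

lemma h_divide: "h (a / b) = h a / h b"
proof (cases "b = 0")
  case False
  then have "h (a / b) * h b = h a" by (simp flip: h_mult)
  then show ?thesis using False by (simp add: field_simps)
qed simp

lemma h_hl_v: "h (hl_v t mu) = hl_v (h t) mu"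
  by (simp add: hl_v_def h_prod h_divide h_diff h_power)

lemma h_coefficient: "h (coefficient t la) = coefficient (h t) la"
  by (simp add: coefficient_def c_factor_def h_prod h_divide h_diff h_power h_mult)

lemma not_root_of_unity:
  "(\<And>j. j \<ge> 1 \<Longrightarrow> t ^ j \<noteq> 1) \<Longrightarrow> j \<ge> 1 \<Longrightarrow> h t ^ j \<noteq> 1"
  by (simp flip: h_power)

text \<open>Since x is injective, the Vandermonde product has a nonzero value and can be cancelled
  from the evaluated form of \<open>hl_poly_eq\<close>.\<close>

lemma meval_hl_poly:
  assumes "inj x" "(2::'c) \<noteq> 0" "\<And>j. j \<ge> 1 \<Longrightarrow> t ^ j \<noteq> 1"
  shows "meval x (hl_poly t mu) = alphabet.hl_value x (h t) mu"
proof -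
  interpret X: alphabet x "h t" by unfold_locales (rule assms(1))
  let ?n = "length mu"
  let ?V = "meval x (vandermonde ?n id)"
  have V: "?V = (\<Prod>(i, j)\<in>index_pairs ?n. x i - x j)"
    by (simp add: vandermonde_def meval_prod case_prod_beta meval_diff)
  have "?V \<noteq> 0"
    unfolding V by (subst prod_zero_iff[OF finite_index_pairs]) (auto simp: index_pairs_def)
  have v: "hl_v t mu \<noteq> 0"
    using assms(3) by (rule hl_v_nonzero)
  have term_eq: "meval x (sgn_of ?n w * hl_term t mu w) =
      (\<Prod>i<?n. x (w i) ^ (mu ! i)) *
      (\<Prod>(i, j)\<in>{(i, j). i < j \<and> j < ?n}. X.factor (w i) (w j)) * ?V" if w: "w permutes {..<?n}" for w
  proof -
    let ?Vw = "\<Prod>(i, j)\<in>index_pairs ?n. x (w i) - x (w j)"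
    have ne: "?Vw \<noteq> 0"
      using permutes_inj[OF w]
      by (subst prod_zero_iff[OF finite_index_pairs]) (auto simp: index_pairs_def dest: injD)
    have "?Vw = meval x (vandermonde ?n w)"
      by (simp add: vandermonde_def meval_prod case_prod_beta meval_diff)
    also have "\<dots> = sgn_of ?n w * ?V"
      by (simp add: vandermonde_permute[OF w] meval_mult meval_sgn_of)
    finally have "sgn_of ?n w * ?Vw = ?V"
      using sgn_of_square[of ?n w, where 'a = 'b] by (simp add: mult.assoc[symmetric])
    moreover have "meval x (hl_term t mu w) = (\<Prod>i<?n. x (w i) ^ (mu ! i)) *
      (\<Prod>(i, j)\<in>{(i, j). i < j \<and> j < ?n}. X.factor (w i) (w j)) * ?Vw"
    proof -
      have "(\<Prod>(i, j)\<in>index_pairs ?n. x (w i) - h t * x (w j)) =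
          (\<Prod>(i, j)\<in>index_pairs ?n. X.factor (w i) (w j)) * ?Vw"
        using ne by (simp add: case_prod_beta prod_dividef)
      then show ?thesis
        by (simp add: hl_term_def meval_mult meval_prod meval_power meval_diff case_prod_beta
              index_pairs_def)
    qed
    ultimately show ?thesis
      by (simp add: meval_mult meval_sgn_of mult_ac)
  qed
  have "h (hl_v t mu) * meval x (hl_poly t mu) * ?V = meval x (hl_numerator t mu)"
    unfolding hl_poly_eq[OF assms(2) v, symmetric] by (simp add: meval_mult)
  also have "\<dots> = (\<Sum>w | w permutes {..<?n}. (\<Prod>i<?n. x (w i) ^ (mu ! i)) *
      (\<Prod>(i, j)\<in>{(i, j). i < j \<and> j < ?n}. X.factor (w i) (w j))) * ?V"
    by (simp add: hl_numerator_def meval_sum term_eq sum_distrib_right)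
  finally have "h (hl_v t mu) * meval x (hl_poly t mu) =
      (\<Sum>w | w permutes {..<?n}. (\<Prod>i<?n. x (w i) ^ (mu ! i)) *
      (\<Prod>(i, j)\<in>{(i, j). i < j \<and> j < ?n}. X.factor (w i) (w j)))"
    using \<open>?V \<noteq> 0\<close> by simp
  then show ?thesis
    using v unfolding X.hl_value_def h_hl_v[symmetric] by (simp add: field_simps)
qed

lemma meval_hl_poly_HL:
  assumes "inj x" "(2::'c) \<noteq> 0" "\<And>j. j \<ge> 1 \<Longrightarrow> t ^ j \<noteq> 1" "0 \<notin> set la"
  shows "meval x (hl_poly t (la @ replicate k 0)) = alphabet.HL x (h t) la {..<length la + k}"
proof -
  interpret X: alphabet x "h t" by unfold_locales (rule assms(1))
  show ?thesis
    using meval_hl_poly[OF assms(1-3)] X.hl_value_eq_HL[OF not_root_of_unity assms(4)] assms(3)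
    by simp
qed

end

abbreviation to_field :: "'a::field \<Rightarrow> 'a mpoly fract" where
  "to_field c \<equiv> to_fract (poly_const c)"

interpretation to_field: field_hom to_field
  by unfold_locales (simp_all add: poly_const_add poly_const_mult)

lemma to_fract_monom_value: "to_fract (monom_value x m) = monom_value (\<lambda>i. to_fract (x i)) m"
proof -
  have "to_fract (p ^ k) = to_fract p ^ k" for p :: 'a and k
    by (induction k) simp_all
  moreover have "to_fract (prod f A) = (\<Prod>i\<in>A. to_fract (f i))" for f :: "nat \<Rightarrow> 'a" and A
    by (induction A rule: infinite_finite_induct) simp_all
  ultimately show ?thesis
    by (simp add: monom_value_def)
qed

lemma to_fract_sum: "to_fract (sum f A) = (\<Sum>i\<in>A. to_fract (f i))"
  by (induction A rule: infinite_finite_induct) simp_all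

lemma to_field_meval: "to_field.meval (\<lambda>i. to_fract (x i)) p = to_fract (subst_vars x p)"
  by (simp add: to_field.meval_def poly_const.meval_def to_fract_sum to_fract_monom_value)

lemma lookup_subst_zero:
  fixes p :: "'a::idom mpoly"
  assumes "n \<notin> keys m"
  shows "lookup (subst_vars (poly_var(n := 0)) p) m = lookup p m"
proof -
  have mv: "monom_value (poly_var(n := 0)) a =
      (if n \<in> keys a then 0 else single a (1::'a))" for a
  proof (cases "n \<in> keys a")
    case True
    then show ?thesis
      unfolding monom_value_def by (auto simp: in_keys_iff intro!: prod_zero)
  next
    case False
    then have "monom_value (poly_var(n := 0)) a = (monom_value poly_var a :: 'a mpoly)"
      unfolding monom_value_def by (intro prod.cong) auto
    then show ?thesis
      using False by (simp add: monom_value_poly_var)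
  qed
  have "lookup (subst_vars (poly_var(n := 0)) p) m =
      (\<Sum>a\<in>keys p. if a = m then lookup p m else 0)"
    unfolding poly_const.meval_def lookup_sum mv
    using assms by (intro sum.cong) (auto simp: poly_const_def mult_single lookup_single when_def)
  then show ?thesis
    by (auto simp: in_keys_iff)
qed

text \<open>Putting the last variable to 0 does not affect monomials without it, and leaves an
  injective alphabet, since a single letter becomes 0. There \<open>rows_zero_variable\<close>
  compares the two polynomials.\<close>

lemma lookup_hl_poly_stable:
  fixes t :: "'a::field"
  assumes "(2::'a) \<noteq> 0" "\<And>j. j \<ge> 1 \<Longrightarrow> t ^ j \<noteq> 1" "0 \<notin> set la"
    and "length la + k \<notin> keys m"
  shows "lookup (hl_poly t (la @ replicate (Suc k) 0)) m =
    lookup (hl_poly t (la @ replicate k 0)) m"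
proof -
  let ?n = "length la + k"
  let ?x = "\<lambda>i. to_fract ((poly_var(?n := 0)) i :: 'a mpoly)"
  have var_nz: "poly_var i \<noteq> (0 :: 'a mpoly)" for i
    by (metis poly_var_def lookup_single_eq lookup_zero zero_neq_one)
  have inj: "inj ?x"
    by (rule injI) (auto simp: var_nz var_nz[symmetric] split: if_splits)
  interpret X: alphabet ?x "to_field t" by unfold_locales (rule inj)
  have "X.HL la {..<length la + Suc k} = X.HL la {..<?n}"
    unfolding X.HL_def add_Suc_right lessThan_Suc using assms(3)
    by (subst X.rows_zero_variable) auto
  then have "to_field.meval ?x (hl_poly t (la @ replicate (Suc k) 0)) =
      to_field.meval ?x (hl_poly t (la @ replicate k 0))"
    using to_field.meval_hl_poly_HL[OF inj assms(1-3), of "Suc k"]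
      to_field.meval_hl_poly_HL[OF inj assms(1-3), of k] by simp
  then have "subst_vars (poly_var(?n := 0)) (hl_poly t (la @ replicate (Suc k) 0)) =
      subst_vars (poly_var(?n := 0)) (hl_poly t (la @ replicate k 0))"
    unfolding to_field_meval by (simp only: to_fract_eq_iff)
  then show ?thesis
    using lookup_subst_zero[OF assms(4)] by metis
qed

section \<open>Total degree as the order of a Laurent series\<close>

definition monom_degree :: "(nat \<Rightarrow>\<^sub>0 nat) \<Rightarrow> nat" where
  "monom_degree m = (\<Sum>i\<in>keys m. lookup m i)"

lemma monom_degree_add: "monom_degree (a + b) = monom_degree a + monom_degree b"
proof -
  have sup: "monom_degree m = (\<Sum>i\<in>A. lookup m i)"
    if "finite A" "keys m \<subseteq> A" for m A
    unfolding monom_degree_def using that by (intro sum.mono_neutral_left) (auto simp: in_keys_iff)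
  let ?A = "keys a \<union> keys b"
  have "keys (a + b) \<subseteq> ?A" by (rule keys_add)
  then show ?thesis
    by (simp add: sup[of ?A] lookup_add sum.distrib)
qed

text \<open>
  Evaluating at $x_i = X_i z$ in the field of formal Laurent series in $z$ makes the total degree
  visible as the power of $z$.
\<close>

abbreviation to_fls :: "'a::field \<Rightarrow> 'a mpoly fract fls" where
  "to_fls c \<equiv> fls_const (to_field c)"

definition graded_var :: "nat \<Rightarrow> 'a::field mpoly fract fls" where
  "graded_var i = fls_const (to_fract (poly_var i)) * fls_X"

interpretation to_fls: field_hom to_fls
  by unfold_locales (simp_all add: poly_const_add poly_const_mult flip: fls_plus_const)

lemma monom_value_graded_var:
  "monom_value graded_var m =
    fls_const (to_fract (single m (1::'a::field))) * fls_X ^ monom_degree m"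
proof -
  have "fls_const (prod f A) = (\<Prod>i\<in>A. fls_const (f i))"
    for f :: "nat \<Rightarrow> 'a mpoly fract" and A
    by (induction A rule: infinite_finite_induct) (simp_all flip: fls_const_mult_const)
  then have "monom_value graded_var m =
      fls_const (monom_value (\<lambda>i. to_fract (poly_var i :: 'a mpoly)) m) * fls_X ^ monom_degree m"
    by (simp add: monom_value_def graded_var_def power_mult_distrib prod.distrib
          fls_const_power power_sum monom_degree_def)
  then show ?thesis
    by (simp flip: to_fract_monom_value add: monom_value_poly_var)
qed

text \<open>The coefficient of z^d is the homogeneous component of degree d, still a polynomial
  although the Laurent series have coefficients in the field of fractions.\<close>

lemma fls_nth_meval:
  "fls_nth (to_fls.meval graded_var p) (int d) =
    to_fract (\<Sum>m\<in>keys p. single m (lookup p m when monom_degree m = d))"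
proof -
  have nth_sum: "fls_nth (sum f A) k = (\<Sum>i\<in>A. fls_nth (f i) k)"
    for f :: "(nat \<Rightarrow>\<^sub>0 nat) \<Rightarrow> 'a mpoly fract fls" and A k
    by (induction A rule: infinite_finite_induct) simp_all
  have "to_fls c * monom_value graded_var m =
      fls_const (to_fract (single m c)) * fls_X ^ monom_degree m" for c :: 'a and m
    by (simp add: monom_value_graded_var mult.assoc[symmetric] poly_const_def mult_single
          flip: to_fract_mult)
  then show ?thesis
    unfolding to_fls.meval_def nth_sum to_fract_sum
    by (intro sum.cong) (auto simp: when_def)
qed

lemma lookup_eq_0_if_fls_nth:
  assumes "fls_nth (to_fls.meval graded_var p) (int (monom_degree m)) = 0"
  shows "lookup p m = 0"
proof -
  have "(\<Sum>a\<in>keys p.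
      single a (lookup p a when monom_degree a = monom_degree m)) = 0"
    using assms unfolding fls_nth_meval by (simp only: to_fract_eq_0_iff)
  then have "lookup (\<Sum>a\<in>keys p.
      single a (lookup p a when monom_degree a = monom_degree m)) m = 0"
    by simp
  then have "(\<Sum>a\<in>keys p. if a = m then lookup p m else 0) = 0"
    unfolding lookup_sum by (subst (asm) sum.cong[OF refl]) (auto simp: lookup_single when_def)
  then show ?thesis
    by (auto simp: in_keys_iff split: if_splits)
qed

lemma inj_graded_var: "inj (graded_var :: nat \<Rightarrow> 'a::field mpoly fract fls)"
proof (rule injI)
  fix i j
  assume "graded_var i = (graded_var j :: 'a mpoly fract fls)"
  then have "fls_const (to_fract (poly_var i :: 'a mpoly)) = fls_const (to_fract (poly_var j))"
    unfolding graded_var_def by (subst (asm) mult_right_cancel) auto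
  then have "fls_nth (fls_const (to_fract (poly_var i :: 'a mpoly))) 0 = fls_nth (fls_const (to_fract (poly_var j))) 0"
    by simp
  then show "i = j" by simp
qed

text \<open>The z-adic valuation is at least d. The zero series, whose subdegree is 0 by convention,
  has to count as being of infinite order.\<close>

definition order_ge :: "int \<Rightarrow> 'b::field fls \<Rightarrow> bool" where
  "order_ge d f \<longleftrightarrow> f = 0 \<or> d \<le> fls_subdegree f"

lemma order_ge_0 [simp]: "order_ge d 0"
  by (simp add: order_ge_def)

lemma order_ge_const [simp]: "order_ge 0 (fls_const c)"
  by (simp add: order_ge_def)

lemma order_ge_1 [simp]: "order_ge 0 1"
  by (simp add: order_ge_def)

lemma order_ge_add: "order_ge d f \<Longrightarrow> order_ge d g \<Longrightarrow> order_ge d (f + g)"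
  unfolding order_ge_def by (metis add_0 add.right_neutral fls_plus_subdegree min.bounded_iff order_trans)

lemma order_ge_uminus: "order_ge d f \<Longrightarrow> order_ge d (- f)"
  by (simp add: order_ge_def)

lemma order_ge_diff: "order_ge d f \<Longrightarrow> order_ge d g \<Longrightarrow> order_ge d (f - g)"
  using order_ge_add[of d f "- g"] order_ge_uminus[of d g] by simp

lemma order_ge_mult: "order_ge d f \<Longrightarrow> order_ge e g \<Longrightarrow> order_ge (d + e) (f * g)"
  by (cases "f = 0 \<or> g = 0") (auto simp: order_ge_def)

lemma order_ge_mult_0: "order_ge 0 f \<Longrightarrow> order_ge 0 g \<Longrightarrow> order_ge 0 (f * g)"
  using order_ge_mult[of 0 f 0 g] by simp

lemma order_ge_prod: "(\<And>i. i \<in> A \<Longrightarrow> order_ge 0 (f i)) \<Longrightarrow> order_ge 0 (prod f A)"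
  by (induction A rule: infinite_finite_induct) (auto simp: order_ge_mult_0)

lemma order_ge_sum: "(\<And>i. i \<in> A \<Longrightarrow> order_ge d (f i)) \<Longrightarrow> order_ge d (sum f A)"
  by (induction A rule: infinite_finite_induct) (auto simp: order_ge_add)

lemma order_ge_inverse_1_minus:
  assumes "order_ge 1 f"
  shows "order_ge 0 (1 / (1 - f))" "f \<noteq> 1"
proof -
  have "fls_nth f k = 0" if "k < 1" for k
    using assms that by (auto simp: order_ge_def)
  then have nth: "fls_nth (1 - f) 0 = 1" "\<And>k. k < 0 \<Longrightarrow> fls_nth (1 - f) k = 0"
    by auto
  then have ne: "1 - f \<noteq> 0"
    by (metis fls_zero_nth zero_neq_one)
  have "fls_subdegree (1 - f) = 0"
    using ne nth by (intro antisym fls_subdegree_leI fls_subdegree_geI) (simp_all del: fls_minus_nth)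
  with ne show "order_ge 0 (1 / (1 - f))" "f \<noteq> 1"
    by (auto simp: order_ge_def divide_inverse)
qed

lemma order_ge_nth: "order_ge d f \<Longrightarrow> k < d \<Longrightarrow> fls_nth f k = 0"
  by (auto simp: order_ge_def)

section \<open>Comparison of the two sides in n variables, up to a given degree\<close>

lemma (in alphabet) rows_eq_0:
  "finite S \<Longrightarrow> card S < length la \<Longrightarrow> rows la S = 0"
proof (induction la arbitrary: S)
  case (Cons p la)
  have "rows la (S - {a}) = 0" if "a \<in> S" for a
  proof (rule Cons.IH)
    have "card S = Suc (card (S - {a}))"
      using that Cons.prems(1) by (metis card_Suc_Diff1)
    then show "finite (S - {a})" "card (S - {a}) < length la"
      using Cons.prems by simp_all
  qed
  then show ?case
    using Cons.prems(1) by (simp add: row_star)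
qed simp

lemma lessThan_pairs: "{(i, j). i \<in> {..<n} \<and> j \<in> {..<n} \<and> i < j} = index_pairs n"
  unfolding index_pairs_def by (intro Collect_cong) (auto simp: split_beta)

text \<open>2 \<noteq> 0 is for the antisymmetry argument, the condition on powers of t keeps every
  v_\<lambda>(t) nonzero, and t itself occurs in denominators.\<close>

locale generic_parameter =
  fixes t :: "'a::field"
  assumes two_nonzero: "(2::'a) \<noteq> 0"
    and not_root_of_unity: "j \<ge> 1 \<Longrightarrow> t ^ j \<noteq> 1"
    and t_nonzero: "t \<noteq> 0"
begin

sublocale graded: alphabet graded_var "to_fls t"
  by unfold_locales (rule inj_graded_var)

abbreviation poly_C :: "'a \<Rightarrow> 'a mpoly" where
  "poly_C \<equiv> poly_const"

abbreviation poly_X :: "nat \<Rightarrow> 'a mpoly" where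
  "poly_X \<equiv> poly_var"

lemma poly_X_nonzero: "poly_X i \<noteq> 0"
  by (metis poly_var_def lookup_single_eq lookup_zero zero_neq_one)

abbreviation Z :: "nat \<Rightarrow> 'a mpoly fract fls" where
  "Z \<equiv> graded_var"

lemma Z_nonzero: "Z i \<noteq> 0"
  by (simp add: graded_var_def poly_X_nonzero)

lemma subdegree_Z: "fls_subdegree (Z i) = 1"
  by (simp add: graded_var_def poly_X_nonzero)

lemma to_fls_t_nonzero: "to_fls t \<noteq> 0"
  unfolding to_fls.h_eq_0_iff by (rule t_nonzero)

lemma divide_t: "f / to_fls t = f * to_fls (1 / t)"
proof -
  have "to_fls (1 / t) = 1 / to_fls t"
    unfolding to_fls.h_divide to_fls.h_1 ..
  then show ?thesis
    by (simp only: times_divide_eq_right mult_1_right)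
qed

lemma order_ge_divide_t: "order_ge d f \<Longrightarrow> order_ge d (f / to_fls t)"
  unfolding divide_t using order_ge_mult[OF _ order_ge_const, of d f] by (simp only: add_0_right)

lemma Z_mult_neq_t: "Z i * Z j \<noteq> to_fls t"
proof
  assume "Z i * Z j = to_fls t"
  then have "fls_subdegree (Z i * Z j) = 0" by simp
  then show False by (simp add: Z_nonzero subdegree_Z)
qed

lemma factor_const: "\<exists>c. graded.factor i j = fls_const c"
proof -
  let ?c = "to_fract (poly_X i) - to_field t * to_fract (poly_X j)"
  let ?d = "to_fract (poly_X i) - to_fract (poly_X j)"
  have "Z i - to_fls t * Z j = fls_const ?c * fls_X"
    unfolding graded_var_def fls_minus_const[symmetric] fls_const_mult_const[symmetric]
    by (simp only: algebra_simps)
  moreover have "Z i - Z j = fls_const ?d * fls_X"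
    unfolding graded_var_def fls_minus_const[symmetric]
    by (simp only: algebra_simps)
  ultimately have "graded.factor i j = fls_const (?c / ?d)"
    by (simp add: fls_const_divide_const)
  then show ?thesis by blast
qed

lemma prod_const: "(\<And>i. i \<in> A \<Longrightarrow> \<exists>c. f i = fls_const c) \<Longrightarrow> \<exists>c. prod f A = fls_const (c::'b::comm_semiring_1)"
proof (induction A rule: infinite_finite_induct)
  case (insert a A)
  then obtain c d where "f a = fls_const c" "prod f A = fls_const d" by blast
  then show ?case using insert(1,2) by (auto simp: fls_const_mult_const)
qed (auto intro!: exI[of _ 1])

text \<open>In each factor of \<open>cross\<close> the z of numerator and denominator cancel
  (\<open>factor_const\<close>), so only the powers prescribed by the parts remain.\<close>

lemma rows_homogeneous:
  "finite S \<Longrightarrow> \<exists>c. graded.rows la S = fls_const c * fls_X ^ sum_list la"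
proof (induction la arbitrary: S)
  case Nil
  then show ?case by (auto simp: graded.E_def intro: exI[of _ 1])
next
  case (Cons p la)
  have "\<exists>c. Z a ^ p * (\<Prod>b\<in>S - {a}. graded.factor a b) * graded.rows la (S - {a}) =
      fls_const c * fls_X ^ sum_list (p # la)" for a
  proof -
    have "\<exists>c. (\<Prod>b\<in>S - {a}. graded.factor a b) = fls_const c"
      by (intro prod_const factor_const)
    then obtain c where c: "(\<Prod>b\<in>S - {a}. graded.factor a b) = fls_const c"
      by (elim exE)
    have "finite (S - {a})" using Cons.prems by simp
    from Cons.IH[OF this] obtain d where d: "graded.rows la (S - {a}) = fls_const d * fls_X ^ sum_list la"
      by (elim exE)
    have "Z a ^ p * fls_const c * (fls_const d * fls_X ^ sum_list la) =
        (fls_const (to_fract (poly_X a)) ^ p * fls_const c * fls_const d) * fls_X ^ sum_list (p # la)"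
      by (simp only: graded_var_def power_mult_distrib power_add sum_list.Cons mult_ac)
    also have "\<dots> = fls_const (to_fract (poly_X a) ^ p * c * d) * fls_X ^ sum_list (p # la)"
      by (simp only: fls_const_power[symmetric] fls_const_mult_const)
    finally show ?thesis
      unfolding c d by blast
  qed
  then obtain c where "\<And>a. Z a ^ p * (\<Prod>b\<in>S - {a}. graded.factor a b) * graded.rows la (S - {a}) =
      fls_const (c a) * fls_X ^ sum_list (p # la)"
    by metis
  then have "graded.rows (p # la) S = (\<Sum>a\<in>S. fls_const (c a)) * fls_X ^ sum_list (p # la)"
    using Cons.prems by (simp only: graded.rows.simps graded.row_star sum_distrib_right)
  moreover have "(\<Sum>a\<in>S. fls_const (c a)) = fls_const (\<Sum>a\<in>S. c a)"
    by (induction S rule: infinite_finite_induct) (simp_all add: fls_plus_const)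
  ultimately show ?case by metis
qed

lemma HL_homogeneous:
  assumes "finite S"
  shows "\<exists>c. graded.HL la S = fls_const c * fls_X ^ sum_list la"
proof -
  obtain c where "graded.rows la S = fls_const c * fls_X ^ sum_list la"
    using rows_homogeneous[OF assms] by blast
  then have "graded.HL la S = fls_const (c / to_field (hl_v t la)) * fls_X ^ sum_list la"
    unfolding graded.HL_def to_fls.h_hl_v[symmetric] fls_const_divide_const[symmetric]
    by simp
  then show ?thesis by blast
qed

lemma meval_hl_poly:
  "0 \<notin> set la \<Longrightarrow> to_fls.meval Z (hl_poly t (la @ replicate k 0)) = graded.HL la {..<length la + k}"
  by (intro to_fls.meval_hl_poly_HL inj_graded_var two_nonzero not_root_of_unity)

lemma lookup_hl_poly_degree:
  assumes "0 \<notin> set la" "monom_degree m \<noteq> sum_list la"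
  shows "lookup (hl_poly t (la @ replicate k 0)) m = 0"
proof (rule lookup_eq_0_if_fls_nth)
  obtain c where "graded.HL la {..<length la + k} = fls_const c * fls_X ^ sum_list la"
    using HL_homogeneous by blast
  then show "fls_nth (to_fls.meval Z (hl_poly t (la @ replicate k 0))) (int (monom_degree m)) = 0"
    using assms by (simp add: meval_hl_poly)
qed

lemma order_ge_cross: "order_ge 0 (graded.cross A B)"
  unfolding graded.cross_def
proof (intro order_ge_prod)
  fix i j
  show "order_ge 0 (graded.factor i j)"
    using factor_const[of i j] by auto
qed

lemma order_ge_E: "(\<And>i. order_ge 0 (u i)) \<Longrightarrow> order_ge 0 (graded.E u S)"
  unfolding graded.E_def by (cases "finite S") (simp_all only: if_True if_False order_ge_0 order_ge_prod)

lemma order_ge_star: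
  "(\<And>S. order_ge 0 (f S)) \<Longrightarrow> (\<And>S. order_ge 0 (g S)) \<Longrightarrow> order_ge 0 (graded.star f g S)"
  unfolding graded.star_def by (intro order_ge_sum order_ge_mult_0 order_ge_cross)

lemma order_ge_Z: "order_ge 0 (Z i)" "order_ge 1 (Z i)"
  by (simp_all add: order_ge_def subdegree_Z)

lemma order_ge_Z2: "order_ge 2 (Z i * Z j)"
  using order_ge_mult[OF order_ge_Z(2) order_ge_Z(2)] by simp

lemma order_ge_weaken: "order_ge d f \<Longrightarrow> e \<le> d \<Longrightarrow> order_ge e f"
  by (auto simp: order_ge_def)

lemma order_ge_tau: "order_ge (2 * int k) (graded.tau k i)"
proof (induction k)
  case (Suc k)
  have "order_ge 2 (Z i ^ 2 / to_fls t)"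
    using order_ge_divide_t[OF order_ge_Z2[of i i]] by (simp only: power2_eq_square)
  from order_ge_mult[OF this Suc] show ?case
    by (simp add: algebra_simps)
qed simp

lemma order_ge_two_levels: "order_ge 0 (graded.two_levels S)"
  unfolding graded.two_levels_def
  by (intro order_ge_E order_ge_mult_0 order_ge_add order_ge_diff order_ge_divide_t order_ge_Z order_ge_1)

lemma order_ge_tail: "order_ge 0 (graded.tail k S)"
proof (induction k arbitrary: S)
  case (Suc k)
  have "order_ge 0 (graded.tau k i)" for i
    by (rule order_ge_weaken[OF order_ge_tau]) simp
  then show ?case
    unfolding graded.tail.simps graded.twist_def
    by (intro order_ge_star order_ge_mult_0 order_ge_E order_ge_two_levels Suc)
qed (simp add: graded.layer_def)

lemma inverse_factors:
  "order_ge 0 (1 / (1 - Z i * Z j / to_fls t))" "1 - Z i * Z j / to_fls t \<noteq> 0"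
proof -
  have "order_ge 1 (Z i * Z j / to_fls t)"
    by (rule order_ge_weaken[OF order_ge_divide_t[OF order_ge_Z2]]) simp
  from order_ge_inverse_1_minus[OF this] show
    "order_ge 0 (1 / (1 - Z i * Z j / to_fls t))" "1 - Z i * Z j / to_fls t \<noteq> 0"
    by simp_all
qed

lemma order_ge_closed_form: "order_ge 0 (graded.closed_form S)"
proof -
  have "order_ge 0 (graded.ratio 1 (1 / to_fls t) i j)" for i j
  proof -
    have "graded.ratio 1 (1 / to_fls t) i j = (1 - Z i * Z j) * (1 / (1 - Z i * Z j / to_fls t))"
      by (simp add: graded.ratio_def)
    then show ?thesis
      using inverse_factors(1)[of i j] by (simp only: order_ge_mult_0 order_ge_diff order_ge_1 order_ge_Z)
  qed
  then have "order_ge 0 (graded.pairs 1 (1 / to_fls t) S)"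
    unfolding graded.pairs_def by (auto intro!: order_ge_prod)
  moreover have "order_ge 0 ((1 + Z i / to_fls t) * (1 - Z i) / (1 - Z i ^ 2 / to_fls t))" for i
  proof -
    have "(1 + Z i / to_fls t) * (1 - Z i) / (1 - Z i ^ 2 / to_fls t) =
        (1 + Z i / to_fls t) * (1 - Z i) * (1 / (1 - Z i * Z i / to_fls t))"
      by (simp add: power2_eq_square)
    then show ?thesis
      using inverse_factors(1)[of i i]
      by (simp only: order_ge_mult_0 order_ge_add order_ge_diff order_ge_divide_t order_ge_1 order_ge_Z)
  qed
  ultimately show ?thesis
    unfolding graded.closed_form_def graded.twist_def by (intro order_ge_mult_0 order_ge_E)
qed

lemma order_ge_levels_diff:
  assumes "finite S"
  shows "order_ge (2 * int k) (graded.levels (2 * k) S - graded.closed_form S)"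
proof -
  have "order_ge (2 * int k) (graded.cross T (S - T) *
      (graded.E (graded.tau k) T * (1 - graded.closed_form T) * graded.tail k (S - T)))"
    if T: "T \<in> Pow S - {{}}" for T
  proof -
    \<comment> \<open>One letter of the non-empty T already supplies the order 2k; everything else
      has order at least 0.\<close>
    obtain a where a: "a \<in> T" "finite T" using T assms by (auto intro: finite_subset)
    have "order_ge 0 (graded.tau k i)" for i
      by (rule order_ge_weaken[OF order_ge_tau]) simp
    then have "order_ge (2 * int k + 0) (graded.tau k a * (\<Prod>i\<in>T - {a}. graded.tau k i))"
      by (intro order_ge_mult order_ge_tau order_ge_prod)
    then have "order_ge (2 * int k) (graded.E (graded.tau k) T)"
      using a by (simp add: graded.E_def prod.remove)
    then have "order_ge (0 + (2 * int k + 0 + 0)) (graded.cross T (S - T) *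
      (graded.E (graded.tau k) T * (1 - graded.closed_form T) * graded.tail k (S - T)))"
      by (intro order_ge_mult order_ge_cross order_ge_diff order_ge_1 order_ge_closed_form order_ge_tail)
    then show ?thesis by simp
  qed
  then show ?thesis
    unfolding graded.levels_diff[OF Z_nonzero to_fls_t_nonzero Z_mult_neq_t] by (intro order_ge_sum)
qed

text \<open>\<open>numer\<close> and \<open>denom\<close> write the closed form in n variables as a
  fraction of polynomials, with the factors 1 + X_i already cancelled.\<close>

definition numer :: "nat \<Rightarrow> 'a mpoly" where
  "numer n = (\<Prod>i<n. (1 + poly_X i * poly_C (1 / t)) * (1 - poly_X i)) *
    (\<Prod>(i, j)\<in>index_pairs n. 1 - poly_X i * poly_X j)"

definition denom :: "nat \<Rightarrow> 'a mpoly" where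
  "denom n = (\<Prod>i<n. 1 - poly_X i * poly_X i * poly_C (1 / t)) *
    (\<Prod>(i, j)\<in>index_pairs n. 1 - poly_X i * poly_X j * poly_C (1 / t))"

text \<open>The subtraction in \<open>n - length la\<close> truncates, so longer partitions must be
  excluded for the padded list to have n entries.\<close>

definition partition_sum :: "nat \<Rightarrow> nat \<Rightarrow> 'a mpoly" where
  "partition_sum n M = (\<Sum>la\<in>{la \<in> partitions_in n M. length la \<le> n}.
    poly_C (coefficient t la) * hl_poly t (la @ replicate (n - length la) 0))"

lemma meval_partition_sum: "to_fls.meval Z (partition_sum n M) = graded.levels M {..<n}"
proof -
  have "to_fls.meval Z (partition_sum n M) =
      (\<Sum>la\<in>{la \<in> partitions_in n M. length la \<le> n}. coefficient (to_fls t) la * graded.HL la {..<n})"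
    unfolding partition_sum_def to_fls.meval_sum to_fls.meval_mult to_fls.meval_const to_fls.h_coefficient
  proof (rule sum.cong[OF refl])
    fix la assume la: "la \<in> {la \<in> partitions_in n M. length la \<le> n}"
    then have "0 \<notin> set la"
      using partitions_in_props[of la n M] by (auto simp: is_partition_def)
    then show "coefficient (to_fls t) la * to_fls.meval Z (hl_poly t (la @ replicate (n - length la) 0)) =
        coefficient (to_fls t) la * graded.HL la {..<n}"
      using la by (simp add: meval_hl_poly)
  qed
  also have "\<dots> = (\<Sum>la\<in>partitions_in n M. coefficient (to_fls t) la * graded.HL la {..<n})"
  \<comment> \<open>The excluded partitions have more rows than there are letters, so their values
    are 0.\<close>
  proof (rule sum.mono_neutral_left)
    have "graded.HL la {..<n} = 0" if "\<not> length la \<le> n" for la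
      using that by (simp add: graded.HL_def graded.rows_eq_0)
    then show "\<forall>la\<in>partitions_in n M - {la \<in> partitions_in n M. length la \<le> n}.
        coefficient (to_fls t) la * graded.HL la {..<n} = 0"
      by simp
  qed auto
  also have "\<dots> = graded.levels M {..<n}"
    using to_fls.not_root_of_unity[OF not_root_of_unity]
    by (intro graded.sum_HL_eq_levels) auto
  finally show ?thesis .
qed

lemma meval_numer: "to_fls.meval Z (numer n) = graded.closed_form {..<n} * to_fls.meval Z (denom n)"
proof -
  let ?\<phi> = "\<lambda>i. (1 + Z i / to_fls t) * (1 - Z i) / (1 - Z i ^ 2 / to_fls t)"
  let ?D1 = "\<Prod>i<n. 1 - Z i * Z i / to_fls t"
  let ?D2 = "\<Prod>(i, j)\<in>index_pairs n. 1 - Z i * Z j / to_fls t"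
  have a: "graded.pairs 1 (1 / to_fls t) {..<n} * ?D2 = (\<Prod>(i, j)\<in>index_pairs n. 1 - Z i * Z j)"
    unfolding graded.pairs_def lessThan_pairs prod.distrib[symmetric]
    using inverse_factors(2) by (intro prod.cong) (auto simp: graded.ratio_def)
  have b: "graded.E ?\<phi> {..<n} * ?D1 = (\<Prod>i<n. (1 + Z i / to_fls t) * (1 - Z i))"
    using inverse_factors(2)
    by (simp add: graded.E_def power2_eq_square flip: prod.distrib)
  have c: "to_fls.meval Z (numer n) = (\<Prod>i<n. (1 + Z i / to_fls t) * (1 - Z i)) *
      (\<Prod>(i, j)\<in>index_pairs n. 1 - Z i * Z j)"
    unfolding numer_def divide_t
    by (simp only: to_fls.meval_mult to_fls.meval_prod to_fls.meval_diff to_fls.meval_add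
        case_prod_unfold to_fls.meval_1 to_fls.meval_var to_fls.meval_const)
  have d: "to_fls.meval Z (denom n) = ?D1 * ?D2"
    unfolding denom_def divide_t
    by (simp only: to_fls.meval_mult to_fls.meval_prod to_fls.meval_diff
        case_prod_unfold to_fls.meval_1 to_fls.meval_var to_fls.meval_const)
  have "to_fls.meval Z (numer n) = (graded.E ?\<phi> {..<n} * ?D1) * (graded.pairs 1 (1 / to_fls t) {..<n} * ?D2)"
    by (simp only: a b c)
  also have "\<dots> = (graded.E ?\<phi> {..<n} * graded.pairs 1 (1 / to_fls t) {..<n}) * (?D1 * ?D2)"
    by (simp only: mult_ac)
  finally show ?thesis
    by (simp only: d graded.closed_form_def graded.twist_def)
qed

lemma order_ge_meval_denom: "order_ge 0 (to_fls.meval Z (denom n))"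
  unfolding denom_def to_fls.meval_mult to_fls.meval_prod case_prod_unfold to_fls.meval_diff
    to_fls.meval_1 to_fls.meval_var to_fls.meval_const
  by (intro order_ge_mult_0 order_ge_prod order_ge_diff order_ge_1 order_ge_Z order_ge_const)

text \<open>Multiplication by \<open>denom\<close> makes the difference a polynomial, so a bound on
  its order in z says something about its coefficients.\<close>

lemma lookup_difference:
  assumes "monom_degree m < 2 * k"
  shows "lookup (partition_sum n (2 * k) * denom n - numer n) m = 0"
proof (rule lookup_eq_0_if_fls_nth)
  let ?p = "partition_sum n (2 * k) * denom n - numer n"
  have "to_fls.meval Z (?p) =
      (graded.levels (2 * k) {..<n} - graded.closed_form {..<n}) * to_fls.meval Z (denom n)"
    by (simp only: to_fls.meval_diff to_fls.meval_mult meval_partition_sum meval_numer left_diff_distrib)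
  moreover have "order_ge (2 * int k + 0)
      ((graded.levels (2 * k) {..<n} - graded.closed_form {..<n}) * to_fls.meval Z (denom n))"
    by (intro order_ge_mult order_ge_levels_diff order_ge_meval_denom finite_lessThan)
  ultimately have "order_ge (2 * int k) (to_fls.meval Z (?p))"
    by (simp only: add_0_right)
  then show "fls_nth (to_fls.meval Z (?p)) (int (monom_degree m)) = 0"
    by (rule order_ge_nth) (use assms in simp)
qed

end

section \<open>Formal power series\<close>

lemma mfps_coeff_simps [simp]:
  "mfps_coeff (0 :: 'a::comm_ring_1 mfps) m = 0"
  "mfps_coeff (1 :: 'a mfps) m = (if m = 0 then 1 else 0)"
  "mfps_coeff (f + g) m = mfps_coeff f m + mfps_coeff (g :: 'a mfps) m"
  "mfps_coeff (f - g) m = mfps_coeff f m - mfps_coeff (g :: 'a mfps) m"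
  by (transfer; simp)+

lemma mfps_coeff_mult:
  "mfps_coeff (f * g) m = (\<Sum>(a, b)\<in>splits_of m. mfps_coeff f a * mfps_coeff (g :: 'a::comm_ring_1 mfps) b)"
  by transfer simp

lemma mfps_coeff_sum:
  "mfps_coeff (sum f A) m = (\<Sum>i\<in>A. mfps_coeff (f i :: 'a::comm_ring_1 mfps) m)"
  by (induction A rule: infinite_finite_induct) simp_all

lemma mfps_coeff_of_poly: "mfps_coeff (mfps_of_poly p) m = lookup p m"
  by (simp add: mfps_of_poly_def Abs_mfps_inverse)

lemma mfps_of_poly_add: "mfps_of_poly (p + q) = mfps_of_poly p + (mfps_of_poly q :: 'a::comm_ring_1 mfps)"
  and mfps_of_poly_diff: "mfps_of_poly (p - q) = mfps_of_poly p - (mfps_of_poly q :: 'a::comm_ring_1 mfps)"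
  and mfps_of_poly_0 [simp]: "mfps_of_poly 0 = (0 :: 'a::comm_ring_1 mfps)"
  and mfps_of_poly_1 [simp]: "mfps_of_poly 1 = (1 :: 'a::comm_ring_1 mfps)"
  by (rule mfps_eqI; simp add: mfps_coeff_of_poly lookup_add lookup_minus lookup_one when_def; fail)+

lemma mfps_of_poly_sum:
  "mfps_of_poly (sum f A) = (\<Sum>i\<in>A. mfps_of_poly (f i) :: 'a::comm_ring_1 mfps)"
  by (induction A rule: infinite_finite_induct) (simp_all add: mfps_of_poly_add)

lemma mfps_of_poly_single_mult:
  "mfps_of_poly (single (a + b) (c * d)) =
    mfps_of_poly (single a c) * (mfps_of_poly (single b d) :: 'a::comm_ring_1 mfps)"
proof (rule mfps_eqI)
  fix m
  have "mfps_coeff (mfps_of_poly (single a c) * mfps_of_poly (single b d)) m =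
      (\<Sum>z\<in>splits_of m. if z = (a, b) then c * d else 0)"
    unfolding mfps_coeff_mult mfps_coeff_of_poly
    by (intro sum.cong) (auto simp: lookup_single when_def split: if_splits)
  also have "\<dots> = (if (a, b) \<in> splits_of m then c * d else 0)"
    by simp
  also have "\<dots> = (if a + b = m then c * d else 0)"
    by (simp add: splits_of_def)
  finally show "mfps_coeff (mfps_of_poly (single (a + b) (c * d))) m =
      mfps_coeff (mfps_of_poly (single a c) * mfps_of_poly (single b d)) m"
    by (simp add: mfps_coeff_of_poly lookup_single when_def)
qed

lemma mfps_of_poly_mult:
  "mfps_of_poly (p * q) = mfps_of_poly p * (mfps_of_poly q :: 'a::comm_ring_1 mfps)"
proof -
  have "mfps_of_poly (p * q) = (\<Sum>a\<in>keys p. \<Sum>b\<in>keys q.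
      mfps_of_poly (single a (lookup p a)) *
      mfps_of_poly (single b (lookup q b)))"
    by (simp only: mult_poly_mapping_eq_sum[of p q] mfps_of_poly_sum mfps_of_poly_single_mult)
  also have "\<dots> = mfps_of_poly (\<Sum>a\<in>keys p. single a (lookup p a)) *
      mfps_of_poly (\<Sum>b\<in>keys q. single b (lookup q b))"
    unfolding mfps_of_poly_sum by (rule sum_product[symmetric])
  finally show ?thesis
    unfolding poly_mapping_eq_sum[of p, symmetric] poly_mapping_eq_sum[of q, symmetric] .
qed

lemma mfps_of_poly_prod:
  "mfps_of_poly (prod f A) = (\<Prod>i\<in>A. mfps_of_poly (f i) :: 'a::comm_ring_1 mfps)"
  by (induction A rule: infinite_finite_induct) (simp_all add: mfps_of_poly_mult)

definition agree_on :: "(nat \<Rightarrow>\<^sub>0 nat) set \<Rightarrow> 'a mfps \<Rightarrow> 'a mfps \<Rightarrow> bool" where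
  "agree_on D f g \<longleftrightarrow> (\<forall>m\<in>D. mfps_coeff f m = mfps_coeff g m)"

text \<open>The condition under which the coefficients of a product on D depend only on those of its
  factors on D. It is used for the monomials of bounded degree and for those in the first n
  variables.\<close>

definition divisor_closed :: "(nat \<Rightarrow>\<^sub>0 nat) set \<Rightarrow> bool" where
  "divisor_closed D \<longleftrightarrow> (\<forall>a b. a + b \<in> D \<longrightarrow> a \<in> D \<and> b \<in> D)"

lemma agree_on_refl [simp]: "agree_on D f f"
  by (simp add: agree_on_def)

lemma agree_on_mult:
  assumes "divisor_closed D" "agree_on D f f'" "agree_on D g (g' :: 'a::comm_ring_1 mfps)"
  shows "agree_on D (f * g) (f' * g')"
  unfolding agree_on_def
proof
  fix m assume m: "m \<in> D"
  have "mfps_coeff f a * mfps_coeff g b = mfps_coeff f' a * mfps_coeff g' b"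
    if "(a, b) \<in> splits_of m" for a b
  proof -
    have "a + b \<in> D"
      using m that by (simp add: splits_of_def)
    then have "a \<in> D" "b \<in> D"
      using assms(1)[unfolded divisor_closed_def, rule_format] by metis+
    then show ?thesis
      using assms(2,3) by (simp add: agree_on_def)
  qed
  then show "mfps_coeff (f * g) m = mfps_coeff (f' * g') m"
    unfolding mfps_coeff_mult by (intro sum.cong) auto
qed

lemma agree_on_prod:
  "divisor_closed D \<Longrightarrow> (\<And>i. i \<in> A \<Longrightarrow> agree_on D (f i) (g i :: 'a::comm_ring_1 mfps)) \<Longrightarrow>
    agree_on D (prod f A) (prod g A)"
  by (induction A rule: infinite_finite_induct) (auto simp: agree_on_mult)

lemma divisor_closed_degree: "divisor_closed {m. monom_degree m \<le> d}"
  by (auto simp: divisor_closed_def monom_degree_add)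

definition monoms_in :: "nat \<Rightarrow> (nat \<Rightarrow>\<^sub>0 nat) set" where
  "monoms_in n = {m. keys m \<subseteq> {..<n}}"

lemma divisor_closed_monoms_in: "divisor_closed (monoms_in n)"
proof -
  have "keys a \<subseteq> keys (a + b)" for a b :: "nat \<Rightarrow>\<^sub>0 nat"
    by (auto simp: in_keys_iff lookup_add)
  moreover from this have "keys b \<subseteq> keys (a + b)" for a b :: "nat \<Rightarrow>\<^sub>0 nat"
    by (metis add.commute)
  ultimately show ?thesis
    unfolding divisor_closed_def monoms_in_def by blast
qed

lemma monom_degree_eq_0_iff: "monom_degree m = 0 \<longleftrightarrow> m = 0"
proof
  assume "monom_degree m = 0"
  then have "\<forall>i\<in>keys m. lookup m i = 0"
    by (simp add: monom_degree_def)
  then show "m = 0"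
    by (intro poly_mapping_eqI) (metis in_keys_iff lookup_zero)
qed (simp add: monom_degree_def)

lemma mfps_power_coeff_eq_0:
  assumes "mfps_coeff g 0 = 0" "monom_degree m < k"
  shows "mfps_coeff (g ^ k) m = (0 :: 'a::comm_ring_1)"
  using assms(2)
proof (induction k arbitrary: m)
  case (Suc k)
  have "mfps_coeff g a * mfps_coeff (g ^ k) b = 0" if "(a, b) \<in> splits_of m" for a b
  proof (cases "a = 0")
    case False
    then have "monom_degree a \<noteq> 0"
      by (simp add: monom_degree_eq_0_iff)
    moreover have "monom_degree m = monom_degree a + monom_degree b"
      using that by (auto simp: splits_of_def monom_degree_add)
    ultimately show ?thesis
      using Suc by simp
  qed (simp add: assms(1))
  then show ?case
    unfolding power_Suc mfps_coeff_mult by (intro sum.neutral) auto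
qed simp

text \<open>u is the geometric series in g = 1 - f. As g has no constant term, g^k contributes only
  in degrees at least k, so each coefficient of u comes from a finite sum cut off at the degree of
  its monomial.\<close>

lemma mfps_unit:
  assumes "mfps_coeff f 0 = (1 :: 'a::comm_ring_1)"
  shows "f * inverse f = 1"
proof -
  define g where "g = 1 - f"
  have g0: "mfps_coeff g 0 = 0"
    by (simp add: g_def assms)
  define u where "u = Abs_mfps (\<lambda>m. mfps_coeff (\<Sum>k\<le>monom_degree m. g ^ k) m)"
  have "f * u = 1"
  proof (rule mfps_eqI)
    fix m
    let ?d = "monom_degree m"
    have "agree_on {a. monom_degree a \<le> ?d} u (\<Sum>k\<le>?d. g ^ k)"
      unfolding agree_on_def
    proof clarify
      fix a assume "monom_degree a \<le> ?d"
      then have "(\<Sum>k\<le>?d. mfps_coeff (g ^ k) a) = (\<Sum>k\<le>monom_degree a. mfps_coeff (g ^ k) a)"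
        by (intro sum.mono_neutral_right) (auto simp: mfps_power_coeff_eq_0[OF g0])
      then show "mfps_coeff u a = mfps_coeff (\<Sum>k\<le>?d. g ^ k) a"
        by (simp add: u_def Abs_mfps_inverse mfps_coeff_sum)
    qed
    then have "agree_on {a. monom_degree a \<le> ?d} (f * u) (f * (\<Sum>k\<le>?d. g ^ k))"
      by (intro agree_on_mult divisor_closed_degree) auto
    then have "mfps_coeff (f * u) m = mfps_coeff (f * (\<Sum>k\<le>?d. g ^ k)) m"
      by (simp add: agree_on_def)
    also have "f * (\<Sum>k\<le>?d. g ^ k) = 1 - g ^ Suc ?d"
      using one_diff_power_eq[of g "Suc ?d"] by (simp add: g_def lessThan_Suc_atMost)
    also have "mfps_coeff (1 - g ^ Suc ?d) m = mfps_coeff 1 m"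
      using mfps_power_coeff_eq_0[OF g0, of m "Suc ?d"] by simp
    finally show "mfps_coeff (f * u) m = mfps_coeff 1 m" .
  qed
  then show ?thesis
    using mfps_inverse_unique by metis
qed

definition var_bound :: "(nat \<Rightarrow>\<^sub>0 nat) \<Rightarrow> nat" where
  "var_bound m = Suc (Max (insert 0 (keys m)))"

lemma in_monoms_in_var_bound: "m \<in> monoms_in (var_bound m)"
  by (auto simp: monoms_in_def var_bound_def less_Suc_eq_le simp del: Max_insert)

text \<open>J n collects the factors that are relevant to the first n variables; the others act as 1
  on such monomials. Every coefficient is thus eventually constant along the net of finite
  subproducts.\<close>

lemma infprod_agree:
  fixes f :: "'i \<Rightarrow> 'a::comm_ring_1 mfps"
  assumes "\<And>n. finite (J n)" "\<And>n. J n \<subseteq> A"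
    and "\<And>n i. i \<in> A - J n \<Longrightarrow> agree_on (monoms_in n) (f i) 1"
  shows "agree_on (monoms_in n) (infprod f A) (prod f (J n))"
proof -
  have agree: "agree_on (monoms_in n) (prod f F) (prod f (J n))"
    if "finite F" "J n \<subseteq> F" "F \<subseteq> A" for F n
  proof -
    have "prod f F = prod f (F - J n) * prod f (J n)"
      by (rule prod.subset_diff[OF that(2,1)])
    moreover have "agree_on (monoms_in n) (prod f (F - J n)) (\<Prod>i\<in>F - J n. 1)"
      using that assms(3) by (intro agree_on_prod divisor_closed_monoms_in) auto
    then have "agree_on (monoms_in n) (prod f (F - J n) * prod f (J n)) (1 * prod f (J n))"
      by (intro agree_on_mult divisor_closed_monoms_in) auto
    ultimately show ?thesis by simp
  qed
  \<comment> \<open>The limit is assembled coefficient by coefficient, using for each monomial a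
    finite subproduct that sees all its variables.\<close>
  define G where "G = Abs_mfps (\<lambda>m. mfps_coeff (prod f (J (var_bound m))) m)"
  have G: "mfps_coeff G m = mfps_coeff (prod f (J (var_bound m))) m" for m
    by (simp add: G_def Abs_mfps_inverse)
  have "(prod f \<longlongrightarrow> G) (finite_subsets_at_top A)"
    unfolding tendsto_mfps_iff eventually_finite_subsets_at_top
  proof
    fix m
    show "\<exists>X. finite X \<and> X \<subseteq> A \<and> (\<forall>Y. finite Y \<and> X \<subseteq> Y \<and> Y \<subseteq> A \<longrightarrow> mfps_coeff (prod f Y) m = mfps_coeff G m)"
    proof (intro exI[of _ "J (var_bound m)"] conjI allI impI assms(1,2))
      fix Y assume "finite Y \<and> J (var_bound m) \<subseteq> Y \<and> Y \<subseteq> A"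
      then have "agree_on (monoms_in (var_bound m)) (prod f Y) (prod f (J (var_bound m)))"
        by (intro agree) auto
      then show "mfps_coeff (prod f Y) m = mfps_coeff G m"
        using in_monoms_in_var_bound[of m] by (simp add: G agree_on_def)
    qed
  qed
  then have "infprod f A = G"
    unfolding infprod_def by (intro tendsto_Lim) simp_all
  moreover have "agree_on (monoms_in n) G (prod f (J n))"
    unfolding agree_on_def
  proof
    fix m assume m: "m \<in> monoms_in n"
    \<comment> \<open>The sets J n are not assumed to be nested, so the two subproducts are compared
      through a common larger one.\<close>
    let ?F = "J n \<union> J (var_bound m)"
    have "agree_on (monoms_in n) (prod f ?F) (prod f (J n))"
        "agree_on (monoms_in (var_bound m)) (prod f ?F) (prod f (J (var_bound m)))"
      using assms(1,2) by (intro agree; simp)+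
    then have "mfps_coeff (prod f ?F) m = mfps_coeff (prod f (J n)) m"
        "mfps_coeff (prod f ?F) m = mfps_coeff (prod f (J (var_bound m))) m"
      using m in_monoms_in_var_bound[of m] unfolding agree_on_def by blast+
    then show "mfps_coeff G m = mfps_coeff (prod f (J n)) m"
      by (simp only: G)
  qed
  ultimately show ?thesis by simp
qed

lemma is_partition_bounds:
  assumes "is_partition la"
  shows "length la \<le> sum_list la" "r \<in> set la \<Longrightarrow> r \<le> sum_list la"
proof -
  show "length la \<le> sum_list la"
    using assms by (induction la) (auto simp: is_partition_Cons)
  show "r \<in> set la \<Longrightarrow> r \<le> sum_list la"
    by (simp add: member_le_sum_list)
qed

lemma splits_of_0: "splits_of 0 = {(0, 0)}"
proof -
  have zero: "a = 0" if "a + b = 0" for a b :: "nat \<Rightarrow>\<^sub>0 nat"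
  proof -
    have "monom_degree a + monom_degree b = monom_degree (a + b)"
      by (rule monom_degree_add[symmetric])
    also have "\<dots> = 0"
      unfolding that monom_degree_eq_0_iff ..
    finally show ?thesis
      by (simp add: monom_degree_eq_0_iff)
  qed
  have "z = (0, 0)" if split: "z \<in> splits_of 0" for z
  proof -
    obtain a b where z: "z = (a, b)" "a + b = 0"
      using split by (auto simp: splits_of_def)
    moreover have "b + a = 0"
      using z(2) by (simp only: add.commute)
    ultimately show ?thesis
      using zero[of a b] zero[of b a] by blast
  qed
  then show ?thesis
    by (auto simp: splits_of_def)
qed

lemma mfps_coeff_mult_0: "mfps_coeff (f * g) 0 = mfps_coeff f 0 * mfps_coeff (g :: 'a::comm_ring_1 mfps) 0"
  by (simp add: mfps_coeff_mult splits_of_0)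

section \<open>Passage to infinitely many variables\<close>

context generic_parameter
begin

text \<open>Once all variables of m are present, a further variable does not change the coefficient
  (\<open>lookup_hl_poly_stable\<close>), so the limit exists and has the value reached at that
  stage.\<close>

lemma hall_littlewood_coeff:
  assumes "0 \<notin> set la" "m \<in> monoms_in (length la + k)"
  shows "mfps_coeff (hall_littlewood t la) m =
    lookup (hl_poly t (la @ replicate k 0)) m"
proof -
  let ?P = "\<lambda>k. hl_poly t (la @ replicate k 0)"
  have stable: "lookup (?P (k + j)) m = lookup (?P k) m"
    if "m \<in> monoms_in (length la + k)" for m k j
  proof (induction j)
    case (Suc j)
    have "length la + (k + j) \<notin> keys m"
      using that by (auto simp: monoms_in_def)
    from lookup_hl_poly_stable[OF two_nonzero not_root_of_unity assms(1) this]
    show ?case using Suc by simp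
  qed simp
  define F where "F = Abs_mfps (\<lambda>m. lookup (?P (var_bound m)) m)"
  have F: "mfps_coeff F m = lookup (?P (var_bound m)) m" for m
    by (simp add: F_def Abs_mfps_inverse)
  have vb: "m \<in> monoms_in (length la + var_bound m)" for m
    using in_monoms_in_var_bound[of m] by (auto simp: monoms_in_def)
  have "(\<lambda>k. mfps_of_poly (?P k)) \<longlonglongrightarrow> F"
    unfolding tendsto_mfps_iff
  proof
    fix m
    have "mfps_coeff (mfps_of_poly (?P k)) m = mfps_coeff F m" if "k \<ge> var_bound m" for k
      using stable[OF vb, of m "k - var_bound m"] that by (simp add: mfps_coeff_of_poly F)
    then show "\<forall>\<^sub>F k in sequentially. mfps_coeff (mfps_of_poly (?P k)) m = mfps_coeff F m"
      by (auto simp: eventually_sequentially)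
  qed
  then have "hall_littlewood t la = F"
    unfolding hall_littlewood_def by (rule limI)
  then have "mfps_coeff (hall_littlewood t la) m = lookup (?P (var_bound m)) m"
    by (simp add: F)
  also have "\<dots> = lookup (?P (var_bound m + k)) m"
    by (rule stable[OF vb, symmetric])
  also have "\<dots> = lookup (?P k) m"
    using stable[OF assms(2), of "var_bound m"] by (simp add: add.commute)
  finally show ?thesis .
qed

abbreviation mX :: "nat \<Rightarrow> 'a mfps" where
  "mX \<equiv> mfps_var"

abbreviation mC :: "'a \<Rightarrow> 'a mfps" where
  "mC \<equiv> mfps_const"

definition fac1 :: "nat \<Rightarrow> 'a mfps" where
  "fac1 = (\<lambda>i. (1 + mX i / mC t) / (1 + mX i))"

definition fac2 :: "nat \<times> nat \<Rightarrow> 'a mfps" where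
  "fac2 = (\<lambda>(i, j). (1 - mX i * mX j) / (1 - mX i * mX j / mC t))"

lemma mfps_divide_t: "f / mC t = f * mC (1 / t)"
proof -
  have "mC t * mC (1 / t) = 1"
    using t_nonzero by (simp add: mfps_const_def mfps_of_poly_mult[symmetric] poly_const_mult[symmetric])
  then show ?thesis
    by (simp add: divide_mfps_def mfps_inverse_unique)
qed

lemma coeff_mX: "mfps_coeff (mX i) m = (if m = single i 1 then 1 else 0)"
  by (auto simp: mfps_var_def mfps_coeff_of_poly poly_var_def lookup_single when_def)

lemma coeff_mX_0: "mfps_coeff (mX i) 0 = 0"
proof -
  have "single i (1::nat) \<noteq> 0"
    by (metis lookup_single_eq lookup_zero zero_neq_one)
  then have "0 \<noteq> single i (1::nat)"
    by (rule not_sym)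
  then show ?thesis
    by (simp only: coeff_mX if_False)
qed

lemma units:
  "(1 + mX i) * inverse (1 + mX i) = 1"
  "(1 - mX i * mX j * mC (1 / t)) * inverse (1 - mX i * mX j * mC (1 / t)) = 1"
  by (rule mfps_unit; simp add: coeff_mX_0 mfps_coeff_mult_0)+

lemma mX_agree:
  assumes "i \<ge> n"
  shows "agree_on (monoms_in n) (mX i) 0"
proof -
  have "single i 1 \<notin> monoms_in n"
    using assms by (simp add: monoms_in_def)
  then show ?thesis
    by (auto simp: agree_on_def coeff_mX)
qed

text \<open>\<open>inverse g\<close> agrees with \<open>g * inverse g\<close>, which is 1, because g
  agrees with 1.\<close>

lemma agree_1_divide:
  assumes "agree_on (monoms_in n) f 1" "agree_on (monoms_in n) g 1" "g * inverse g = (1::'a mfps)"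
  shows "agree_on (monoms_in n) (f / g) 1"
proof -
  have "agree_on (monoms_in n) (1 * inverse g) (g * inverse g)"
    using assms(2) by (intro agree_on_mult divisor_closed_monoms_in) (auto simp: agree_on_def)
  then have "agree_on (monoms_in n) (inverse g) 1"
    using assms(3) by simp
  then have "agree_on (monoms_in n) (f * inverse g) (1 * 1)"
    by (intro agree_on_mult divisor_closed_monoms_in assms)
  then show ?thesis
    by (simp add: divide_mfps_def)
qed

lemma agree_0_mult:
  assumes "agree_on (monoms_in n) f 0"
  shows "agree_on (monoms_in n) (f * g) (0::'a mfps)"
  using agree_on_mult[OF divisor_closed_monoms_in assms agree_on_refl[of _ g]] by simp

lemma fac1_agree: "i \<ge> n \<Longrightarrow> agree_on (monoms_in n) (fac1 i) 1"
  unfolding fac1_def mfps_divide_t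
proof (intro agree_1_divide units)
  assume "i \<ge> n"
  from mX_agree[OF this] agree_0_mult[OF mX_agree[OF this], of "mC (1 / t)"]
  show "agree_on (monoms_in n) (1 + mX i * mC (1 / t)) 1" "agree_on (monoms_in n) (1 + mX i) 1"
    by (simp_all add: agree_on_def)
qed

lemma fac2_agree: "j \<ge> n \<Longrightarrow> agree_on (monoms_in n) (fac2 (i, j)) 1"
  unfolding fac2_def prod.case mfps_divide_t
proof (intro agree_1_divide units)
  assume "j \<ge> n"
  from agree_0_mult[OF mX_agree[OF this], of "mX i"]
    agree_0_mult[OF mX_agree[OF this], of "mX i * mC (1 / t)"]
  show "agree_on (monoms_in n) (1 - mX i * mX j) 1" "agree_on (monoms_in n) (1 - mX i * mX j * mC (1 / t)) 1"
    by (simp_all add: agree_on_def mult_ac)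
qed

definition limit_product :: "'a mfps" where
  "limit_product = infprod fac1 UNIV * infprod fac2 {(i, j). i \<le> j}"

definition finite_product :: "nat \<Rightarrow> 'a mfps" where
  "finite_product n = prod fac1 {..<n} * prod fac2 {(i, j). i \<le> j \<and> j < n}"

lemma limit_product_agree: "agree_on (monoms_in n) limit_product (finite_product n)"
  unfolding limit_product_def finite_product_def
proof (intro agree_on_mult divisor_closed_monoms_in)
  show "agree_on (monoms_in n) (infprod fac1 UNIV) (prod fac1 {..<n})"
    by (rule infprod_agree) (auto intro: fac1_agree)
  have "finite {(i, j). i \<le> j \<and> j < n}" for n :: nat
    by (rule finite_subset[of _ "{..<n} \<times> {..<n}"]) auto
  then show "agree_on (monoms_in n) (infprod fac2 {(i, j). i \<le> j}) (prod fac2 {(i, j). i \<le> j \<and> j < n})"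
    by (rule infprod_agree[where J = "\<lambda>n. {(i, j). i \<le> j \<and> j < n}"]) (auto intro: fac2_agree)
qed

lemma finite_product_denom: "finite_product n * mfps_of_poly (denom n) = mfps_of_poly (numer n)"
proof -
  let ?s = "mC (1 / t)"
  have diag: "{(i, j). i \<le> j \<and> j < n} = (\<lambda>i. (i, i)) ` {..<n} \<union> index_pairs n"
    unfolding index_pairs_def by (auto simp: image_iff)
  have "prod fac2 {(i, j). i \<le> j \<and> j < n} = (\<Prod>i<n. fac2 (i, i)) * prod fac2 (index_pairs n)"
  proof -
    have "(\<lambda>i. (i, i)) ` {..<n} \<inter> index_pairs n = {}"
      by (auto simp: index_pairs_def)
    then show ?thesis
      unfolding diag by (simp add: prod.union_disjoint prod.reindex inj_on_def)
  qed
  then have a: "finite_product n = (\<Prod>i<n. fac1 i * fac2 (i, i)) * prod fac2 (index_pairs n)"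
    by (simp add: finite_product_def prod.distrib mult.assoc)
  have b: "mfps_of_poly (denom n) = (\<Prod>i<n. 1 - mX i * mX i * ?s) *
      (\<Prod>(i, j)\<in>index_pairs n. 1 - mX i * mX j * ?s)"
    unfolding denom_def mfps_of_poly_mult mfps_of_poly_prod case_prod_unfold mfps_of_poly_diff
      mfps_of_poly_1 mfps_var_def mfps_const_def ..
  have c: "mfps_of_poly (numer n) = (\<Prod>i<n. (1 + mX i * ?s) * (1 - mX i)) *
      (\<Prod>(i, j)\<in>index_pairs n. 1 - mX i * mX j)"
    unfolding numer_def mfps_of_poly_mult mfps_of_poly_prod case_prod_unfold mfps_of_poly_diff
      mfps_of_poly_add mfps_of_poly_1 mfps_var_def mfps_const_def ..
  have d: "(\<Prod>i<n. fac1 i * fac2 (i, i)) * (\<Prod>i<n. 1 - mX i * mX i * ?s) =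
      (\<Prod>i<n. (1 + mX i * ?s) * (1 - mX i))"
    unfolding prod.distrib[symmetric]
  proof (rule prod.cong[OF refl])
    fix i
    have "fac1 i * fac2 (i, i) * (1 - mX i * mX i * ?s) =
        (1 + mX i * ?s) * (1 - mX i) * ((1 + mX i) * inverse (1 + mX i)) *
        ((1 - mX i * mX i * ?s) * inverse (1 - mX i * mX i * ?s))"
    proof -
      \<comment> \<open>The diagonal factor of \<open>fac2\<close> cancels the denominator of
        \<open>fac1\<close>, leaving the factor 1 - X_i of \<open>numer\<close>.\<close>
      have "1 - mX i * mX i = (1 - mX i) * (1 + mX i)"
        by (simp add: algebra_simps)
      then show ?thesis
        unfolding fac1_def fac2_def prod.case mfps_divide_t divide_mfps_def[of _ "1 + _"]
          divide_mfps_def[of _ "1 - _"] by (simp only: mult_ac)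
    qed
    then show "fac1 i * fac2 (i, i) * (1 - mX i * mX i * ?s) = (1 + mX i * ?s) * (1 - mX i)"
      by (simp only: units mult_1_right)
  qed
  have e: "prod fac2 (index_pairs n) * (\<Prod>(i, j)\<in>index_pairs n. 1 - mX i * mX j * ?s) =
      (\<Prod>(i, j)\<in>index_pairs n. 1 - mX i * mX j)"
    unfolding prod.distrib[symmetric]
  proof (rule prod.cong[OF refl], clarify)
    fix i j
    have "fac2 (i, j) * (1 - mX i * mX j * ?s) = (1 - mX i * mX j) *
        ((1 - mX i * mX j * ?s) * inverse (1 - mX i * mX j * ?s))"
      unfolding fac2_def prod.case mfps_divide_t divide_mfps_def[of _ "1 - _"] by (simp only: mult_ac)
    then show "fac2 (i, j) * (1 - mX i * mX j * ?s) = 1 - mX i * mX j"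
      by (simp only: units mult_1_right)
  qed
  have "finite_product n * mfps_of_poly (denom n) =
      ((\<Prod>i<n. fac1 i * fac2 (i, i)) * (\<Prod>i<n. 1 - mX i * mX i * ?s)) *
      (prod fac2 (index_pairs n) * (\<Prod>(i, j)\<in>index_pairs n. 1 - mX i * mX j * ?s))"
    unfolding a b by (simp only: mult_ac)
  also have "\<dots> = mfps_of_poly (numer n)"
    unfolding c d e ..
  finally show ?thesis .
qed

lemma coeff_denom_0: "mfps_coeff (mfps_of_poly (denom n)) 0 = 1"
proof -
  have coeff_prod: "mfps_coeff (prod f A) 0 = 1" if "\<And>i. i \<in> A \<Longrightarrow> mfps_coeff (f i) 0 = 1"
    for f :: "'i \<Rightarrow> 'a mfps" and A
    using that by (induction A rule: infinite_finite_induct) (simp_all add: mfps_coeff_mult_0)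
  have "mfps_coeff (mfps_of_poly (1 - poly_X i * poly_X j * poly_C (1 / t))) 0 = 1" for i j
    using coeff_mX_0[of i] by (simp add: mfps_var_def mfps_of_poly_mult mfps_of_poly_diff mfps_coeff_mult_0)
  then show ?thesis
    unfolding denom_def mfps_of_poly_mult[of "prod _ _"] mfps_of_poly_prod mfps_coeff_mult_0 case_prod_unfold
    by (simp only: coeff_prod mult_1_left)
qed

text \<open>\<open>denom\<close> has constant term 1 and is a unit; multiplying by its inverse
  preserves vanishing in all degrees up to that of m, so the equation for polynomials can be
  divided.\<close>

lemma partition_sum_coeff:
  assumes "monom_degree m < 2 * k"
  shows "lookup (partition_sum n (2 * k)) m = mfps_coeff (finite_product n) m"
proof -
  let ?Q = "mfps_of_poly (partition_sum n (2 * k))" and ?D = "mfps_of_poly (denom n)"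
  let ?R = "mfps_of_poly (partition_sum n (2 * k) * denom n - numer n)"
  have unit: "?D * inverse ?D = 1"
    by (rule mfps_unit[OF coeff_denom_0])
  have "?R = (?Q - finite_product n) * ?D"
    by (simp add: mfps_of_poly_diff mfps_of_poly_mult finite_product_denom[symmetric] left_diff_distrib)
  then have "?R * inverse ?D = ?Q - finite_product n"
    by (simp add: mult.assoc unit)
  moreover have "agree_on {a. monom_degree a \<le> monom_degree m} ?R 0"
    using assms lookup_difference[of _ k n] by (auto simp: agree_on_def mfps_coeff_of_poly)
  then have "agree_on {a. monom_degree a \<le> monom_degree m} (?R * inverse ?D) (0 * inverse ?D)"
    by (intro agree_on_mult divisor_closed_degree) auto
  ultimately have "mfps_coeff (?Q - finite_product n) m = 0"
    by (simp add: agree_on_def)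
  then show ?thesis
    by (simp add: mfps_coeff_of_poly)
qed

lemma lookup_const_mult: "lookup (poly_C c * p) m = c * lookup p m"
  unfolding poly_const_def
  by (simp add: mult_map_scale_conv_mult[symmetric] Poly_Mapping.map.rep_eq when_def)

lemma coeff_const_mult: "mfps_coeff (mC c * f) m = c * mfps_coeff f m"
proof -
  have "mfps_coeff (mC c * f) m = (\<Sum>z\<in>splits_of m. if z = (0, m) then c * mfps_coeff f m else 0)"
    unfolding mfps_coeff_mult mfps_const_def mfps_coeff_of_poly poly_const_def
    by (intro sum.cong) (auto simp: lookup_single when_def splits_of_def split: if_splits)
  also have "\<dots> = (if (0, m) \<in> splits_of m then c * mfps_coeff f m else 0)"
    by simp
  finally show ?thesis
    by (simp add: splits_of_def)
qed

lemma hall_littlewood_has_sum: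
  "((\<lambda>la. mC (c_factor t la / t ^ ((odd_parts la + sum_list la) div 2)) * hall_littlewood t la)
    has_sum limit_product) {la. is_partition la \<and> admissible la}"
  unfolding has_sum_def tendsto_mfps_iff eventually_finite_subsets_at_top
proof
  fix m
  let ?A = "{la. is_partition la \<and> admissible la}"
  let ?f = "\<lambda>la. mC (c_factor t la / t ^ ((odd_parts la + sum_list la) div 2)) * hall_littlewood t la"
  define d where "d = monom_degree m"
  \<comment> \<open>Enough variables for m to live in them and for every partition of d to have at
    most n rows.\<close>
  define n where "n = max (var_bound m) d"
  \<comment> \<open>Then 2k exceeds d, as \<open>partition_sum_coeff\<close> requires, and bounds
    all parts of a partition of d.\<close>
  define k where "k = Suc d"
  let ?B = "{la \<in> partitions_in n (2 * k). length la \<le> n}"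
  \<comment> \<open>By homogeneity only partitions of size d reach a monomial of degree d, so adding
    further partitions to this finite set does not change the coefficient.\<close>
  define X where "X = {la \<in> ?A. sum_list la = d}"
  have XB: "X \<subseteq> ?B"
  proof
    fix la assume "la \<in> X"
    then have la: "is_partition la" "length la \<le> d" "\<forall>r\<in>set la. r \<le> d"
      using is_partition_bounds[of la] by (auto simp: X_def)
    have "la \<in> partitions_in n (2 * k)"
    proof (rule in_partitions_in)
      show "\<forall>r\<in>set la. r \<le> 2 * k"
        using la(3) by (fastforce simp: k_def)
      show "length la \<le> n"
        using la(2) by (simp add: n_def)
    qed (rule la(1))
    then show "la \<in> ?B"
      using la(2) by (simp add: n_def)
  qed
  have finX: "finite X"
    using XB by (rule finite_subset) simp
  have m: "m \<in> monoms_in n"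
    using in_monoms_in_var_bound[of m] by (auto simp: monoms_in_def n_def)
  have coeff0: "mfps_coeff (?f la) m = 0" if "la \<in> ?A" "sum_list la \<noteq> d" for la
  proof -
    have "0 \<notin> set la" using that by (simp add: is_partition_def)
    moreover have "m \<in> monoms_in (length la + n)"
      using m by (auto simp: monoms_in_def)
    ultimately have "mfps_coeff (hall_littlewood t la) m = 0"
      using that(2) by (subst hall_littlewood_coeff[where k = n]) (simp_all add: lookup_hl_poly_degree d_def)
    then show ?thesis
      by (simp only: coeff_const_mult mult_zero_right)
  qed
  have coeffX: "mfps_coeff (?f la) m =
      lookup (poly_C (coefficient t la) * hl_poly t (la @ replicate (n - length la) 0)) m"
    if "la \<in> X" for la
  proof -
    have "0 \<notin> set la" "length la \<le> n"
      using that XB by (auto simp: X_def is_partition_def)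
    then have "mfps_coeff (hall_littlewood t la) m =
        lookup (hl_poly t (la @ replicate (n - length la) 0)) m"
      using m by (intro hall_littlewood_coeff) auto
    then show ?thesis
      using that by (simp add: coeff_const_mult lookup_const_mult coefficient_def X_def)
  qed
  have "(\<Sum>la\<in>X. mfps_coeff (?f la) m) =
      (\<Sum>la\<in>X. lookup (poly_C (coefficient t la) * hl_poly t (la @ replicate (n - length la) 0)) m)"
    using coeffX by (rule sum.cong[OF refl])
  also have "\<dots> = (\<Sum>la\<in>?B. lookup (poly_C (coefficient t la) *
      hl_poly t (la @ replicate (n - length la) 0)) m)"
  proof (rule sum.mono_neutral_left[OF _ XB])
    show "\<forall>la\<in>?B - X. lookup (poly_C (coefficient t la) *
        hl_poly t (la @ replicate (n - length la) 0)) m = 0"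
    proof
      fix la assume la: "la \<in> ?B - X"
      then have part: "is_partition la" "0 \<notin> set la"
        using partitions_in_props[of la n "2 * k"] by (auto simp: is_partition_def)
      show "lookup (poly_C (coefficient t la) *
          hl_poly t (la @ replicate (n - length la) 0)) m = 0"
      proof (cases "admissible la")
        case True
        then have "monom_degree m \<noteq> sum_list la"
          using la part by (auto simp: X_def d_def)
        then show ?thesis
          using part by (simp add: lookup_const_mult lookup_hl_poly_degree)
      qed (simp add: lookup_const_mult coefficient_def)
    qed
  qed simp
  also have "\<dots> = lookup (partition_sum n (2 * k)) m"
    by (simp add: partition_sum_def lookup_sum)
  also have "\<dots> = mfps_coeff (finite_product n) m"
    by (rule partition_sum_coeff) (simp add: k_def d_def)
  also have "\<dots> = mfps_coeff limit_product m"
    using limit_product_agree[of n] m by (simp add: agree_on_def)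
  finally have sumX: "(\<Sum>la\<in>X. mfps_coeff (?f la) m) = mfps_coeff limit_product m" .
  show "\<exists>X. finite X \<and> X \<subseteq> ?A \<and> (\<forall>Y. finite Y \<and> X \<subseteq> Y \<and> Y \<subseteq> ?A \<longrightarrow>
      mfps_coeff (sum ?f Y) m = mfps_coeff limit_product m)"
  proof (intro exI[of _ X] conjI allI impI)
    fix Y assume Y: "finite Y \<and> X \<subseteq> Y \<and> Y \<subseteq> ?A"
    have "(\<Sum>la\<in>Y. mfps_coeff (?f la) m) = (\<Sum>la\<in>X. mfps_coeff (?f la) m)"
      using Y coeff0 by (intro sum.mono_neutral_right) (auto simp: X_def)
    then show "mfps_coeff (sum ?f Y) m = mfps_coeff limit_product m"
      using sumX by (simp add: mfps_coeff_sum)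
  qed (use finX in \<open>auto simp: X_def\<close>)
qed

end

section \<open>The indeterminate over the rationals as a generic parameter\<close>

lemma generic_parameter_indeterminate: "generic_parameter (to_fract [:0, 1 :: rat:])"
proof
  have "(2 :: rat poly fract) = to_fract 2"
    by (metis one_add_one to_fract_1 to_fract_add)
  then show "(2 :: rat poly fract) \<noteq> 0"
    by simp
  show "to_fract [:0, 1 :: rat:] \<noteq> 0" by simp
  have pow: "to_fract p ^ j = to_fract (p ^ j)" for p :: "rat poly" and j
    by (induction j) simp_all
  show "to_fract [:0, 1 :: rat:] ^ j \<noteq> 1" if "j \<ge> 1" for j
  proof
    assume "to_fract [:0, 1 :: rat:] ^ j = 1"
    then have "[:0, 1 :: rat:] ^ j = 1"
      unfolding pow by (metis to_fract_1 to_fract_eq_iff)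
    then have "degree ([:0, 1 :: rat:] ^ j) = 0" by simp
    then show False using that by (simp add: degree_power_eq)
  qed
qed

theorem theorem2p8:
  fixes t :: "rat poly fract"
  assumes "t = to_fract [:0, 1:]"
  shows "((\<lambda>la. mfps_const (c_factor t la / t ^ ((odd_parts la + sum_list la) div 2)) *
              hall_littlewood t la)
          has_sum
            (infprod (\<lambda>i. (1 + mfps_var i / mfps_const t) / (1 + mfps_var i)) UNIV *
             infprod (\<lambda>(i, j). (1 - mfps_var i * mfps_var j) /
                               (1 - mfps_var i * mfps_var j / mfps_const t))
               {(i, j). i \<le> j}))
          {la. is_partition la \<and> (\<forall>p \<in> set la. even p \<longrightarrow> even (count_list la p))}"
proof -
  have t: "generic_parameter t"
    unfolding assms by (rule generic_parameter_indeterminate)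
  show ?thesis
    using generic_parameter.hall_littlewood_has_sum[OF t]
    unfolding generic_parameter.limit_product_def[OF t] generic_parameter.fac1_def[OF t]
      generic_parameter.fac2_def[OF t] admissible_def .
qed

end
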